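(* Let $n\ge 2$ and let $\mathcal{L}=\{L_1,\dots,L_n\}$ be an elliptic system of linearly independent complex vector fields on $\mathbb{R}^N$ with constant complex coefficients, and let $1<p<\infty$, $\frac1p+\frac1{p'}=1$. If $V\in L^p(\mathbb{R}^N,\mathbb{C}^n)$ and $W\in L^{p'}(\mathbb{R}^N,\mathbb{C}^n)$ satisfy, in the sense of distributions, $$\operatorname{div}_{\mathcal{L}^*}V\in L^p(\mathbb{R}^N)\quad\text{and}\quad \operatorname{curl}_{\mathcal{L}}W\in L^{p'}(\mathbb{R}^N,\mathbb{C}^{n\times n}),$$ then $V\cdot W$ belongs to the local Hardy space $h^1(\mathbb{R}^N)$. Moreover, there exists a constant $C>0$, independent of $V$ and $W$, such that $$\|V\cdot W\|_{h^1}\le C\left(\|V\|_{L^p}\|W\|_{L^{p'}}+\|\operatorname{div}_{\mathcal{L}^*}V\|_{L^p}\|W\|_{L^{p'}}+\|V\|_{L^p}\|\operatorname{curl}_{\mathcal{L}}W\|_{L^{p'}}\right).$$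
   Context: Let $N\ge2$. A complex vector field with constant coefficients on $\mathbb{R}^N$ is an operator $L_j=\sum_{k=1}^N c_{jk}\,\partial_{x_k}$ with $c_{jk}\in\mathbb{C}$; its formal adjoint is $L_j^*=-\sum_{k=1}^N\overline{c_{jk}}\,\partial_{x_k}$. The system $\{L_1,\dots,L_n\}$ is elliptic if for real $\xi\in\mathbb{R}^N$, $\sum_k c_{jk}\xi_k=0$ for all $j=1,\dots,n$ implies $\xi=0$ (equivalently, $\Delta_{\mathcal{L}}=\sum_j L_j^*L_j$ is elliptic). All operators act in the sense of distributions: $\operatorname{div}_{\mathcal{L}^*}V=\sum_{j=1}^n L_j^*V_j$ and $\operatorname{curl}_{\mathcal{L}}W=(L_iW_j-L_jW_i)_{1\le i,j\le n}$. The product is the Hermitian one: $V\cdot W=\sum_{j=1}^n V_j\overline{W_j}$. Local Hardy space: fix $\varphi\in\mathcal{S}(\mathbb{R}^N)$ with $\int\varphi\ne0$ and put $\varphi_t(x)=t^{-N}\varphi(x/t)$. A tempered distribution $f$ belongs to $h^1(\mathbb{R}^N)$ if $\|f\|_{h^1}:=\|m_\varphi f\|_{L^1}<\infty$, where $m_\varphi f(x)=\sup_{0<t<1}|\langle f,\varphi_t(x-\cdot)\rangle|$. Different choices of $\varphi$ give the same space with equivalent norms. *)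

theory Defs
  imports "HOL-Analysis.Analysis"
begin

definition partial_deriv :: "'d::finite \<Rightarrow> (real^'d \<Rightarrow> complex) \<Rightarrow> real^'d \<Rightarrow> complex" where
  "partial_deriv k f x = frechet_derivative f (at x) (axis k 1)"

text \<open>Iterated derivatives are indexed by lists of coordinate directions instead of multi-indices;
  each multi-index corresponds to at least one list, and for smooth functions the order in the list
  is irrelevant.\<close>

definition iter_partial :: "'d::finite list \<Rightarrow> (real^'d \<Rightarrow> complex) \<Rightarrow> real^'d \<Rightarrow> complex" where
  "iter_partial ks f = foldr partial_deriv ks f"

definition smooth :: "(real^'d::finite \<Rightarrow> complex) \<Rightarrow> bool" where
  "smooth f \<longleftrightarrow> (\<forall>ks x. iter_partial ks f differentiable (at x))"

definition test_functions :: "(real^'d::finite \<Rightarrow> complex) set" where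
  "test_functions = {\<psi>. smooth \<psi> \<and> compact (closure {x. \<psi> x \<noteq> 0})}"

definition schwartz_functions :: "(real^'d::finite \<Rightarrow> complex) set" where
  "schwartz_functions =
     {\<psi>. smooth \<psi> \<and> (\<forall>m ks. \<exists>B. \<forall>x. (1 + norm x) ^ m * cmod (iter_partial ks \<psi> x) \<le> B)}"

definition schwartz_seminorm :: "nat \<Rightarrow> (real^'d::finite \<Rightarrow> complex) \<Rightarrow> real" where
  "schwartz_seminorm m \<psi> =
     (SUP (ks, x) \<in> {ks. length ks \<le> m} \<times> UNIV. (1 + norm x) ^ m * cmod (iter_partial ks \<psi> x))"

text \<open>A distribution is a functional on functions of which only the values on test functions
  (respectively on Schwartz functions, in the tempered case) matter.\<close>

type_synonym 'd functional = "(real^'d \<Rightarrow> complex) \<Rightarrow> complex"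

definition tempered :: "'d::finite functional \<Rightarrow> bool" where
  "tempered u \<longleftrightarrow>
     (\<forall>\<psi>\<in>schwartz_functions. \<forall>\<eta>\<in>schwartz_functions. u (\<lambda>x. \<psi> x + \<eta> x) = u \<psi> + u \<eta>) \<and>
     (\<forall>a. \<forall>\<psi>\<in>schwartz_functions. u (\<lambda>x. a * \<psi> x) = a * u \<psi>) \<and>
     (\<exists>C m. \<forall>\<psi>\<in>schwartz_functions. cmod (u \<psi>) \<le> C * schwartz_seminorm m \<psi>)"

definition regular_dist :: "(real^'d::finite \<Rightarrow> complex) \<Rightarrow> 'd functional" where
  "regular_dist f = (\<lambda>\<psi>. LINT x|lebesgue. f x * \<psi> x)"

definition dist_represented_by :: "'d::finite functional \<Rightarrow> (real^'d \<Rightarrow> complex) \<Rightarrow> bool" where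
  "dist_represented_by u g \<longleftrightarrow> (\<forall>\<psi>\<in>test_functions. u \<psi> = regular_dist g \<psi>)"

definition dist_partial :: "'d::finite \<Rightarrow> 'd functional \<Rightarrow> 'd functional" where
  "dist_partial k u = (\<lambda>\<psi>. - u (partial_deriv k \<psi>))"

text \<open>The vector field with coefficients \<open>b\<close> is \<open>\<Sum>k. b\<^sub>k \<partial>\<^sub>k\<close>; a system is given by its matrix
  of coefficients, the row \<open>c $ j\<close> belonging to \<open>L\<^sub>j\<close>.\<close>

definition vf_apply :: "complex^'d::finite \<Rightarrow> 'd functional \<Rightarrow> 'd functional" where
  "vf_apply b u = (\<lambda>\<psi>. \<Sum>k\<in>UNIV. b $ k * dist_partial k u \<psi>)"

definition vf_adjoint :: "complex^'d::finite \<Rightarrow> complex^'d" where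
  "vf_adjoint b = (\<chi> k. - cnj (b $ k))"

definition lin_indep_system :: "complex^'d::finite^'n::finite \<Rightarrow> bool" where
  "lin_indep_system c \<longleftrightarrow>
     (\<forall>a::complex^'n. (\<Sum>j\<in>UNIV. a $ j *s c $ j) = 0 \<longrightarrow> (\<forall>j. a $ j = 0))"

definition elliptic_system :: "complex^'d::finite^'n::finite \<Rightarrow> bool" where
  "elliptic_system c \<longleftrightarrow>
     (\<forall>\<xi>::real^'d. (\<forall>j. (\<Sum>k\<in>UNIV. c $ j $ k * complex_of_real (\<xi> $ k)) = 0) \<longrightarrow> \<xi> = 0)"

definition div_adj :: "complex^'d::finite^'n::finite \<Rightarrow> (real^'d \<Rightarrow> complex^'n) \<Rightarrow> 'd functional" where
  "div_adj c V =
     (\<lambda>\<psi>. \<Sum>j\<in>UNIV. vf_apply (vf_adjoint (c $ j)) (regular_dist (\<lambda>x. V x $ j)) \<psi>)"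

definition curl_sys ::
  "complex^'d::finite^'n::finite \<Rightarrow> (real^'d \<Rightarrow> complex^'n) \<Rightarrow> 'n \<Rightarrow> 'n \<Rightarrow> 'd functional" where
  "curl_sys c W i j =
     (\<lambda>\<psi>. vf_apply (c $ i) (regular_dist (\<lambda>x. W x $ j)) \<psi>
        - vf_apply (c $ j) (regular_dist (\<lambda>x. W x $ i)) \<psi>)"

text \<open>\<open>L\<^sup>p\<close> for finite \<open>p\<close>, with functions instead of classes modulo null sets. Vectors and matrices
  carry the Euclidean (Frobenius) norm.\<close>

definition Lp_space :: "real \<Rightarrow> (real^'d::finite \<Rightarrow> 'b::real_normed_vector) set" where
  "Lp_space p = {f. f \<in> borel_measurable lebesgue \<and> integrable lebesgue (\<lambda>x. norm (f x) powr p)}"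

definition Lp_norm :: "real \<Rightarrow> (real^'d::finite \<Rightarrow> 'b::real_normed_vector) \<Rightarrow> real" where
  "Lp_norm p f = (LINT x|lebesgue. norm (f x) powr p) powr (1 / p)"

definition hermitian :: "complex^'n::finite \<Rightarrow> complex^'n \<Rightarrow> complex" where
  "hermitian v w = (\<Sum>j\<in>UNIV. v $ j * cnj (w $ j))"

definition dilate :: "real \<Rightarrow> (real^'d::finite \<Rightarrow> complex) \<Rightarrow> real^'d \<Rightarrow> complex" where
  "dilate t \<phi> = (\<lambda>x. complex_of_real (1 / t ^ CARD('d)) * \<phi> ((1 / t) *\<^sub>R x))"

definition local_maximal ::
  "(real^'d::finite \<Rightarrow> complex) \<Rightarrow> 'd functional \<Rightarrow> real^'d \<Rightarrow> ennreal" where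
  "local_maximal \<phi> u x = (SUP t\<in>{0<..<1}. ennreal (cmod (u (\<lambda>y. dilate t \<phi> (x - y)))))"

definition h1_norm :: "(real^'d::finite \<Rightarrow> complex) \<Rightarrow> 'd functional \<Rightarrow> ennreal" where
  "h1_norm \<phi> u = (\<integral>\<^sup>+ x. local_maximal \<phi> u x \<partial>lebesgue)"

definition h1_space :: "(real^'d::finite \<Rightarrow> complex) \<Rightarrow> 'd functional set" where
  "h1_space \<phi> = {u. tempered u \<and> h1_norm \<phi> u < \<infinity>}"

end

theory Submission
  imports Defs
begin

text \<open>
  The symbol of \<open>\<Sum>\<^sub>i L\<^sub>i\<^sup>* L\<^sub>i\<close> is a real positive definite quadratic form, so its heat kernel \<open>G\<^sub>s\<close> is an
  explicit Gaussian. Fix \<open>x\<close> and \<open>t < 1\<close>, put \<open>\<Phi> = \<phi>\<^sub>t (x - \<cdot>)\<close>, and replace \<open>\<integral> V \<cdot> W \<Phi>\<close> by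
  \<open>F(s) = \<integral>\<integral> V(y) \<cdot> W(z) \<Phi>(y) G\<^sub>s (y - z)\<close>, which tends to a nonzero multiple of it as \<open>s \<rightarrow> 0\<close>. Here \<open>F'(s)\<close>
  involves two derivatives of \<open>G\<^sub>s\<close>; the curl equation (in \<open>z\<close>) and the divergence equation
      (in \<open>y\<close>) move
  one of them onto \<open>\<Phi>\<close> or trade it for \<open>div V\<close> and \<open>curl W\<close>. What remains are bilinear forms in
      \<open>y\<close> and \<open>z\<close>
  with a kernel living at scale \<open>s \<le> t\<close>. For exponents \<open>a\<close>, \<open>b\<close> slightly below \<open>p\<close>, \<open>p'\<close> they are
      bounded by
  \<open>t\<^sup>-\<^sup>1 (t / s)\<^sup>1\<^sup>/\<^sup>2\<close>, which is integrable in \<open>s\<close> over \<open>(0, t)\<close>, times products of maximal functions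
      such as
  \<open>(M |V|\<^sup>a)\<^sup>1\<^sup>/\<^sup>a (M |W|\<^sup>b)\<^sup>1\<^sup>/\<^sup>b\<close>. The maximal theorem and Hoelder's inequality conclude.
\<close>

subsection \<open>Smooth functions\<close>

text \<open>By the heat equation F'(s) carries the factor s/2 and a kernel of size 1/s^2, so without
  cancellation it has size 1/s, just short of integrability at 0. Moving one derivative replaces 1/s
  by 1/t, which leaves room for losing any power of t/s below the first. This room is spent on the
  maximal functions: M is unbounded on L^1, so exponents a < p and b < p' are forced, with 1/a + 1/b
  = 1 + \<delta> for some \<delta> > 0, and in dimension N the excess costs (t/s)^(N\<delta>).
  Taking \<delta> at most 1/(2N) makes this a square root. The order of the two equations matters.
  The curl equation comes first: it takes the index j from W and puts it on the adjoint derivative.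
  Only then does the sum over j form the divergence of V, with \<Phi> as a multiplier. The terms
  with div V and curl W contain no derivative of \<Phi> and so no factor 1/t. The restriction t < 1
  supplies it, which is why the local Hardy space appears.\<close>

lemma partial_deriv_eqI:
  assumes "(f has_derivative f') (at x)"
  shows "partial_deriv k f x = f' (axis k 1)"
  unfolding partial_deriv_def using frechet_derivative_at[OF assms] by simp

lemma iter_partial_Cons: "iter_partial (k # ks) f = partial_deriv k (iter_partial ks f)"
  by (simp add: iter_partial_def)

lemma smooth_differentiable: "smooth f \<Longrightarrow> f differentiable (at x)"
  unfolding smooth_def iter_partial_def by (drule spec[of _ "[]"]) simp

lemma smooth_partial: "smooth f \<Longrightarrow> smooth (partial_deriv k f)"
  \<comment> \<open>\<open>foldr\<close> applies the last list entry first, so differentiating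
    \<open>f\<close> beforehand appends \<open>k\<close> at the end.\<close>
  unfolding smooth_def by (intro allI, drule_tac x = "ks @ [k]" in spec)
      (simp add: iter_partial_def)

lemma smooth_continuous: "smooth f \<Longrightarrow> continuous_on UNIV f"
  by (metis continuous_at_imp_continuous_on differentiable_imp_continuous_within
      smooth_differentiable)

lemma smooth_borel [measurable_dest]: "smooth f \<Longrightarrow> f \<in> borel_measurable borel"
  by (rule borel_measurable_continuous_onI) (rule smooth_continuous)

lemma partial_deriv_borel [measurable_dest]:
  "smooth f \<Longrightarrow> partial_deriv k f \<in> borel_measurable borel"
  by (rule smooth_borel) (rule smooth_partial)

text \<open>Smoothness as a greatest fixed point: a family of differentiable functions stable under
  all partial derivatives contains every iterated derivative of its members.\<close>

lemma smooth_coinduct: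
  assumes "f \<in> S" and "\<And>g x. g \<in> S \<Longrightarrow> g differentiable (at x)"
    and "\<And>g k. g \<in> S \<Longrightarrow> partial_deriv k g \<in> S"
  shows "smooth f"
proof -
  have "iter_partial ks f \<in> S" for ks
    by (induction ks) (use assms in \<open>auto simp: iter_partial_Cons, auto simp: iter_partial_def\<close>)
  then show ?thesis
    using assms unfolding smooth_def by blast
qed

lemma partial_deriv_add:
  assumes "f differentiable (at x)" "g differentiable (at x)"
  shows "partial_deriv k (\<lambda>x. f x + g x) x = partial_deriv k f x + partial_deriv k g x"
  using assms[unfolded frechet_derivative_works]
  by (subst partial_deriv_eqI[OF has_derivative_add]) (auto simp: partial_deriv_def)

lemma partial_deriv_mult:
  assumes "f differentiable (at x)" "g differentiable (at x)"
  shows "partial_deriv k (\<lambda>x. f x * g x) x = f x * partial_deriv k g x + partial_deriv k f x * g x"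
  using assms[unfolded frechet_derivative_works]
  by (subst partial_deriv_eqI[OF has_derivative_mult]) (auto simp: partial_deriv_def)

lemma partial_deriv_const [simp]: "partial_deriv k (\<lambda>x. a) = (\<lambda>x. 0)"
  by (rule ext, subst partial_deriv_eqI[OF has_derivative_const]) simp

lemma smooth_const [simp]: "smooth (\<lambda>x. a)"
  by (rule smooth_coinduct[where S = "range (\<lambda>a x. a)"]) auto

text \<open>The module generated by \<open>B\<close> over the ring of smooth functions. Gaussians,
  bumps and affine compositions all have derivatives of this shape: smooth multiples of members of
  one explicit family.\<close>

inductive_set smooth_span :: "(real^'d::finite \<Rightarrow> complex) set \<Rightarrow> (real^'d \<Rightarrow> complex) set"
  for B where
  base: "b \<in> B \<Longrightarrow> b \<in> smooth_span B"
| mult: "smooth h \<Longrightarrow> f \<in> smooth_span B \<Longrightarrow> (\<lambda>x. h x * f x) \<in> smooth_span B"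
| add: "f \<in> smooth_span B \<Longrightarrow> g \<in> smooth_span B \<Longrightarrow> (\<lambda>x. f x + g x) \<in> smooth_span B"

text \<open>The point of the span is that smoothness of products does not have to be known in advance.\<close>

lemma smooth_span_smooth:
  assumes diff: "\<And>b x. b \<in> B \<Longrightarrow> b differentiable (at x)"
    and part: "\<And>b k. b \<in> B \<Longrightarrow> partial_deriv k b \<in> smooth_span B"
    and "f \<in> smooth_span B"
  shows "smooth f"
proof (rule smooth_coinduct[OF assms(3)])
  show 1: "g differentiable (at x)" if "g \<in> smooth_span B" for g x
    using that
    by induction (auto intro: diff differentiable_mult differentiable_add smooth_differentiable)
  show "partial_deriv k g \<in> smooth_span B" if "g \<in> smooth_span B" for g k
    using that
  proof induction
    case (base b)
    then show ?case by (rule part)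
  next
    case (mult h f)
    then have "partial_deriv k (\<lambda>x. h x * f x)
        = (\<lambda>x. h x * partial_deriv k f x + partial_deriv k h x * f x)"
      by (intro ext partial_deriv_mult) (auto intro: 1 smooth_differentiable)
    then show ?case
      using mult by (auto intro!: smooth_span.add smooth_span.mult intro: smooth_partial)
  next
    case (add f g)
    then have "partial_deriv k (\<lambda>x. f x + g x) = (\<lambda>x. partial_deriv k f x + partial_deriv k g x)"
      by (intro ext partial_deriv_add) (auto intro: 1)
    then show ?case
      using add by (auto intro!: smooth_span.add)
  qed
qed

lemma smooth_span_cmult: "f \<in> smooth_span B \<Longrightarrow> (\<lambda>x. a * f x) \<in> smooth_span B"
  by (rule smooth_span.mult) simp

text \<open>With all smooth functions as generators, the span argument bootstraps the closure of
  smoothness under sums and products.\<close>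

lemma smooth_span_Collect_smooth: "f \<in> smooth_span (Collect smooth) \<Longrightarrow> smooth f"
  by (rule smooth_span_smooth[where B = "Collect smooth"])
     (auto intro: smooth_differentiable smooth_partial smooth_span.base)

lemma smooth_add: "smooth f \<Longrightarrow> smooth g \<Longrightarrow> smooth (\<lambda>x. f x + g x)"
  by (rule smooth_span_Collect_smooth) (auto intro: smooth_span.intros)

lemma smooth_mult: "smooth f \<Longrightarrow> smooth g \<Longrightarrow> smooth (\<lambda>x. f x * g x)"
  by (rule smooth_span_Collect_smooth) (auto intro: smooth_span.intros)

lemma smooth_sum: "finite I \<Longrightarrow> (\<And>i. i \<in> I \<Longrightarrow> smooth (f i)) \<Longrightarrow> smooth (\<lambda>x. \<Sum>i\<in>I. f i x)"
  by (induction I rule: finite_induct) (auto intro: smooth_add)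

lemma has_derivative_linear_of_real:
  "((\<lambda>x::real^'d::finite. complex_of_real (v \<bullet> x)) has_derivative (\<lambda>h. of_real (v \<bullet> h))) (at x)"
  by (auto intro!: derivative_eq_intros)

lemma partial_deriv_linear: "partial_deriv k (\<lambda>x. complex_of_real (v \<bullet> x)) = (\<lambda>x. of_real (v $ k))"
  by (rule ext, subst partial_deriv_eqI[OF has_derivative_linear_of_real]) (simp add: inner_axis)

lemma smooth_linear: "smooth (\<lambda>x. complex_of_real (v \<bullet> x))"
  by (rule smooth_coinduct[where S = "insert (\<lambda>x. complex_of_real (v \<bullet> x)) (range (\<lambda>a x. a))"])
     (use has_derivative_linear_of_real in
        \<open>auto simp: partial_deriv_linear differentiable_def intro!: has_derivative_const\<close>)

lemma has_derivative_affine_comp: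
  fixes f :: "real^'d::finite \<Rightarrow> complex"
  assumes "f differentiable (at (a + r *\<^sub>R x))"
  shows "((\<lambda>x. f (a + r *\<^sub>R x)) has_derivative
           (\<lambda>h. frechet_derivative f (at (a + r *\<^sub>R x)) (r *\<^sub>R h))) (at x)"
proof -
  have "((\<lambda>x. a + r *\<^sub>R x) has_derivative (\<lambda>h. r *\<^sub>R h)) (at x)"
    by (auto intro!: derivative_eq_intros)
  from diff_chain_at[OF this assms[unfolded frechet_derivative_works]]
  show ?thesis by (simp add: o_def)
qed

lemma partial_deriv_affine_comp:
  fixes f :: "real^'d::finite \<Rightarrow> complex"
  assumes "f differentiable (at (a + r *\<^sub>R x))"
  shows "partial_deriv k (\<lambda>x. f (a + r *\<^sub>R x)) x = of_real r * partial_deriv k f (a + r *\<^sub>R x)"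
proof -
  have "linear (frechet_derivative f (at (a + r *\<^sub>R x)))"
    by (rule linear_frechet_derivative[OF assms])
  then show ?thesis
    by (subst partial_deriv_eqI[OF has_derivative_affine_comp[OF assms]])
       (simp add: partial_deriv_def linear_cmul, simp only: scaleR_conv_of_real)
qed

lemma smooth_affine_comp:
  assumes "smooth f"
  shows "smooth (\<lambda>x. f (a + r *\<^sub>R x))"
proof (rule smooth_span_smooth[where B = "{\<lambda>x. g (a + r *\<^sub>R x) |g. smooth g}"])
  fix b :: "real^'a \<Rightarrow> complex" and x k
  assume "b \<in> {\<lambda>x. g (a + r *\<^sub>R x) |g. smooth g}"
  then obtain g where b: "b = (\<lambda>x. g (a + r *\<^sub>R x))" and g: "smooth g" by blast
  show "b differentiable (at x)"
    unfolding b differentiable_def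
    using has_derivative_affine_comp[OF smooth_differentiable[OF g]] by blast
  have "partial_deriv k b = (\<lambda>x. of_real r * partial_deriv k g (a + r *\<^sub>R x))"
    unfolding b by (intro ext partial_deriv_affine_comp smooth_differentiable g)
  then show "partial_deriv k b \<in> smooth_span {\<lambda>x. g (a + r *\<^sub>R x) |g. smooth g}"
    using smooth_partial[OF g] by (simp only:, intro smooth_span_cmult smooth_span.base) auto
qed (use assms in \<open>auto intro!: smooth_span.base\<close>)

lemma partial_deriv_cnj:
  assumes "f differentiable (at x)"
  shows "partial_deriv k (\<lambda>x. cnj (f x)) x = cnj (partial_deriv k f x)"
  using assms[unfolded frechet_derivative_works]
  by (subst partial_deriv_eqI[OF has_derivative_cnj]) (auto simp: partial_deriv_def)

lemma smooth_cnj: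
  assumes "smooth f"
  shows "smooth (\<lambda>x. cnj (f x))"
proof (rule smooth_coinduct[where S = "{\<lambda>x. cnj (g x) |g. smooth g}"])
  fix b :: "real^'a \<Rightarrow> complex" and x k
  assume "b \<in> {\<lambda>x. cnj (g x) |g. smooth g}"
  then obtain g where b: "b = (\<lambda>x. cnj (g x))" and g: "smooth g" by blast
  show "b differentiable (at x)"
    unfolding b differentiable_def
    using has_derivative_cnj[OF smooth_differentiable[OF g, unfolded frechet_derivative_works]]
        by blast
  have "partial_deriv k b = (\<lambda>x. cnj (partial_deriv k g x))"
    unfolding b by (intro ext partial_deriv_cnj smooth_differentiable g)
  then show "partial_deriv k b \<in> {\<lambda>x. cnj (g x) |g. smooth g}"
    using smooth_partial[OF g] by auto
qed (use assms in auto)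

subsection \<open>A bump function\<close>

text \<open>Powers of 1/u are built in because differentiating exp(-1/u) produces them; derivatives
  are then linear combinations of members of the same family.\<close>

definition flat :: "nat \<Rightarrow> real \<Rightarrow> real" where
  "flat m u = (if u > 0 then exp (- 1 / u) / u ^ m else 0)"

lemma power_le_fact_exp:
  fixes v :: real
  assumes "v \<ge> 0"
  shows "v ^ n \<le> fact n * exp v"
proof -
  have "(\<Sum>i\<in>{n}. inverse (fact i) *\<^sub>R v ^ i) \<le> exp v"
    unfolding exp_def using assms
    by (intro sum_le_suminf summable_exp_generic) auto
  then show ?thesis
    by (simp add: field_simps)
qed

text \<open>Taking v = 1/u in the bound of v^(m+2) by an exponential leaves a factor u^2. So every
  member of the family vanishes to second order at 0.\<close>

lemma flat_bound: "\<bar>flat m u\<bar> \<le> fact (m + 2) * u\<^sup>2"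
proof (cases "u > 0")
  case True
  have "(1 / u) ^ (m + 2) * exp (- 1 / u) \<le> fact (m + 2) * exp (1 / u) * exp (- 1 / u)"
    using power_le_fact_exp[of "1 / u" "m + 2"] True by (intro mult_right_mono) auto
  also have "\<dots> = fact (m + 2)"
    by (simp flip: exp_add add: mult.assoc)
  finally have "exp (- 1 / u) / u ^ (m + 2) \<le> fact (m + 2)"
    by (simp add: power_one_over field_simps)
  then have "exp (- 1 / u) / u ^ (m + 2) * u\<^sup>2 \<le> fact (m + 2) * u\<^sup>2"
    by (rule mult_right_mono) simp
  then show ?thesis
    using True by (simp add: flat_def power_add power2_eq_square)
qed (simp add: flat_def)

lemma flat_has_derivative:
  "(flat m has_real_derivative (flat (m + 2) u - real m * flat (m + 1) u)) (at u)"
proof -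
  consider "u > 0" | "u < 0" | "u = 0" by linarith
  then show ?thesis
  proof cases
    case 1
    have "((\<lambda>u. exp (- 1 / u) / u ^ m) has_real_derivative
            (exp (- 1 / u) * (1 / u\<^sup>2) * u ^ m - exp (- 1 / u) * (real m * u ^ (m - 1))) /
                (u ^ m * u ^ m)) (at u)"
      using 1 by (auto intro!: derivative_eq_intros simp: power2_eq_square)
    also have "(exp (- 1 / u) * (1 / u\<^sup>2) * u ^ m - exp (- 1 / u) * (real m * u ^ (m - 1))) /
        (u ^ m * u ^ m)
        = flat (m + 2) u - real m * flat (m + 1) u"
      using 1 by (cases m) (simp_all add: flat_def field_simps power2_eq_square)
    finally have *: "((\<lambda>u. exp (- 1 / u) / u ^ m) has_real_derivative
        flat (m + 2) u - real m * flat (m + 1) u) (at u)" .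
    show ?thesis
      by (rule has_field_derivative_transform_within_open[OF *, of "{0<..}"])
          (use 1 in \<open>auto simp: flat_def\<close>)
  next
    case 2
    show ?thesis
      by (rule has_field_derivative_transform_within_open[of "\<lambda>_. 0" _ _ "{..<0}"])
         (use 2 in \<open>auto simp: flat_def\<close>)
  next
    case 3
    \<comment> \<open>By \<open>flat_bound\<close> the difference quotient at 0 is at most a
      constant times |h|.\<close>
    have "((\<lambda>h. flat m h / h) \<longlongrightarrow> 0) (at 0)"
    proof (rule tendsto_0_le[where K = "fact (m + 2)"])
      show "((\<lambda>h::real. h) \<longlongrightarrow> 0) (at 0)" by (rule tendsto_ident_at)
      have "\<bar>flat m h / h\<bar> \<le> \<bar>h\<bar> * fact (m + 2)" if "h \<noteq> 0" for h
        using flat_bound[of m h] that by (simp add: field_simps power2_eq_square abs_if split: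
            if_splits)
      then show "\<forall>\<^sub>F h in at 0. norm (flat m h / h) \<le> norm h * fact (m + 2)"
        by (auto simp: eventually_at_filter)
    qed
    then show ?thesis
      using 3 by (simp add: DERIV_def flat_def)
  qed
qed

text \<open>For m = 0 this is the standard bump exp(-1/(1 - |x|^2)) on the unit ball; the other
  indices arise from differentiating it.\<close>

definition bump_flat :: "nat \<Rightarrow> real^'d::finite \<Rightarrow> complex" where
  "bump_flat m x = of_real (flat m (1 - (norm x)\<^sup>2))"

lemma bump_flat_has_derivative:
  "(bump_flat m has_derivative
     (\<lambda>h. of_real ((flat (m + 2) (1 - (norm x)\<^sup>2) - real m * flat (m + 1) (1 - (norm x)\<^sup>2)) *
         (- 2 * (x \<bullet> h))))) (at x)"
proof -
  have 1: "((\<lambda>x. 1 - (norm x)\<^sup>2) has_derivative (\<lambda>h. - 2 * (x \<bullet> h))) (at x)"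
    unfolding power2_norm_eq_inner by (auto intro!: derivative_eq_intros simp: inner_commute)
  show ?thesis
    unfolding bump_flat_def
    using has_derivative_of_real[OF has_derivative_compose[OF 1 flat_has_derivative[THEN
        has_field_derivative_imp_has_derivative]]]
    by simp
qed

lemma smooth_bump_flat: "smooth (bump_flat m)"
proof (rule smooth_span_smooth[where B = "range bump_flat"])
  fix b :: "real^'a \<Rightarrow> complex" and x k
  assume "b \<in> range bump_flat"
  then obtain m where b: "b = bump_flat m" by blast
  show "b differentiable (at x)"
    unfolding b differentiable_def using bump_flat_has_derivative by blast
  have "partial_deriv k b = (\<lambda>x. of_real ((- 2 *\<^sub>R axis k 1) \<bullet> x) *
      (bump_flat (m + 2) x + (of_real (- real m)) * bump_flat (m + 1) x))"
    unfolding b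
    by (intro ext, subst partial_deriv_eqI[OF bump_flat_has_derivative])
       (simp add: bump_flat_def inner_axis inner_axis' algebra_simps)
  also have "\<dots> \<in> smooth_span (range bump_flat)"
    by (intro smooth_span.mult smooth_linear smooth_span.add smooth_span_cmult smooth_span.base)
        auto
  finally show "partial_deriv k b \<in> smooth_span (range bump_flat)" .
qed (auto intro: smooth_span.base)

lemma flat_le: "u \<le> 1 \<Longrightarrow> \<bar>flat m u\<bar> \<le> fact (m + 2)"
proof (cases "u > 0")
  case True
  assume "u \<le> 1"
  have "\<bar>flat m u\<bar> \<le> fact (m + 2) * u\<^sup>2" by (rule flat_bound)
  also have "\<dots> \<le> fact (m + 2) * 1"
    using \<open>u \<le> 1\<close> True by (intro mult_left_mono power_le_one) auto
  finally show ?thesis by simp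
qed (simp add: flat_def)

lemma bump_flat_le: "cmod (bump_flat m x) \<le> fact (m + 2)"
  unfolding bump_flat_def using flat_le[of "1 - (norm x)\<^sup>2" m] by simp

lemma partial_bump_flat_le: "cmod (partial_deriv k (bump_flat 0) x) \<le> 48"
proof -
  have eq: "partial_deriv k (bump_flat 0) x = of_real (flat 2 (1 - (norm x)\<^sup>2) * (- 2 * (x $ k)))"
    by (subst partial_deriv_eqI[OF bump_flat_has_derivative]) (simp add: inner_axis numeral_2_eq_2)
  \<comment> \<open>24 is fact (2 + 2) from \<open>flat_le\<close>, and 2 bounds |2 x_k| on the unit
    ball; outside the ball the product vanishes.\<close>
  have "\<bar>flat 2 (1 - (norm x)\<^sup>2)\<bar> * \<bar>2 * x $ k\<bar> \<le> 24 * 2"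
  proof (cases "norm x < 1")
    case True
    then have "\<bar>x $ k\<bar> \<le> 1" using component_le_norm_cart[of x k] by simp
    moreover have "\<bar>flat 2 (1 - (norm x)\<^sup>2)\<bar> \<le> fact (2 + 2)" by (rule flat_le) simp
    ultimately show ?thesis by (intro mult_mono) (auto simp: fact_numeral)
  next
    case False
    then have "1 \<le> (norm x)\<^sup>2" by simp
    then show ?thesis by (simp add: flat_def)
  qed
  then show ?thesis by (simp add: eq abs_mult norm_mult)
qed

lemma cutoff_mult_test_function:
  assumes "smooth \<psi>" "r > 0"
  shows "(\<lambda>x. bump_flat 0 (r *\<^sub>R x) * \<psi> x) \<in> test_functions"
proof -
  have "smooth (\<lambda>x. bump_flat 0 (0 + r *\<^sub>R x) * \<psi> x)"
    by (intro smooth_mult smooth_affine_comp smooth_bump_flat assms)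
  moreover have "norm x \<le> 1 / r" if "bump_flat 0 (r *\<^sub>R x) * \<psi> x \<noteq> 0" for x
  proof (rule ccontr)
    assume "\<not> norm x \<le> 1 / r"
    then have "1 \<le> norm (r *\<^sub>R x)" using \<open>r > 0\<close> by (simp add: field_simps)
    then have "1 \<le> (norm (r *\<^sub>R x))\<^sup>2" by (simp only: one_le_power)
    then show False using that by (simp add: bump_flat_def flat_def)
  qed
  then have "bounded {x. bump_flat 0 (r *\<^sub>R x) * \<psi> x \<noteq> 0}"
    by (intro boundedI[where B = "1 / r"]) auto
  ultimately show ?thesis
    by (simp add: test_functions_def)
qed

text \<open>Weak identities tested against compactly supported functions extend, by cutting off, to all
  smooth functions for which the integrals converge.\<close>

lemma weak_identity_extend:
  fixes f :: "'d::finite \<Rightarrow> real^'d \<Rightarrow> complex"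
  assumes weak: "\<And>\<psi>. \<psi> \<in> test_functions \<Longrightarrow>
      (\<Sum>k\<in>UNIV. LINT x|lborel. f k x * partial_deriv k \<psi> x) = (LINT x|lborel. g x * \<psi> x)"
    and \<psi>: "smooth \<psi>"
    and int: "\<And>k. integrable lborel (\<lambda>x. f k x * partial_deriv k \<psi> x)"
      "\<And>k. integrable lborel (\<lambda>x. f k x * \<psi> x)" "integrable lborel (\<lambda>x. g x * \<psi> x)"
  shows "(\<Sum>k\<in>UNIV. LINT x|lborel. f k x * partial_deriv k \<psi> x) = (LINT x|lborel. g x * \<psi> x)"
proof -
  define r where "r n = inverse (real (Suc n))" for n
  have r: "r n > 0" "r n \<le> 1" for n by (auto simp: r_def field_simps)
  have r0: "r \<longlonglongrightarrow> 0" unfolding r_def by (rule LIMSEQ_inverse_real_of_nat)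
  define cut where "cut n x = bump_flat 0 (r n *\<^sub>R x)" for n and x :: "real^'d"
  define dcut where "dcut k n x = partial_deriv k (bump_flat 0) (r n *\<^sub>R x)" for k n and x ::
      "real^'d"
  \<comment> \<open>The cutoffs tend to the value of the bump at 0, which is exp(-1) rather than 1.
    The factor appears on both sides of the limit identity and cancels.\<close>
  let ?e = "complex_of_real (exp (- 1))"
  have cut_m [measurable]: "cut n \<in> borel_measurable borel" for n
    unfolding cut_def using smooth_borel[OF smooth_bump_flat[of 0]] by measurable
  have dcut_m [measurable]: "dcut k n \<in> borel_measurable borel" for k n
    unfolding dcut_def using partial_deriv_borel[OF smooth_bump_flat[of 0], of k] by measurable
  have cut_lim: "(\<lambda>n. cut n x) \<longlonglongrightarrow> ?e" for x
  proof -
    have "isCont (bump_flat 0) (0::real^'d)"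
      using smooth_continuous[OF smooth_bump_flat]
      by (metis continuous_on_eq_continuous_at open_UNIV UNIV_I)
    moreover have "(\<lambda>n. r n *\<^sub>R x) \<longlonglongrightarrow> 0"
      using tendsto_scaleR[OF r0 tendsto_const[of x]] by simp
    ultimately have "(\<lambda>n. cut n x) \<longlonglongrightarrow> bump_flat 0 (0::real^'d)"
      unfolding cut_def by (rule isCont_tendsto_compose)
    then show ?thesis by (simp add: bump_flat_def flat_def)
  qed
  \<comment> \<open>The chain rule contributes \<open>r n\<close>, which removes in the limit the
    terms where the derivative falls on the cutoff.\<close>
  have dcut_lim: "(\<lambda>n. of_real (r n) * dcut k n x) \<longlonglongrightarrow> 0" for k x
  proof (rule tendsto_0_le[OF r0, where K = 48])
    show "\<forall>\<^sub>F n in sequentially. cmod (of_real (r n) * dcut k n x) \<le> norm (r n) * 48"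
      unfolding dcut_def using partial_bump_flat_le
      by (intro always_eventually allI) (auto simp: norm_mult intro!: mult_left_mono)
  qed
  have part: "partial_deriv k (\<lambda>x. cut n x * \<psi> x) x
      = cut n x * partial_deriv k \<psi> x + of_real (r n) * dcut k n x * \<psi> x" for k n x
  proof -
    have d: "bump_flat 0 differentiable (at y)" for y :: "real^'d"
      by (rule smooth_differentiable[OF smooth_bump_flat])
    have "partial_deriv k (\<lambda>x. bump_flat 0 (0 + r n *\<^sub>R x)) x
        = of_real (r n) * partial_deriv k (bump_flat 0) (0 + r n *\<^sub>R x)"
      by (rule partial_deriv_affine_comp[OF d])
    moreover have "(\<lambda>x. bump_flat 0 (0 + r n *\<^sub>R x)) differentiable (at x)"
      by (rule smooth_differentiable[OF smooth_affine_comp[OF smooth_bump_flat]])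
    ultimately show ?thesis
      using smooth_differentiable[OF \<psi>] by (subst partial_deriv_mult)
          (simp_all add: cut_def[abs_def] dcut_def)
  qed
  have L: "(\<lambda>n. LINT x|lborel. f k x * partial_deriv k (\<lambda>x. cut n x * \<psi> x) x)
      \<longlonglongrightarrow> (LINT x|lborel. ?e * (f k x * partial_deriv k \<psi> x))" for k
  proof (rule integral_dominated_convergence[where
        w = "\<lambda>x. 2 * cmod (f k x * partial_deriv k \<psi> x) + 48 * cmod (f k x * \<psi> x)"])
    have eq: "(\<lambda>x. f k x * partial_deriv k (\<lambda>x. cut n x * \<psi> x) x) =
        (\<lambda>x. cut n x * (f k x * partial_deriv k \<psi> x) + of_real (r n) * dcut k n x *
            (f k x * \<psi> x))" for n
      unfolding part by (simp add: algebra_simps)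
    show "(\<lambda>x. f k x * partial_deriv k (\<lambda>x. cut n x * \<psi> x) x) \<in> borel_measurable lborel" for n
      unfolding eq using int(1,2)[of k] by measurable
    show "(\<lambda>x. ?e * (f k x * partial_deriv k \<psi> x)) \<in> borel_measurable lborel"
      using int(1)[of k] by measurable
    show "integrable lborel (\<lambda>x. 2 * cmod (f k x * partial_deriv k \<psi> x) + 48 * cmod (f k x * \<psi> x))"
      using int(1,2)[of k] by (intro Bochner_Integration.integrable_add integrable_mult_right
          integrable_norm)
    show "AE x in lborel. (\<lambda>n. f k x * partial_deriv k (\<lambda>x. cut n x * \<psi> x) x)
        \<longlonglongrightarrow> ?e * (f k x * partial_deriv k \<psi> x)"
    proof (intro AE_I2)
      fix x
      have "(\<lambda>n. cut n x * (f k x * partial_deriv k \<psi> x) + of_real (r n) * dcut k n x *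
          (f k x * \<psi> x))
        \<longlonglongrightarrow> ?e * (f k x * partial_deriv k \<psi> x) + 0 * (f k x * \<psi> x)"
        by (intro tendsto_intros cut_lim dcut_lim)
      then show "(\<lambda>n. f k x * partial_deriv k (\<lambda>x. cut n x * \<psi> x) x)
          \<longlonglongrightarrow> ?e * (f k x * partial_deriv k \<psi> x)"
        unfolding fun_cong[OF eq] by simp
    qed
    show "AE x in lborel. cmod (f k x * partial_deriv k (\<lambda>x. cut n x * \<psi> x) x)
        \<le> 2 * cmod (f k x * partial_deriv k \<psi> x) + 48 * cmod (f k x * \<psi> x)" for n
    proof (intro AE_I2)
      fix x
      have "cmod (cut n x) \<le> 2" using bump_flat_le[of 0] by (simp add: cut_def numeral_2_eq_2)
      moreover have "cmod (of_real (r n) * dcut k n x) \<le> 1 * 48"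
        unfolding norm_mult dcut_def using partial_bump_flat_le r[of n]
        by (intro mult_mono) auto
      ultimately have "cmod (cut n x * (f k x * partial_deriv k \<psi> x)) + cmod
          (of_real (r n) * dcut k n x * (f k x * \<psi> x))
          \<le> 2 * cmod (f k x * partial_deriv k \<psi> x) + 48 * cmod (f k x * \<psi> x)"
        unfolding norm_mult[of "cut n x"] norm_mult[of "of_real (r n) * dcut k n x"]
        by (intro add_mono mult_right_mono) auto
      then show "cmod (f k x * partial_deriv k (\<lambda>x. cut n x * \<psi> x) x)
        \<le> 2 * cmod (f k x * partial_deriv k \<psi> x) + 48 * cmod (f k x * \<psi> x)"
        unfolding fun_cong[OF eq] by (rule order_trans[OF norm_triangle_ineq])
    qed
  qed
  have R: "(\<lambda>n. LINT x|lborel. g x * (cut n x * \<psi> x)) \<longlonglongrightarrow> (LINT x|lborel. ?e * (g x * \<psi> x))"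
  proof (rule integral_dominated_convergence[where w = "\<lambda>x. 2 * cmod (g x * \<psi> x)"])
    have eq: "(\<lambda>x. g x * (cut n x * \<psi> x)) = (\<lambda>x. cut n x * (g x * \<psi> x))" for n by
        (simp add: algebra_simps)
    show "(\<lambda>x. g x * (cut n x * \<psi> x)) \<in> borel_measurable lborel" for n
      unfolding eq using int(3) by measurable
    show "(\<lambda>x. ?e * (g x * \<psi> x)) \<in> borel_measurable lborel"
      using int(3) by measurable
    show "integrable lborel (\<lambda>x. 2 * cmod (g x * \<psi> x))"
      using int(3) by (intro integrable_mult_right integrable_norm)
    show "AE x in lborel. (\<lambda>n. g x * (cut n x * \<psi> x)) \<longlonglongrightarrow> ?e * (g x * \<psi> x)"
      unfolding fun_cong[OF eq] by (intro AE_I2 tendsto_intros cut_lim)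
    show "AE x in lborel. cmod (g x * (cut n x * \<psi> x)) \<le> 2 * cmod (g x * \<psi> x)" for n
      unfolding fun_cong[OF eq] norm_mult[of "cut n _"] using bump_flat_le[of 0]
      by (intro AE_I2 mult_right_mono) (auto simp: cut_def numeral_2_eq_2)
  qed
  have "(LINT x|lborel. g x * (cut n x * \<psi> x))
      = (\<Sum>k\<in>UNIV. LINT x|lborel. f k x * partial_deriv k (\<lambda>x. cut n x * \<psi> x) x)" for n
    using weak[OF cutoff_mult_test_function[OF \<psi> r(1)[of n]]] by (simp add: cut_def)
  then have "(\<lambda>n. LINT x|lborel. g x * (cut n x * \<psi> x))
      \<longlonglongrightarrow> (\<Sum>k\<in>UNIV. LINT x|lborel. ?e * (f k x * partial_deriv k \<psi> x))"
    by (simp only:) (intro tendsto_sum L)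
  from LIMSEQ_unique[OF this R] show ?thesis
    by (simp flip: sum_distrib_left)
qed

subsection \<open>The Hardy--Littlewood maximal function\<close>

definition ball_avg :: "('a::euclidean_space \<Rightarrow> ennreal) \<Rightarrow> real \<Rightarrow> 'a \<Rightarrow> ennreal" where
  "ball_avg f r x = (\<integral>\<^sup>+y. f y * indicator (ball x r) y \<partial>lborel)
     * ennreal (1 / (unit_ball_vol DIM('a) * r ^ DIM('a)))"

text \<open>Rational radii make measurability immediate.\<close>

definition maximal_fun :: "('a::euclidean_space \<Rightarrow> ennreal) \<Rightarrow> 'a \<Rightarrow> ennreal" where
  "maximal_fun f x = (SUP q\<in>{q::rat. q > 0}. ball_avg f (of_rat q) x)"

text \<open>The indicator of a ball with variable centre is a section of an open set in the product,
  so measurability in the centre comes from Fubini.\<close>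

lemma ball_avg_measurable [measurable]:
  assumes [measurable]: "f \<in> borel_measurable borel"
  shows "ball_avg f r \<in> borel_measurable borel"
proof -
  have "{p :: 'a \<times> 'a. dist (fst p) (snd p) < r} \<in> sets borel"
    by (intro borel_open open_Collect_less continuous_intros)
  then have [measurable]: "{p :: 'a \<times> 'a. dist (fst p) (snd p) < r} \<in> sets (borel \<Otimes>\<^sub>M borel)"
    unfolding borel_prod .
  have "(\<lambda>x. \<integral>\<^sup>+y. f y * indicator {p. dist (fst p) (snd p) < r} (x, y) \<partial>lborel) \<in>
      borel_measurable borel"
    by measurable
  moreover have "indicator {p. dist (fst p) (snd p) < r} (x, y) =
      (indicator (ball x r) y :: ennreal)" for x y :: 'a
    by (simp add: indicator_def)
  ultimately show ?thesis
    unfolding ball_avg_def[abs_def] by simp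
qed

lemma maximal_fun_measurable [measurable]:
  assumes [measurable]: "f \<in> borel_measurable borel"
  shows "maximal_fun f \<in> borel_measurable borel"
  unfolding maximal_fun_def[abs_def] by (intro borel_measurable_SUP) auto

lemma ball_avg_le_maximal: "q > 0 \<Longrightarrow> ball_avg f (real_of_rat q) x \<le> maximal_fun f x"
  unfolding maximal_fun_def by (rule SUP_upper) simp

lemma maximal_fun_mono: "(\<And>y. f y \<le> g y) \<Longrightarrow> maximal_fun f x \<le> maximal_fun g x"
  unfolding maximal_fun_def ball_avg_def by (intro SUP_mono' mult_right_mono nn_integral_mono) auto

lemma ball_avg_const:
  assumes "r > 0"
  shows "ball_avg (\<lambda>_. a) r (x::'a::euclidean_space) = a"
proof -
  have "(\<integral>\<^sup>+y. a * indicator (ball x r) y \<partial>lborel) = a * ennreal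
      (unit_ball_vol DIM('a) * r ^ DIM('a))"
    using assms by (subst nn_integral_cmult_indicator) (auto simp: emeasure_ball)
  moreover have "unit_ball_vol DIM('a) * r ^ DIM('a) > 0"
    using assms by simp
  ultimately show ?thesis
    using assms unfolding ball_avg_def
    by (simp add: mult.assoc less_imp_neq[symmetric] flip: ennreal_mult)
qed

lemma ball_avg_add:
  assumes [measurable]: "f \<in> borel_measurable borel" "g \<in> borel_measurable borel"
  shows "ball_avg (\<lambda>y. f y + g y) r x = ball_avg f r x + ball_avg g r x"
proof -
  have [measurable]: "ball x r \<in> sets borel" by simp
  show ?thesis
    unfolding ball_avg_def by (simp add: distrib_right nn_integral_add)
qed

text \<open>Serves the interpolation argument, where a function is dominated by its part above a
  height plus a constant.\<close>

lemma maximal_fun_add_const: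
  assumes [measurable]: "f \<in> borel_measurable borel"
  shows "maximal_fun (\<lambda>y. f y + a) x \<le> maximal_fun f x + a"
  unfolding maximal_fun_def
  by (intro SUP_least) (auto simp: ball_avg_add ball_avg_const intro!: add_right_mono SUP_upper)

text \<open>Each point of the superlevel set carries a ball on which the average exceeds
  \<open>l\<close>. The Vitali covering lemma selects disjoint balls whose fivefold enlargements
  cover the set, and the enlargement costs 5^N in volume.\<close>

theorem maximal_fun_weak_type:
  fixes f :: "'a::euclidean_space \<Rightarrow> ennreal"
  assumes [measurable]: "f \<in> borel_measurable borel" and "l > 0"
  shows "ennreal l * emeasure lborel {x. ennreal l < maximal_fun f x} \<le> 5 ^ DIM('a) *
      (\<integral>\<^sup>+y. f y \<partial>lborel)"
proof (cases "(\<integral>\<^sup>+y. f y \<partial>lborel) = \<infinity>")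
  case True
  then show ?thesis by (simp add: ennreal_mult_top)
next
  case False
  let ?E = "{x. ennreal l < maximal_fun f x}" and ?\<omega> = "unit_ball_vol (real DIM('a))" and ?N =
      "DIM('a)"
  obtain I where I: "(\<integral>\<^sup>+y. f y \<partial>lborel) = ennreal I" "I \<ge> 0"
    using False by (cases "\<integral>\<^sup>+y. f y \<partial>lborel") auto
  have "\<exists>r>0. ennreal l < ball_avg f r x" if "x \<in> ?E" for x
    using that unfolding maximal_fun_def less_SUP_iff by (auto simp: less_SUP_iff)
        (metis zero_less_of_rat_iff)
  then obtain r where r: "r x > 0" "ennreal l < ball_avg f (r x) x" if "x \<in> ?E" for x
    by metis
  have vol: "ennreal (l * (?\<omega> * r x ^ ?N)) \<le> (\<integral>\<^sup>+y. f y * indicator (ball x (r x)) y \<partial>lborel)" if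
      "x \<in> ?E" for x
  proof -
    have "ennreal l * ennreal (?\<omega> * r x ^ ?N) \<le> ball_avg f (r x) x * ennreal (?\<omega> * r x ^ ?N)"
      using r[OF that] by (intro mult_right_mono) auto
    also have "\<dots> = (\<integral>\<^sup>+y. f y * indicator (ball x (r x)) y \<partial>lborel)"
      using r(1)[OF that] by (simp add: ball_avg_def mult.assoc less_imp_neq[symmetric] flip:
          ennreal_mult)
    finally show ?thesis
      using \<open>l > 0\<close> r(1)[OF that] by (simp add: ennreal_mult)
  qed
  \<comment> \<open>Vitali needs bounded radii. Here l times the volume of each ball is at most the
    total integral I, and a radius above 1 is at most its N-th power.\<close>
  have bound: "0 < r x \<and> r x \<le> 1 + I / (l * ?\<omega>)" if "x \<in> ?E" for x
  proof
    show "0 < r x" by (rule r(1)[OF that])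
    have "ennreal (l * (?\<omega> * r x ^ ?N)) \<le> (\<integral>\<^sup>+y. f y \<partial>lborel)"
      by (rule order_trans[OF vol[OF that]]) (auto intro!: nn_integral_mono simp: indicator_def)
    then have "l * (?\<omega> * r x ^ ?N) \<le> I"
      using I by simp
    then have le: "r x ^ ?N \<le> I / (l * ?\<omega>)"
      using \<open>l > 0\<close> by (simp add: field_simps)
    show "r x \<le> 1 + I / (l * ?\<omega>)"
    proof (cases "r x \<le> 1")
      case True
      moreover have "0 \<le> I / (l * ?\<omega>)" using I \<open>l > 0\<close> by simp
      ultimately show ?thesis by linarith
    next
      case False
      then have "r x ^ 1 \<le> r x ^ ?N" by (intro power_increasing) auto
      then show ?thesis using le by simp
    qed
  qed
  obtain C where C: "countable C" "C \<subseteq> ?E"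
    "pairwise (\<lambda>i j. disjnt (ball i (r i)) (ball j (r j))) C"
    "?E \<subseteq> (\<Union>i\<in>C. ball i (5 * r i))"
    by (rule Vitali_covering_lemma_balls[where S = ?E and K = ?E and a = "\<lambda>x. x" and r
        = r, OF _ bound]) (use r(1) in force)+
  \<comment> \<open>The countable family is indexed by natural numbers, with the empty set at the
    remaining indices, so that countable additivity applies as a series.\<close>
  define D where "D = to_nat_on C ` C"
  define A where "A n = (if n \<in> D then ball (from_nat_into C n) (r (from_nat_into C n)) else {})"
      for n
  define A5 where "A5 n = (if n \<in> D then ball (from_nat_into C n) (5 * r (from_nat_into C n))
      else {})" for n
  have D: "from_nat_into C n \<in> C" if "n \<in> D" for n
    using that C(1) by (auto simp: D_def)
  have "disjoint_family A"
    unfolding disjoint_family_on_def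
  proof (intro ballI impI)
    fix m n :: nat assume "m \<noteq> n"
    show "A m \<inter> A n = {}"
    proof (cases "m \<in> D \<and> n \<in> D")
      case True
      then have "from_nat_into C m \<noteq> from_nat_into C n"
        using \<open>m \<noteq> n\<close> C(1) by (auto simp: D_def)
      then show ?thesis
        using C(3) D True unfolding pairwise_def disjnt_def by (auto simp: A_def)
    qed (auto simp: A_def)
  qed
  have A_sets: "range A \<subseteq> sets lborel" "range A5 \<subseteq> sets lborel"
    by (auto simp: A_def A5_def)
  have A5_le: "ennreal l * emeasure lborel (A5 n) \<le> 5 ^ ?N * emeasure (density lborel f) (A n)"
      for n
  proof (cases "n \<in> D")
    case True
    let ?x = "from_nat_into C n"
    have x: "?x \<in> ?E" using D[OF True] C(2) by blast
    have "ennreal l * emeasure lborel (A5 n) = 5 ^ ?N * ennreal (l * (?\<omega> * r ?x ^ ?N))"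
      using True r(1)[OF x] \<open>l > 0\<close>
      by (simp add: A5_def emeasure_ball power_mult_distrib ennreal_mult ennreal_power[symmetric]
          mult_ac)
    also have "\<dots> \<le> 5 ^ ?N * (\<integral>\<^sup>+y. f y * indicator (ball ?x (r ?x)) y \<partial>lborel)"
      by (intro mult_left_mono vol x) simp
    also have "\<dots> = 5 ^ ?N * emeasure (density lborel f) (A n)"
      using True by (simp add: A_def emeasure_density)
    finally show ?thesis .
  qed (simp add: A5_def)
  have "emeasure lborel ?E \<le> emeasure lborel (\<Union>n. A5 n)"
  proof (rule emeasure_mono)
    show "?E \<subseteq> (\<Union>n. A5 n)"
    proof
      fix x assume "x \<in> ?E"
      then obtain i where "i \<in> C" "x \<in> ball i (5 * r i)" using C(4) by blast
      then have "x \<in> A5 (to_nat_on C i)"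
        using C(1) by (auto simp: A5_def D_def)
      then show "x \<in> (\<Union>n. A5 n)" by blast
    qed
  qed (use A_sets in auto)
  also have "\<dots> \<le> (\<Sum>n. emeasure lborel (A5 n))"
    by (rule emeasure_subadditive_countably[OF A_sets(2)])
  finally have "ennreal l * emeasure lborel ?E \<le> ennreal l * (\<Sum>n. emeasure lborel (A5 n))"
    by (intro mult_left_mono) auto
  also have "\<dots> = (\<Sum>n. ennreal l * emeasure lborel (A5 n))"
    by (simp add: ennreal_suminf_cmult)
  also have "\<dots> \<le> (\<Sum>n. 5 ^ ?N * emeasure (density lborel f) (A n))"
    by (intro suminf_le A5_le) auto
  also have "\<dots> = 5 ^ ?N * (\<Sum>n. emeasure (density lborel f) (A n))"
    by (simp add: ennreal_suminf_cmult)
  also have "(\<Sum>n. emeasure (density lborel f) (A n)) = emeasure (density lborel f) (\<Union>n. A n)"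
    using A_sets \<open>disjoint_family A\<close> by (intro suminf_emeasure) auto
  also have "\<dots> \<le> emeasure (density lborel f) (space (density lborel f))"
    by (rule emeasure_space)
  also have "\<dots> = (\<integral>\<^sup>+y. f y \<partial>lborel)"
    by (simp add: emeasure_density)
  finally show ?thesis
    by (simp add: mult_left_mono)
qed

lemma nn_integral_powr_0:
  assumes "a > - 1" "y \<ge> 0"
  shows "(\<integral>\<^sup>+l. ennreal (l powr a * indicator {0<..<y} l) \<partial>lborel) = ennreal
      (y powr (a + 1) / (a + 1))"
proof -
  have "((\<lambda>l. l powr a) has_integral (y powr (a + 1) / (a + 1))) {0..y}"
    by (rule has_integral_powr_from_0[OF assms])
  then have "((\<lambda>l. l powr a) has_integral (y powr (a + 1) / (a + 1))) {0<..<y}"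
    by (subst has_integral_spike_set_eq[where T = "{0..y}"])
       (auto intro!: negligible_subset[OF negligible_finite[of "{0, y}"]])
  then have "((\<lambda>l. l powr a * indicator {0<..<y} l) has_integral (y powr (a + 1) / (a + 1))) UNIV"
    by (subst (asm) has_integral_restrict_UNIV[symmetric])
        (simp add: indicator_def of_bool_def if_distrib cong: if_cong)
  then show ?thesis
    by (intro nn_integral_has_integral_lborel) auto
qed

text \<open>Marcinkiewicz interpolation between the weak L^1 bound and the trivial bound for bounded
  functions. Note that \<open>enn2real\<close> maps an infinite value to 0; infinite values are
  dealt with by \<open>maximal_fun_AE_finite\<close>.\<close>

theorem maximal_fun_strong_type:
  fixes f :: "'a::euclidean_space \<Rightarrow> real"
  assumes f[measurable]: "f \<in> borel_measurable borel" and nonneg: "\<And>x. f x \<ge> 0" and "q > 1"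
  shows "(\<integral>\<^sup>+x. ennreal (enn2real (maximal_fun f x) powr q) \<partial>lborel)
    \<le> ennreal (q * (2 * 5 ^ DIM('a)) * 2 powr (q - 1) / (q - 1)) *
        (\<integral>\<^sup>+x. ennreal (f x powr q) \<partial>lborel)"
proof -
  let ?M = "\<lambda>x. enn2real (maximal_fun f x)"
  let ?F = "\<lambda>x l. ennreal (q * l powr (q - 1)) *
      (indicator {0<..} l * indicator {(x, l). l < ?M x} (x, l))"
  let ?G = "\<lambda>x l. ennreal (q * (2 * 5 ^ DIM('a)) * l powr (q - 2)) * indicator {0<..} l *
      (ennreal (f x) * indicator {(x, l). l < 2 * f x} (x, l))"
  \<comment> \<open>The part of \<open>f\<close> below l/2 raises the maximal function by at most
    l/2, so only the part where l < 2 f can push it above l.\<close>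
  have weak: "emeasure lborel {x. l < ?M x} \<le> ennreal (2 * 5 ^ DIM('a) / l) *
      (\<integral>\<^sup>+x. ennreal (f x) * indicator {x. l < 2 * f x} x \<partial>lborel)" if "l > 0" for l
  proof -
    let ?g = "\<lambda>x. ennreal (f x) * indicator {x. l < 2 * f x} x"
    have le: "maximal_fun f x \<le> maximal_fun ?g x + ennreal (l / 2)" for x
    proof -
      have "maximal_fun f x \<le> maximal_fun (\<lambda>y. ?g y + ennreal (l / 2)) x"
        using \<open>l > 0\<close> nonneg
        by (intro maximal_fun_mono) (auto simp: indicator_def simp flip: ennreal_plus intro!:
            ennreal_leI)
      also have "\<dots> \<le> maximal_fun ?g x + ennreal (l / 2)"
        by (rule maximal_fun_add_const) measurable
      finally show ?thesis .
    qed
    have "{x. l < ?M x} \<subseteq> {x. ennreal (l / 2) < maximal_fun ?g x}"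
    proof (intro subsetI CollectI, elim CollectE, rule ccontr)
      fix x assume "l < ?M x" "\<not> ennreal (l / 2) < maximal_fun ?g x"
      then have "maximal_fun f x \<le> ennreal (l / 2) + ennreal (l / 2)"
        by (intro order_trans[OF le[of x]] add_mono) auto
      also have "\<dots> = ennreal l" using \<open>l > 0\<close> by (simp flip: ennreal_plus)
      finally have "?M x \<le> l" using \<open>l > 0\<close> by (simp add: enn2real_leI)
      then show False using \<open>l < ?M x\<close> by simp
    qed
    then have "ennreal (l / 2) * emeasure lborel {x. l < ?M x}
        \<le> ennreal (l / 2) * emeasure lborel {x. ennreal (l / 2) < maximal_fun ?g x}"
      by (intro mult_left_mono emeasure_mono) auto
    also have "\<dots> \<le> 5 ^ DIM('a) * (\<integral>\<^sup>+x. ?g x \<partial>lborel)"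
      using \<open>l > 0\<close> by (intro maximal_fun_weak_type) auto
    finally have "ennreal (2 / l) * (ennreal (l / 2) * emeasure lborel {x. l < ?M x})
        \<le> ennreal (2 / l) * (5 ^ DIM('a) * (\<integral>\<^sup>+x. ?g x \<partial>lborel))"
      by (rule mult_left_mono) simp
    moreover have "ennreal (2 / l) * ennreal (l / 2) = 1"
      using \<open>l > 0\<close> by (simp flip: ennreal_mult)
    moreover have "ennreal (2 / l) * 5 ^ DIM('a) = ennreal (2 * 5 ^ DIM('a) / l)"
    proof -
      have "(5::ennreal) ^ DIM('a) = ennreal (5 ^ DIM('a))" by (simp flip: ennreal_power)
      then show ?thesis using \<open>l > 0\<close> by (simp add: field_simps flip: ennreal_mult)
    qed
    ultimately show ?thesis
      by (simp flip: mult.assoc)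
  qed
  \<comment> \<open>The layer-cake formula turns the q-th power into an integral over levels, where
    the weak bound applies.\<close>
  have layer: "ennreal (y powr q) = (\<integral>\<^sup>+l. ennreal (q * l powr (q - 1)) * indicator {0<..<y} l
      \<partial>lborel)" if "y \<ge> 0" for y
  proof -
    have "(\<integral>\<^sup>+l. ennreal (q * l powr (q - 1)) * indicator {0<..<y} l \<partial>lborel)
        = (\<integral>\<^sup>+l. ennreal q * ennreal (l powr (q - 1) * indicator {0<..<y} l) \<partial>lborel)"
      using \<open>q > 1\<close> by (intro nn_integral_cong) (auto simp: indicator_def ennreal_mult)
    also have "\<dots> = ennreal (y powr q)"
      using \<open>q > 1\<close> nn_integral_powr_0[of "q - 1" y] that
      by (subst nn_integral_cmult) (auto simp flip: ennreal_mult)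
    finally show ?thesis ..
  qed
  have "(\<integral>\<^sup>+x. ennreal (?M x powr q) \<partial>lborel)
      = (\<integral>\<^sup>+x. \<integral>\<^sup>+l. ennreal (q * l powr (q - 1)) * indicator {0<..<?M x} l \<partial>lborel \<partial>lborel)"
    by (simp add: layer)
  also have "\<dots> = (\<integral>\<^sup>+x. \<integral>\<^sup>+l. ?F x l \<partial>lborel \<partial>lborel)"
    by (intro nn_integral_cong) (auto simp: indicator_def)
  also have "\<dots> = (\<integral>\<^sup>+l. \<integral>\<^sup>+x. ?F x l \<partial>lborel \<partial>lborel)"
    by (rule lborel_pair.Fubini'[symmetric]) measurable
  also have "\<dots> = (\<integral>\<^sup>+l. ennreal (q * l powr (q - 1)) *
      (indicator {0<..} l * emeasure lborel {x. l < ?M x}) \<partial>lborel)"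
  proof (intro nn_integral_cong)
    fix l :: real
    have "(\<integral>\<^sup>+x. ?F x l \<partial>lborel)
       = (\<integral>\<^sup>+x. ennreal (q * l powr (q - 1)) * indicator {0<..} l * indicator {x. l < ?M x} x
           \<partial>lborel)"
      by (intro nn_integral_cong) (auto simp: indicator_def)
    also have "\<dots> = ennreal (q * l powr (q - 1)) * indicator {0<..} l
        * emeasure lborel {x. l < ?M x}"
      by (subst nn_integral_cmult) auto
    finally show "(\<integral>\<^sup>+x. ?F x l \<partial>lborel)
      = ennreal (q * l powr (q - 1)) * (indicator {0<..} l * emeasure lborel {x. l < ?M x})"
      by (simp add: mult.assoc)
  qed
  also have "\<dots> \<le> (\<integral>\<^sup>+l. \<integral>\<^sup>+x. ?G x l \<partial>lborel \<partial>lborel)"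
  proof (intro nn_integral_mono)
    fix l :: real
    show "ennreal (q * l powr (q - 1)) * (indicator {0<..} l * emeasure lborel {x. l < ?M x})
      \<le> (\<integral>\<^sup>+x. ?G x l \<partial>lborel)"
    proof (cases "l > 0")
      case True
      have "ennreal (q * l powr (q - 1)) * emeasure lborel {x. l < ?M x}
        \<le> ennreal (q * l powr (q - 1)) * (ennreal (2 * 5 ^ DIM('a) / l) *
            (\<integral>\<^sup>+x. ennreal (f x) * indicator {x. l < 2 * f x} x \<partial>lborel))"
        by (intro mult_left_mono weak True) simp
      also have "\<dots> = ennreal (q * (2 * 5 ^ DIM('a)) * l powr (q - 2)) *
          (\<integral>\<^sup>+x. ennreal (f x) * indicator {x. l < 2 * f x} x \<partial>lborel)"
      proof -
        have "l powr (q - 1) = l powr (q - 2) * l"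
          using True powr_add[of l "q - 2" 1] by simp
        then have "q * l powr (q - 1) * (2 * 5 ^ DIM('a) / l) = q * (2 * 5 ^ DIM('a)) * l powr
            (q - 2)"
          using True by simp
        then show ?thesis
          using True \<open>q > 1\<close> by (simp flip: mult.assoc ennreal_mult)
      qed
      also have "\<dots> = (\<integral>\<^sup>+x. ennreal (q * (2 * 5 ^ DIM('a)) * l powr (q - 2)) *
          (ennreal (f x) * indicator {x. l < 2 * f x} x) \<partial>lborel)"
        by (rule nn_integral_cmult[symmetric]) measurable
      finally show ?thesis
        using True by (simp add: indicator_def)
    qed simp
  qed
  also have "\<dots> = (\<integral>\<^sup>+x. \<integral>\<^sup>+l. ?G x l \<partial>lborel \<partial>lborel)"
    by (rule lborel_pair.Fubini') measurable
  also have "\<dots> = (\<integral>\<^sup>+x. ennreal (q * (2 * 5 ^ DIM('a)) * 2 powr (q - 1) / (q - 1)) * ennreal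
      (f x powr q) \<partial>lborel)"
  proof (intro nn_integral_cong)
    fix x :: 'a
    have "(\<integral>\<^sup>+l. ?G x l \<partial>lborel)
      = (\<integral>\<^sup>+l. ennreal (q * (2 * 5 ^ DIM('a)) * f x) * ennreal
          (l powr (q - 2) * indicator {0<..<2 * f x} l) \<partial>lborel)"
      using \<open>q > 1\<close> nonneg[of x]
      by (intro nn_integral_cong) (auto simp: indicator_def ac_simps simp flip: ennreal_mult)
    also have "\<dots> = ennreal (q * (2 * 5 ^ DIM('a)) * f x) * ennreal ((2 * f x) powr (q - 2 + 1) /
        (q - 2 + 1))"
      using \<open>q > 1\<close> nonneg[of x] by (subst nn_integral_cmult) (auto simp: nn_integral_powr_0)
    also have "\<dots> = ennreal (q * (2 * 5 ^ DIM('a)) * 2 powr (q - 1) / (q - 1)) * ennreal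
        (f x powr q)"
    proof -
      have "(2 * f x) powr (q - 1) * f x = 2 powr (q - 1) * f x powr q"
      proof (cases "f x = 0")
        case False
        then have "f x > 0" using nonneg[of x] by simp
        then show ?thesis using powr_add[of "f x" "q - 1" 1] by (simp add: powr_mult)
      qed (use \<open>q > 1\<close> in simp)
      then have "q * (2 * 5 ^ DIM('a)) * f x * ((2 * f x) powr (q - 1) / (q - 1))
         = q * (2 * 5 ^ DIM('a)) * 2 powr (q - 1) / (q - 1) * f x powr q"
        by (simp add: field_simps)
      then show ?thesis
        using \<open>q > 1\<close> nonneg[of x] by (simp flip: ennreal_mult)
    qed
    finally show "(\<integral>\<^sup>+l. ?G x l \<partial>lborel)
      = ennreal (q * (2 * 5 ^ DIM('a)) * 2 powr (q - 1) / (q - 1)) * ennreal (f x powr q)" .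
  qed
  also have "\<dots> = ennreal (q * (2 * 5 ^ DIM('a)) * 2 powr (q - 1) / (q - 1)) *
      (\<integral>\<^sup>+x. ennreal (f x powr q) \<partial>lborel)"
    by (rule nn_integral_cmult) measurable
  finally show ?thesis .
qed

subsection \<open>Integrals against polynomially decaying weights\<close>

text \<open>The integral of this weight does not depend on t, as for a dilated Schwartz function.
  The smallest natural exponent for integrability is K = N + 1; doubling it leaves a spare half that
  can be spent on shifting the centre.\<close>

definition wt :: "nat \<Rightarrow> real \<Rightarrow> 'a::euclidean_space \<Rightarrow> real" where
  "wt K t w = 1 / (t ^ DIM('a) * (1 + norm w / t) ^ K)"

lemma one_plus_norm_power_pos: "t > 0 \<Longrightarrow> 0 < (1 + norm w / t) ^ K"
  by (intro zero_less_power add_pos_nonneg) auto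

lemma wt_pos: "t > 0 \<Longrightarrow> wt K t w > 0"
  unfolding wt_def by (intro divide_pos_pos mult_pos_pos zero_less_power add_pos_nonneg) auto

lemma wt_nonneg: "t > 0 \<Longrightarrow> wt K t w \<ge> 0"
  using wt_pos by (rule less_imp_le)

lemma wt_measurable [measurable]: "wt K t \<in> borel_measurable borel"
  unfolding wt_def[abs_def] by measurable

lemma wt_uminus [simp]: "wt K t (- w) = wt K t w"
  by (simp add: wt_def)

lemma wt_commute: "wt K t (x - y) = wt K t (y - x)"
  by (simp add: wt_def norm_minus_commute)

lemma wt_antimono: "t > 0 \<Longrightarrow> K \<le> K' \<Longrightarrow> wt K' t w \<le> wt K t w"
  unfolding wt_def by (intro divide_left_mono mult_left_mono power_increasing mult_pos_pos)
     (auto intro: one_plus_norm_power_pos)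

text \<open>The tail factor only grows when s is replaced by the larger t, and the prefactor loses
  exactly the ratio of volumes.\<close>

lemma wt_rescale:
  fixes w :: "'a::euclidean_space"
  assumes "0 < s" "s \<le> t"
  shows "wt K s w \<le> (t / s) ^ DIM('a) * wt K t w"
proof -
  have "(1 + norm w / t) ^ K \<le> (1 + norm w / s) ^ K"
    using assms by (intro power_mono add_mono divide_left_mono) auto
  moreover have "(1 + norm w / t) ^ K > 0"
    using assms by (intro zero_less_power add_pos_nonneg) auto
  ultimately have "1 / (1 + norm w / s) ^ K \<le> 1 / (1 + norm w / t) ^ K"
    by (intro divide_left_mono) auto
  then have "1 / s ^ DIM('a) * (1 / (1 + norm w / s) ^ K) \<le> 1 / s ^ DIM('a) *
      (1 / (1 + norm w / t) ^ K)"
    using assms by (intro mult_left_mono) auto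
  then show ?thesis
    using assms by (simp add: wt_def power_divide)
qed

lemma wt_double: "wt (2 * K) t w = wt K t w / (1 + norm w / t) ^ K"
  by (simp add: wt_def power_add mult_2)

text \<open>Peetre's inequality: 1 + |u + v|/t is at most (1 + |u|/t) (1 + |v|/t).\<close>

lemma wt_peetre:
  assumes "t > 0"
  shows "wt K t u / (1 + norm v / t) ^ K \<le> wt K t (u + v)"
proof -
  have "1 + norm (u + v) / t \<le> 1 + (norm u + norm v) / t"
    using assms by (intro add_left_mono divide_right_mono norm_triangle_ineq) auto
  also have "\<dots> \<le> (1 + norm u / t) * (1 + norm v / t)"
    using assms by (simp add: field_simps)
  finally have "(1 + norm (u + v) / t) ^ K \<le> ((1 + norm u / t) * (1 + norm v / t)) ^ K"
    using assms by (intro power_mono) auto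
  moreover have "(1 + norm (u + v) / t) ^ K > 0"
    using assms by (intro zero_less_power add_pos_nonneg) auto
  ultimately have "1 / (t ^ DIM('a) * ((1 + norm u / t) * (1 + norm v / t)) ^ K) \<le> wt K t (u + v)"
    unfolding wt_def using assms by (intro divide_left_mono mult_left_mono mult_pos_pos) auto
  then show ?thesis
    by (simp add: wt_def power_mult_distrib)
qed

text \<open>The weight in y - z is first enlarged to scale t. The spare half of the weight in x - y
  then pays, by Peetre, for replacing y - z by x - z, and the two variables are decoupled.\<close>

lemma wt_prod_le_rescaled:
  fixes x :: "'a::euclidean_space"
  assumes "0 < s" "s \<le> t"
  shows "wt (2 * K) s (y - z) * wt (2 * K) t (x - y) \<le> (t / s) ^ DIM('a) *
      (wt K t (x - y) * wt K t (x - z))"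
proof -
  have "wt (2 * K) s (y - z) \<le> (t / s) ^ DIM('a) * wt K t (y - z)"
    using assms by (intro order_trans[OF wt_antimono[of s K "2 * K"] wt_rescale]) auto
  then have "wt (2 * K) s (y - z) * wt (2 * K) t (x - y)
      \<le> ((t / s) ^ DIM('a) * wt K t (y - z)) * (wt K t (x - y) / (1 + norm (x - y) / t) ^ K)"
    unfolding wt_double[of K t] using assms by (intro mult_right_mono divide_nonneg_nonneg
        wt_nonneg) auto
  also have "\<dots> = ((t / s) ^ DIM('a) * wt K t (x - y)) *
      (wt K t (y - z) / (1 + norm (x - y) / t) ^ K)"
    by simp
  also have "\<dots> \<le> ((t / s) ^ DIM('a) * wt K t (x - y)) * wt K t ((y - z) + (x - y))"
    using assms by (intro mult_left_mono wt_peetre mult_nonneg_nonneg wt_nonneg) auto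
  finally show ?thesis by (simp add: mult.assoc)
qed

text \<open>Here the spare half is taken from the weight in y - z, whose decay at scale s \<le> t is
  at least as strong as at scale t. A kernel at scale s survives and can be integrated in y.\<close>

lemma wt_prod_le:
  assumes "0 < s" "s \<le> t"
  shows "wt (2 * K) s (y - z) * wt (2 * K) t (x - y) \<le> wt K s (y - z) * wt K t (x - z)"
proof -
  have t: "0 < 1 + norm (y - z) / t" using assms by (intro add_pos_nonneg) auto
  have "wt (2 * K) s (y - z) \<le> wt K s (y - z) / (1 + norm (y - z) / t) ^ K"
    unfolding wt_double using assms t wt_nonneg[of s K "y - z"]
    by (intro divide_left_mono power_mono add_mono mult_pos_pos zero_less_power)
        (auto intro: add_pos_nonneg)
  moreover have "wt (2 * K) t (x - y) \<le> wt K t (x - y)"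
    using assms by (intro wt_antimono) auto
  ultimately have "wt (2 * K) s (y - z) * wt (2 * K) t (x - y) \<le> wt K s (y - z) /
      (1 + norm (y - z) / t) ^ K * wt K t (x - y)"
    using assms t by (intro mult_mono divide_nonneg_nonneg wt_nonneg) auto
  also have "\<dots> = wt K s (y - z) * (wt K t (x - y) / (1 + norm (y - z) / t) ^ K)"
    by simp
  also have "\<dots> \<le> wt K s (y - z) * wt K t ((x - y) + (y - z))"
    using assms by (intro mult_left_mono wt_peetre wt_nonneg) auto
  finally show ?thesis by simp
qed

text \<open>2^(2N+1) comes from the comparison with dyadic balls and one more 2 from summing 2^-j;
  the volume of the unit ball undoes the normalisation of the averages.\<close>

definition wt_const :: "'a::euclidean_space itself \<Rightarrow> real" where
  "wt_const _ = 2 ^ (2 * DIM('a) + 2) * unit_ball_vol DIM('a)"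

lemma unit_ball_vol_DIM: "unit_ball_vol (real DIM('a::euclidean_space)) > 0"
  by simp

lemma unit_ball_vol_DIM_neq_0: "unit_ball_vol (real DIM('a::euclidean_space)) \<noteq> 0"
  using unit_ball_vol_DIM[where 'a = 'a] by (rule less_imp_neq[symmetric])

lemma wt_const_pos: "wt_const TYPE('a::euclidean_space) > 0"
  unfolding wt_const_def by (intro mult_pos_pos unit_ball_vol_DIM) auto

text \<open>Take j minimal, so that |w| \<ge> 2^(j-1) r unless j = 0. Of the N + 1 powers of decay,
  N match the volume of the ball of radius 2^j r and the last one gives the summable factor 2^-j.
  The play between t and 2t allows r to be rational.\<close>

lemma wt_le_ball_terms:
  fixes w :: "'a::euclidean_space"
  assumes "t > 0" "t < r" "r < 2 * t"
  obtains j where "norm w < 2 ^ j * r"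
    "wt (DIM('a) + 1) t w \<le> 2 ^ (2 * DIM('a) + 1) / (2 ^ j * (2 ^ j * r) ^ DIM('a))"
proof -
  let ?N = "DIM('a)"
  have "r > 0" using assms by linarith
  have "\<exists>j. norm w < 2 ^ j * r"
  proof -
    obtain j where "norm w / r < 2 ^ j" using real_arch_pow[of 2 "norm w / r"] by auto
    then show ?thesis using \<open>r > 0\<close> by (auto simp: field_simps)
  qed
  define j where "j = (LEAST j. norm w < 2 ^ j * r)"
  have j: "norm w < 2 ^ j * r"
    unfolding j_def by (rule LeastI_ex) fact
  have rt: "1 / t ^ ?N \<le> 2 ^ ?N / r ^ ?N"
  proof -
    have "r ^ ?N \<le> (2 * t) ^ ?N" using assms \<open>r > 0\<close> by (intro power_mono) auto
    then show ?thesis using \<open>r > 0\<close> \<open>t > 0\<close> by (simp add: field_simps power_mult_distrib)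
  qed
  show ?thesis
  proof (rule that[OF j], cases j)
    case 0
    have "wt (?N + 1) t w \<le> wt 0 t w" using assms by (intro wt_antimono) auto
    also have "\<dots> \<le> 2 ^ ?N / r ^ ?N" using rt by (simp add: wt_def)
    also have "\<dots> \<le> 2 ^ (2 * ?N + 1) / r ^ ?N"
      using \<open>r > 0\<close> by (intro divide_right_mono power_increasing) auto
    finally show "wt (?N + 1) t w \<le> 2 ^ (2 * ?N + 1) / (2 ^ j * (2 ^ j * r) ^ ?N)"
      using 0 by simp
  next
    case (Suc i)
    have "\<not> norm w < 2 ^ i * r"
      using not_less_Least[of i "\<lambda>j. norm w < 2 ^ j * r"] Suc by (simp add: j_def)
    then have "2 ^ i * t \<le> norm w" using \<open>t < r\<close>
      by (smt (verit) mult_left_mono zero_le_power)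
    then have "2 ^ i \<le> 1 + norm w / t" using \<open>t > 0\<close> by (simp add: field_simps)
    then have "(2 ^ i) ^ (?N + 1) \<le> (1 + norm w / t) ^ (?N + 1)" by (intro power_mono) auto
    then have "1 / (1 + norm w / t) ^ (?N + 1) \<le> 1 / (2 ^ i) ^ (?N + 1)"
      using \<open>t > 0\<close> by (intro divide_left_mono mult_pos_pos one_plus_norm_power_pos) auto
    then have "(1 / t ^ ?N) * (1 / (1 + norm w / t) ^ (?N + 1)) \<le> (2 ^ ?N / r ^ ?N) *
        (1 / (2 ^ i) ^ (?N + 1))"
      using rt \<open>t > 0\<close> \<open>r > 0\<close> by (intro mult_mono) auto
    also have "\<dots> = 2 ^ (2 * ?N + 1) / (2 ^ j * (2 ^ j * r) ^ ?N)"
      using \<open>r > 0\<close> Suc by (simp add: field_simps power_mult_distrib power_add mult_2_right flip: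
          power_mult)
    finally show "wt (?N + 1) t w \<le> 2 ^ (2 * ?N + 1) / (2 ^ j * (2 ^ j * r) ^ ?N)"
      by (simp add: wt_def)
  qed
qed

text \<open>An integrable radially decreasing kernel is dominated by a convergent combination of
  normalised indicators of dyadic balls, with a total mass independent of the scale.\<close>

theorem wt_integral_le_maximal:
  fixes F :: "'a::euclidean_space \<Rightarrow> ennreal"
  assumes [measurable]: "F \<in> borel_measurable borel" and "t > 0"
  shows "(\<integral>\<^sup>+y. F y * ennreal (wt (DIM('a) + 1) t (x - y)) \<partial>lborel)
    \<le> ennreal (wt_const TYPE('a)) * maximal_fun F x"
proof -
  let ?N = "DIM('a)" and ?\<omega> = "unit_ball_vol DIM('a)"
  \<comment> \<open>The supremum in \<open>maximal_fun\<close> runs over rational radii;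
    multiplication by powers of 2 keeps them rational.\<close>
  obtain q where q: "t < real_of_rat q" "real_of_rat q < 2 * t"
    using of_rat_dense[of t "2 * t"] \<open>t > 0\<close> by auto
  define r where "r = real_of_rat q"
  have r: "t < r" "r < 2 * t" "r > 0" using q \<open>t > 0\<close> unfolding r_def by linarith+
  have [measurable]: "ball x e \<in> sets borel" for e by simp
  define a where "a j = ennreal (2 ^ (2 * ?N + 1) / (2 ^ j * (2 ^ j * r) ^ ?N))" for j :: nat
  have "ennreal (wt (?N + 1) t (x - y)) \<le> (\<Sum>j. a j * indicator (ball x (2 ^ j * r)) y)" for y
  proof -
    obtain j where j: "norm (x - y) < 2 ^ j * r"
      "wt (?N + 1) t (x - y) \<le> 2 ^ (2 * ?N + 1) / (2 ^ j * (2 ^ j * r) ^ ?N)"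
      by (rule wt_le_ball_terms[OF \<open>t > 0\<close> r(1,2)])
    have "ennreal (wt (?N + 1) t (x - y)) \<le> a j * indicator (ball x (2 ^ j * r)) y"
      using j by (simp add: a_def dist_norm ennreal_leI)
    also have "\<dots> \<le> (\<Sum>i. a i * indicator (ball x (2 ^ i * r)) y)"
    proof -
      define b where "b i = a i * indicator (ball x (2 ^ i * r)) y" for i
      have "sum b {j} \<le> suminf b" by (rule sum_le_suminf) auto
      then have "b j \<le> suminf b" by simp
      then show ?thesis unfolding b_def .
    qed
    finally show ?thesis .
  qed
  then have "(\<integral>\<^sup>+y. F y * ennreal (wt (?N + 1) t (x - y)) \<partial>lborel)
      \<le> (\<integral>\<^sup>+y. F y * (\<Sum>j. a j * indicator (ball x (2 ^ j * r)) y) \<partial>lborel)"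
    by (intro nn_integral_mono mult_left_mono) auto
  also have "\<dots> = (\<integral>\<^sup>+y. (\<Sum>j. a j * (F y * indicator (ball x (2 ^ j * r)) y)) \<partial>lborel)"
    by (intro nn_integral_cong) (simp add: ac_simps flip: ennreal_suminf_cmult)
  also have "\<dots> = (\<Sum>j. a j * (\<integral>\<^sup>+y. F y * indicator (ball x (2 ^ j * r)) y \<partial>lborel))"
    by (subst nn_integral_suminf) (auto simp: nn_integral_cmult)
  also have "\<dots> \<le> (\<Sum>j. ennreal (2 ^ (2 * ?N + 1) * ?\<omega> * (1 / 2) ^ j) * maximal_fun F x)"
  proof (intro suminf_le)
    fix j :: nat
    have "a j * (\<integral>\<^sup>+y. F y * indicator (ball x (2 ^ j * r)) y \<partial>lborel)
        = ennreal (2 ^ (2 * ?N + 1) * ?\<omega> * (1 / 2) ^ j) * ball_avg F (2 ^ j * r) x"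
    proof -
      have "ennreal (2 ^ (2 * ?N + 1) * ?\<omega> * (1 / 2) ^ j) * ennreal (1 / (?\<omega> * (2 ^ j * r) ^ ?N))
          = a j"
      proof -
        have "A * w * (1 / 2) ^ j * (1 / (w * X)) = A / (2 ^ j * X)" if "w \<noteq> 0" for A w X :: real
          using that by (simp add: power_one_over)
        note eq = this[of ?\<omega> "2 ^ (2 * ?N + 1)" "(2 ^ j * r) ^ ?N", OF unit_ball_vol_DIM_neq_0]
        show ?thesis
          unfolding a_def eq[symmetric] using r unit_ball_vol_DIM[where 'a = 'a]
          by (intro ennreal_mult[symmetric] mult_nonneg_nonneg divide_nonneg_nonneg) auto
      qed
      then show ?thesis
        unfolding ball_avg_def by (simp only: mult_ac flip: \<open>_ = a j\<close>)
    qed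
    also have "\<dots> \<le> ennreal (2 ^ (2 * ?N + 1) * ?\<omega> * (1 / 2) ^ j) * maximal_fun F x"
    proof (rule mult_left_mono)
      have "2 ^ j * q > 0" using r(3) by (simp add: r_def)
      from ball_avg_le_maximal[OF this, of F x] show "ball_avg F (2 ^ j * r) x \<le> maximal_fun F x"
        by (simp add: r_def of_rat_mult of_rat_power)
    qed simp
    finally show "a j * (\<integral>\<^sup>+y. F y * indicator (ball x (2 ^ j * r)) y \<partial>lborel)
      \<le> ennreal (2 ^ (2 * ?N + 1) * ?\<omega> * (1 / 2) ^ j) * maximal_fun F x" .
  qed auto
  also have "\<dots> = (\<Sum>j. ennreal (2 ^ (2 * ?N + 1) * ?\<omega> * (1 / 2) ^ j)) * maximal_fun F x"
    by simp
  also have "(\<Sum>j. ennreal (2 ^ (2 * ?N + 1) * ?\<omega> * (1 / 2) ^ j)) = ennreal (wt_const TYPE('a))"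
  proof -
    have "(\<lambda>j. 2 ^ (2 * ?N + 1) * ?\<omega> * (1 / 2) ^ j) sums (2 ^ (2 * ?N + 1) * ?\<omega> * 2)"
      using geometric_sums[of "1 / 2 :: real"] by (intro sums_mult) simp
    then show ?thesis
      using unit_ball_vol_DIM[where 'a = 'a] by (subst suminf_ennreal_eq)
          (auto simp: wt_const_def mult_ac)
  qed
  finally show ?thesis .
qed

lemma wt_integral_le:
  fixes x :: "'a::euclidean_space"
  assumes "t > 0"
  shows "(\<integral>\<^sup>+y. ennreal (wt (DIM('a) + 1) t (x - y)) \<partial>lborel) \<le> ennreal (wt_const TYPE('a))"
    (is ?A)
    and "(\<integral>\<^sup>+y. ennreal (wt (DIM('a) + 1) t (y - x)) \<partial>lborel) \<le> ennreal (wt_const TYPE('a))"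
proof -
  have "maximal_fun (\<lambda>_. 1) x \<le> 1"
    unfolding maximal_fun_def by (intro SUP_least) (auto simp: ball_avg_const)
  then have "ennreal (wt_const TYPE('a)) * maximal_fun (\<lambda>_. 1) x \<le> ennreal (wt_const TYPE('a)) * 1"
    by (rule mult_left_mono) simp
  then show ?A
    using wt_integral_le_maximal[of "\<lambda>_. 1" t x] assms by simp
  then show "(\<integral>\<^sup>+y. ennreal (wt (DIM('a) + 1) t (y - x)) \<partial>lborel) \<le> ennreal (wt_const TYPE('a))"
    by (simp only: wt_commute[of _ t x])
qed

text \<open>Every base is replaced by the total x + y + z, after which the exponents add up to
  1.\<close>

lemma powr_prod3_le_sum:
  fixes x y z :: real
  assumes "x \<ge> 0" "y \<ge> 0" "z \<ge> 0" "a \<ge> 0" "b \<ge> 0" "c \<ge> 0" "a + b + c = 1"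
  shows "x powr a * y powr b * z powr c \<le> x + y + z"
proof -
  let ?m = "x + y + z"
  have "x powr a * y powr b * z powr c \<le> ?m powr a * ?m powr b * ?m powr c"
    using assms by (intro mult_mono powr_mono2) auto
  also have "\<dots> = ?m powr 1" by (simp only: assms(7) flip: powr_add)
  finally show ?thesis using assms by simp
qed

text \<open>Distributing the exponents by weighted AM--GM costs only a small power of \<open>t / s\<close>: this
  replaces the Sobolev inequality in the classical proof of the div-curl lemma.\<close>

lemma bilinear_wt_bound_aux:
  fixes F G :: "'a::euclidean_space \<Rightarrow> real"
  assumes [measurable]: "F \<in> borel_measurable borel" "G \<in> borel_measurable borel"
    and nonneg: "\<And>y. F y \<ge> 0" "\<And>y. G y \<ge> 0"
    and st: "0 < s" "s \<le> t" and AB: "A > 0" "B > 0"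
    and max: "maximal_fun (\<lambda>y. ennreal (F y)) x \<le> ennreal A" "maximal_fun (\<lambda>y. ennreal (G y)) x
        \<le> ennreal B"
    and exps: "0 < \<delta>" "\<delta> \<le> \<alpha>" "\<delta> \<le> \<beta>" "\<alpha> + \<beta> = 1 + \<delta>"
  shows "(\<integral>\<^sup>+y. \<integral>\<^sup>+z. ennreal (F y powr \<alpha> * G z powr \<beta> * wt (2 * (DIM('a) + 1)) s (y - z) * wt
      (2 * (DIM('a) + 1)) t (x - y)) \<partial>lborel \<partial>lborel)
    \<le> ennreal (3 * (wt_const TYPE('a))\<^sup>2 * ((t / s) ^ DIM('a)) powr \<delta> * A powr \<alpha> * B powr \<beta>)"
proof -
  let ?K = "DIM('a) + 1" and ?C = "wt_const TYPE('a)"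
  define \<rho> where "\<rho> = (t / s) ^ DIM('a)"
  have \<rho>: "\<rho> \<ge> 1" using st by (simp add: \<rho>_def)
  have t: "t > 0" using st by linarith
  define c where "c = \<rho> powr \<delta> * A powr \<alpha> * B powr \<beta>"
  have c: "c \<ge> 0" by (simp add: c_def)
  define a where "a y = F y / A * wt ?K t (x - y)" for y
  define b where "b z = G z / B * wt ?K t (x - z)" for z
  define k where "k y z = wt ?K s (y - z)" for y z :: 'a
  have [measurable]: "a \<in> borel_measurable borel" "b \<in> borel_measurable borel"
    "(\<lambda>(y, z). k y z) \<in> borel_measurable (borel \<Otimes>\<^sub>M borel)"
    unfolding a_def[abs_def] b_def[abs_def] k_def[abs_def] by measurable
  have abk: "a y \<ge> 0" "b y \<ge> 0" "k y z \<ge> 0" for y z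
    using nonneg AB t st by (auto simp: a_def b_def k_def intro!: divide_nonneg_nonneg
        mult_nonneg_nonneg wt_nonneg)
  have pw: "F y powr \<alpha> * G z powr \<beta> * wt (2 * ?K) s (y - z) * wt (2 * ?K) t (x - y)
      \<le> c * (a y * b z + a y * k y z + b z * k y z)" for y z
  proof -
    define f g where "f = F y / A" and "g = G z / B"
    have fg: "f \<ge> 0" "g \<ge> 0" using nonneg AB by (auto simp: f_def g_def)
    let ?w = "wt (2 * ?K) s (y - z) * wt (2 * ?K) t (x - y)"
    have w0: "?w \<ge> 0" using st t by (intro mult_nonneg_nonneg wt_nonneg)
    have "F y powr \<alpha> * G z powr \<beta> = A powr \<alpha> * B powr \<beta> * (f powr \<alpha> * g powr \<beta>)"
      using fg AB nonneg by (simp add: f_def g_def powr_divide)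
    \<comment> \<open>The exponents \<delta>, \<alpha> - \<delta> and \<beta> - \<delta> add up to
      1, as AM-GM requires. Dividing f g by \<rho> beforehand compensates the volume ratio that this
      term meets below.\<close>
    also have "f powr \<alpha> * g powr \<beta> = \<rho> powr \<delta> * ((f * g / \<rho>) powr \<delta> * f powr (\<alpha> - \<delta>) * g powr
        (\<beta> - \<delta>))"
      using fg \<rho> powr_add[of f \<delta> "\<alpha> - \<delta>"] powr_add[of g \<delta> "\<beta> - \<delta>"]
      by (simp add: powr_divide powr_mult)
    finally have "F y powr \<alpha> * G z powr \<beta> = c * ((f * g / \<rho>) powr \<delta> * f powr (\<alpha> - \<delta>) * g powr
        (\<beta> - \<delta>))"
      by (simp add: c_def)
    also have "\<dots> \<le> c * (f * g / \<rho> + f + g)"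
      using fg \<rho> exps c by (intro mult_left_mono powr_prod3_le_sum) auto
    finally have "F y powr \<alpha> * G z powr \<beta> * ?w \<le> c * (f * g / \<rho> + f + g) * ?w"
      using w0 by (rule mult_right_mono)
    also have "\<dots> = c * (f * g / \<rho> * ?w + f * ?w + g * ?w)"
      by (simp add: algebra_simps)
    \<comment> \<open>The term with f g is decoupled at scale t and pays \<rho>. The terms with f
      alone or g alone keep the kernel at scale s, which integrates out in the free variable at no
      cost.\<close>
    also have "\<dots> \<le> c * (a y * b z + a y * k y z + b z * k y z)"
    proof (intro mult_left_mono add_mono c)
      have "f * g / \<rho> * ?w \<le> f * g / \<rho> * (\<rho> * (wt ?K t (x - y) * wt ?K t (x - z)))"
        using fg \<rho> unfolding \<rho>_def by (intro mult_left_mono wt_prod_le_rescaled st) auto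
      also have "\<dots> = a y * b z" using \<rho> by (simp add: a_def b_def f_def g_def)
      finally show "f * g / \<rho> * ?w \<le> a y * b z" .
      have "?w \<le> k y z * wt ?K t (x - y)"
        unfolding k_def using st t by (intro mult_mono wt_antimono wt_nonneg) auto
      then show "f * ?w \<le> a y * k y z"
        using fg mult_left_mono[of ?w "k y z * wt ?K t (x - y)" f] by
            (simp add: a_def f_def mult_ac)
      have "?w \<le> k y z * wt ?K t (x - z)"
        unfolding k_def by (intro wt_prod_le st)
      then show "g * ?w \<le> b z * k y z"
        using fg mult_left_mono[of ?w "k y z * wt ?K t (x - z)" g] by
            (simp add: b_def g_def mult_ac)
    qed
    finally show ?thesis by (simp only: mult.assoc)
  qed
  have a_int: "(\<integral>\<^sup>+y. ennreal (a y) \<partial>lborel) \<le> ennreal ?C"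
    and b_int: "(\<integral>\<^sup>+y. ennreal (b y) \<partial>lborel) \<le> ennreal ?C"
  proof -
    have *: "(\<integral>\<^sup>+y. ennreal (H y / D * wt ?K t (x - y)) \<partial>lborel) \<le> ennreal ?C"
      if [measurable]: "H \<in> borel_measurable borel" and "D > 0" "\<And>y. H y \<ge> 0"
        and m: "maximal_fun (\<lambda>y. ennreal (H y)) x \<le> ennreal D" for H D
    proof -
      have "(\<integral>\<^sup>+y. ennreal (H y / D * wt ?K t (x - y)) \<partial>lborel)
          = (\<integral>\<^sup>+y. ennreal (1 / D) * (ennreal (H y) * ennreal (wt ?K t (x - y))) \<partial>lborel)"
        using that t by (intro nn_integral_cong) (simp add: wt_nonneg flip: ennreal_mult)
      also have "\<dots> = ennreal (1 / D) * (\<integral>\<^sup>+y. ennreal (H y) * ennreal (wt ?K t (x - y)) \<partial>lborel)"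
        by (rule nn_integral_cmult) measurable
      also have "\<dots> \<le> ennreal (1 / D) * (ennreal ?C * ennreal D)"
        using t by (intro mult_left_mono order_trans[OF wt_integral_le_maximal] mult_left_mono m)
            auto
      also have "\<dots> = ennreal ?C"
        using \<open>D > 0\<close> wt_const_pos[where 'a = 'a] by (simp flip: ennreal_mult)
      finally show ?thesis .
    qed
    show "(\<integral>\<^sup>+y. ennreal (a y) \<partial>lborel) \<le> ennreal ?C" "(\<integral>\<^sup>+y. ennreal (b y) \<partial>lborel) \<le> ennreal ?C"
      unfolding a_def b_def using * assms by auto
  qed
  have k_int: "(\<integral>\<^sup>+z. ennreal (k y z) \<partial>lborel) \<le> ennreal ?C" "(\<integral>\<^sup>+y. ennreal (k y z) \<partial>lborel)
      \<le> ennreal ?C" for y z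
    unfolding k_def by (intro wt_integral_le st)+
  have "(\<integral>\<^sup>+y. \<integral>\<^sup>+z. ennreal (F y powr \<alpha> * G z powr \<beta> * wt (2 * ?K) s (y - z) * wt (2 * ?K) t
      (x - y)) \<partial>lborel \<partial>lborel)
    \<le> (\<integral>\<^sup>+y. \<integral>\<^sup>+z. ennreal c * (ennreal (a y) * ennreal (b z) + (ennreal (a y) * ennreal (k y z)
        + ennreal (b z) * ennreal (k y z))) \<partial>lborel \<partial>lborel)"
    using pw c abk by (intro nn_integral_mono) (simp add: add_ac ennreal_leI flip: ennreal_mult
        ennreal_plus)
  also have "\<dots> = ennreal c * ((\<integral>\<^sup>+y. \<integral>\<^sup>+z. ennreal (a y) * ennreal (b z) \<partial>lborel \<partial>lborel)
      + ((\<integral>\<^sup>+y. \<integral>\<^sup>+z. ennreal (a y) * ennreal (k y z) \<partial>lborel \<partial>lborel)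
       + (\<integral>\<^sup>+y. \<integral>\<^sup>+z. ennreal (b z) * ennreal (k y z) \<partial>lborel \<partial>lborel)))"
    by (simp add: nn_integral_cmult nn_integral_add)
  also have "(\<integral>\<^sup>+y. \<integral>\<^sup>+z. ennreal (b z) * ennreal (k y z) \<partial>lborel \<partial>lborel)
      = (\<integral>\<^sup>+z. \<integral>\<^sup>+y. ennreal (b z) * ennreal (k y z) \<partial>lborel \<partial>lborel)"
    by (rule lborel_pair.Fubini') measurable
  also have "(\<integral>\<^sup>+z. \<integral>\<^sup>+y. ennreal (b z) * ennreal (k y z) \<partial>lborel \<partial>lborel)
      = (\<integral>\<^sup>+z. ennreal (b z) * (\<integral>\<^sup>+y. ennreal (k y z) \<partial>lborel) \<partial>lborel)"
    by (intro nn_integral_cong nn_integral_cmult) measurable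
  also have "(\<integral>\<^sup>+y. \<integral>\<^sup>+z. ennreal (a y) * ennreal (k y z) \<partial>lborel \<partial>lborel)
      = (\<integral>\<^sup>+y. ennreal (a y) * (\<integral>\<^sup>+z. ennreal (k y z) \<partial>lborel) \<partial>lborel)"
    by (intro nn_integral_cong nn_integral_cmult) measurable
  also have "(\<integral>\<^sup>+y. \<integral>\<^sup>+z. ennreal (a y) * ennreal (b z) \<partial>lborel \<partial>lborel)
      = (\<integral>\<^sup>+y. ennreal (a y) \<partial>lborel) * (\<integral>\<^sup>+z. ennreal (b z) \<partial>lborel)"
    by (simp add: nn_integral_cmult nn_integral_multc)
  also have "ennreal c * ((\<integral>\<^sup>+y. ennreal (a y) \<partial>lborel) * (\<integral>\<^sup>+z. ennreal (b z) \<partial>lborel)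
      + ((\<integral>\<^sup>+y. ennreal (a y) * (\<integral>\<^sup>+z. ennreal (k y z) \<partial>lborel) \<partial>lborel)
       + (\<integral>\<^sup>+z. ennreal (b z) * (\<integral>\<^sup>+y. ennreal (k y z) \<partial>lborel) \<partial>lborel)))
    \<le> ennreal c * (ennreal ?C * ennreal ?C + ((\<integral>\<^sup>+y. ennreal (a y) * ennreal ?C \<partial>lborel) +
        (\<integral>\<^sup>+z. ennreal (b z) * ennreal ?C \<partial>lborel)))"
    by (intro mult_left_mono add_mono mult_mono nn_integral_mono a_int b_int k_int) auto
  also have "\<dots> = ennreal c * (ennreal ?C * ennreal ?C + ((\<integral>\<^sup>+y. ennreal (a y) \<partial>lborel)
      * ennreal ?C + (\<integral>\<^sup>+z. ennreal (b z) \<partial>lborel) * ennreal ?C))"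
    by (simp add: nn_integral_multc)
  also have "\<dots> \<le> ennreal c * (ennreal ?C * ennreal ?C + (ennreal ?C * ennreal ?C + ennreal ?C
      * ennreal ?C))"
    by (intro mult_left_mono add_mono mult_right_mono a_int b_int) auto
  also have "\<dots> = ennreal (3 * ?C\<^sup>2 * c)"
    using c wt_const_pos[where 'a = 'a]
    by (simp add: power2_eq_square mult_ac flip: ennreal_mult ennreal_plus)
  finally show ?thesis
    by (simp add: c_def \<rho>_def mult_ac)
qed

text \<open>The maximal functions may vanish, whereas the preceding estimate divides by its upper
  bounds A and B. It is applied with 1/(n+1) added to both, followed by a limit.\<close>

lemma bilinear_wt_bound:
  fixes F G :: "'a::euclidean_space \<Rightarrow> real"
  assumes F: "F \<in> borel_measurable borel" "\<And>y. F y \<ge> 0" "maximal_fun (\<lambda>y. ennreal (F y)) x < \<infinity>"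
    and G: "G \<in> borel_measurable borel" "\<And>y. G y \<ge> 0" "maximal_fun (\<lambda>y. ennreal (G y)) x < \<infinity>"
    and st: "0 < s" "s \<le> t"
    and exps: "0 < \<delta>" "\<delta> \<le> \<alpha>" "\<delta> \<le> \<beta>" "\<alpha> + \<beta> = 1 + \<delta>"
  shows "(\<integral>\<^sup>+y. \<integral>\<^sup>+z. ennreal (F y powr \<alpha> * G z powr \<beta> * wt (2 * (DIM('a) + 1)) s (y - z) * wt
      (2 * (DIM('a) + 1)) t (x - y)) \<partial>lborel \<partial>lborel)
    \<le> ennreal (3 * (wt_const TYPE('a))\<^sup>2 * ((t / s) ^ DIM('a)) powr \<delta>
        * enn2real (maximal_fun (\<lambda>y. ennreal (F y)) x) powr \<alpha> * enn2real
            (maximal_fun (\<lambda>y. ennreal (G y)) x) powr \<beta>)"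
    (is "?I \<le> ennreal (?c * ?A powr \<alpha> * ?B powr \<beta>)")
proof (rule tendsto_lowerbound)
  let ?e = "\<lambda>n. inverse (real (Suc n))"
  have "(\<lambda>n. ?A + ?e n) \<longlonglongrightarrow> ?A + 0" "(\<lambda>n. ?B + ?e n) \<longlonglongrightarrow> ?B + 0"
    by (intro tendsto_add tendsto_const LIMSEQ_inverse_real_of_nat)+
  then show "(\<lambda>n. ennreal (?c * (?A + ?e n) powr \<alpha> * (?B + ?e n) powr \<beta>)) \<longlonglongrightarrow> ennreal
      (?c * ?A powr \<alpha> * ?B powr \<beta>)"
    using exps by (intro tendsto_ennrealI tendsto_mult tendsto_const tendsto_powr2) auto
  show "\<forall>\<^sub>F n in sequentially. ?I \<le> ennreal (?c * (?A + ?e n) powr \<alpha> * (?B + ?e n) powr \<beta>)"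
  proof (intro always_eventually allI bilinear_wt_bound_aux assms)
    fix n
    show "?A + ?e n > 0" "?B + ?e n > 0" by (auto intro: add_nonneg_pos)
    have *: "m \<le> ennreal (enn2real m + ?e n)" if "m < \<infinity>" for m
      using that by (cases m) (auto intro!: ennreal_leI)
    show "maximal_fun (\<lambda>y. ennreal (F y)) x \<le> ennreal (?A + ?e n)"
        "maximal_fun (\<lambda>y. ennreal (G y)) x \<le> ennreal (?B + ?e n)"
      using * F G by auto
  qed
qed auto

subsection \<open>The heat kernel of an elliptic system\<close>

text \<open>Since \<open>\<Sum>\<^sub>i L\<^sub>i\<^sup>* L\<^sub>i\<close> has the real symbol \<open>\<xi>\<^sup>T A \<xi>\<close> with \<open>A = Re (c\<^sup>* c)\<close>, its heat kernel is the
  Gaussian of the inverse matrix \<open>B = A\<^sup>-\<^sup>1\<close>, here parametrised by \<open>s = 2 \<surd>\<tau>\<close>.\<close>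

locale heat_kernel =
  fixes c :: "complex^'d::finite^'n::finite" and B :: "real^'d^'d" and \<beta> :: real
  assumes B_sym: "B $ k $ l = B $ l $ k"
    and \<beta>_pos: "\<beta> > 0"
    and B_coercive: "\<beta> * (norm w)\<^sup>2 \<le> w \<bullet> (B *v w)"
    and B_trace: "(\<Sum>i\<in>UNIV. \<Sum>k\<in>UNIV. \<Sum>l\<in>UNIV. cnj (c$i$k) * c$i$l * of_real (B$k$l))
        = of_nat CARD('d)"
    and B_form: "(\<Sum>i\<in>UNIV. (cmod (\<Sum>k\<in>UNIV. c$i$k * of_real ((B *v w)$k)))\<^sup>2) = w \<bullet> (B *v w)"

text \<open>For real v the quadratic form of A is the sum of the squared moduli of the symbols at v,
  so ellipticity amounts to definiteness of A. The trace condition is the trace of A B, the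
  identity.\<close>

lemma elliptic_imp_heat_kernel:
  fixes c :: "complex^'d::finite^'n::finite"
  assumes "elliptic_system c"
  obtains B \<beta> where "heat_kernel c B \<beta>"
proof -
  define M where "M k l = (\<Sum>i\<in>UNIV. cnj (c$i$k) * c$i$l)" for k l
  define A :: "real^'d^'d" where "A = (\<chi> k l. Re (M k l))"
  have M_cnj: "cnj (M k l) = M l k" for k l
    by (simp add: M_def mult.commute)
  have A_sym: "transpose A = A"
  proof -
    have "Re (M l k) = Re (M k l)" for k l
      by (subst M_cnj[symmetric]) simp
    then show ?thesis by (simp add: A_def transpose_def vec_eq_iff)
  qed
  have form: "v \<bullet> (A *v v) = (\<Sum>i\<in>UNIV. (cmod (\<Sum>k\<in>UNIV. c$i$k * of_real (v$k)))\<^sup>2)" for v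
  proof -
    have "complex_of_real ((cmod (\<Sum>k\<in>UNIV. c$i$k * of_real (v$k)))\<^sup>2)
        = (\<Sum>k\<in>UNIV. \<Sum>l\<in>UNIV. of_real (v$k * v$l) * (cnj (c$i$k) * c$i$l))" for i
    proof -
      have "complex_of_real ((cmod (\<Sum>k\<in>UNIV. c$i$k * of_real (v$k)))\<^sup>2)
          = cnj (\<Sum>k\<in>UNIV. c$i$k * of_real (v$k)) * (\<Sum>k\<in>UNIV. c$i$k * of_real (v$k))"
        by (simp only: complex_norm_square mult.commute)
      also have "\<dots> = (\<Sum>k\<in>UNIV. \<Sum>l\<in>UNIV. of_real (v$k * v$l) * (cnj (c$i$k) * c$i$l))"
        unfolding cnj_sum sum_product by (intro sum.cong) simp_all
      finally show ?thesis .
    qed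
    then have "complex_of_real (\<Sum>i\<in>UNIV. (cmod (\<Sum>k\<in>UNIV. c$i$k * of_real (v$k)))\<^sup>2)
        = (\<Sum>i\<in>UNIV. \<Sum>k\<in>UNIV. \<Sum>l\<in>UNIV. of_real (v$k * v$l) * (cnj (c$i$k) * c$i$l))"
      by simp
    also have "\<dots> = (\<Sum>k\<in>UNIV. \<Sum>i\<in>UNIV. \<Sum>l\<in>UNIV. of_real (v$k * v$l) * (cnj (c$i$k) * c$i$l))"
      by (rule sum.swap)
    also have "\<dots> = (\<Sum>k\<in>UNIV. \<Sum>l\<in>UNIV. of_real (v$k * v$l) * M k l)"
      by (intro sum.cong refl, subst sum.swap) (simp add: M_def sum_distrib_left)
    finally have "Re (complex_of_real (\<Sum>i\<in>UNIV. (cmod (\<Sum>k\<in>UNIV. c$i$k * of_real (v$k)))\<^sup>2))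
        = Re (\<Sum>k\<in>UNIV. \<Sum>l\<in>UNIV. of_real (v$k * v$l) * M k l)"
      by simp
    then show ?thesis
      by (simp add: inner_vec_def matrix_vector_mult_def A_def sum_distrib_left mult_ac)
  qed
  have definite: "v = 0" if "v \<bullet> (A *v v) = 0" for v
  proof -
    have "(\<Sum>k\<in>UNIV. c$i$k * of_real (v$k)) = 0" for i
      using that unfolding form by (subst (asm) sum_nonneg_eq_0_iff) auto
    then show ?thesis using assms unfolding elliptic_system_def by blast
  qed
  have "inj ((*v) A)"
  proof (rule injI)
    fix v w assume "A *v v = A *v w"
    then have "A *v (v - w) = 0" by (simp add: matrix_vector_mult_diff_distrib)
    then show "v = w" using definite[of "v - w"] by simp
  qed
  then obtain B where BA: "B ** A = mat 1"
    using matrix_left_invertible_injective by blast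
  then have AB: "A ** B = mat 1" by (simp add: matrix_left_right_inverse)
  have "transpose B ** A = mat 1"
    using arg_cong[OF AB, of transpose] by (simp add: matrix_transpose_mul A_sym transpose_mat)
  then have "transpose B ** (A ** B) = B" by (simp add: matrix_mul_assoc)
  then have tB: "transpose B = B" by (simp add: AB)
  have B_sym: "B $ k $ l = B $ l $ k" for k l
    using arg_cong[OF tB, of "\<lambda>B. B $ l $ k"] by (simp add: transpose_def)
  have ABv: "A *v (B *v w) = w" for w
    by (simp add: matrix_vector_mul_assoc AB)
  have B_form: "(\<Sum>i\<in>UNIV. (cmod (\<Sum>k\<in>UNIV. c$i$k * of_real ((B *v w)$k)))\<^sup>2) = w \<bullet> (B *v w)" for w
    by (simp add: form[symmetric] ABv inner_commute)
  have pos: "w \<bullet> (B *v w) > 0" if "w \<noteq> 0" for w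
  proof -
    have "w \<bullet> (B *v w) \<ge> 0" unfolding B_form[symmetric] by (intro sum_nonneg) auto
    moreover have "w \<bullet> (B *v w) \<noteq> 0"
    proof
      assume "w \<bullet> (B *v w) = 0"
      then have "B *v w = 0" by (intro definite) (simp add: ABv inner_commute)
      then show False using ABv[of w] that by simp
    qed
    ultimately show ?thesis by simp
  qed
  have "axis undefined 1 \<in> sphere (0::real^'d) 1" by simp
  then have ne: "sphere (0::real^'d) 1 \<noteq> {}" by blast
  have cont: "continuous_on (sphere 0 1) (\<lambda>w. w \<bullet> (B *v w))"
    by (intro continuous_intros)
  \<comment> \<open>The coercivity constant \<beta> is the minimum of the form on the unit sphere;
    homogeneity extends the bound to all vectors.\<close>
  obtain w0 where w0: "w0 \<in> sphere 0 1" "\<And>w. w \<in> sphere 0 1 \<Longrightarrow> w0 \<bullet> (B *v w0) \<le> w \<bullet> (B *v w)"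
    using continuous_attains_inf[OF compact_sphere ne cont] by blast
  define \<beta> where "\<beta> = w0 \<bullet> (B *v w0)"
  have "\<beta> > 0" unfolding \<beta>_def using w0(1) by (intro pos) auto
  have coercive: "\<beta> * (norm w)\<^sup>2 \<le> w \<bullet> (B *v w)" for w
  proof (cases "w = 0")
    case False
    define u where "u = (1 / norm w) *\<^sub>R w"
    have w: "w = norm w *\<^sub>R u" using False by (simp add: u_def)
    have "\<beta> \<le> u \<bullet> (B *v u)"
      unfolding \<beta>_def using False by (intro w0(2)) (simp add: u_def)
    then have "\<beta> * (norm w)\<^sup>2 \<le> u \<bullet> (B *v u) * (norm w)\<^sup>2" by (rule mult_right_mono) simp
    also have "\<dots> = (norm w *\<^sub>R u) \<bullet> (B *v (norm w *\<^sub>R u))"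
      by (simp add: matrix_vector_mult_scaleR power2_eq_square)
    finally show ?thesis by (simp flip: w)
  qed simp
  have cnj_fixed: "Im z = 0" if "cnj z = z" for z
    using arg_cong[OF that, of Im] by simp
  have trace: "(\<Sum>i\<in>UNIV. \<Sum>k\<in>UNIV. \<Sum>l\<in>UNIV. cnj (c$i$k) * c$i$l * of_real (B$k$l))
      = of_nat CARD('d)" (is "?S = _")
  proof -
    have S: "?S = (\<Sum>k\<in>UNIV. \<Sum>l\<in>UNIV. M k l * of_real (B$k$l))"
      unfolding M_def sum_distrib_right
      by (subst sum.swap, intro sum.cong refl, rule sum.swap)
    \<comment> \<open>M is Hermitian and B is real symmetric, so the sum is real and equals its real
      part, the trace of A B.\<close>
    have "cnj ?S = (\<Sum>k\<in>UNIV. \<Sum>l\<in>UNIV. M l k * of_real (B$l$k))"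
      unfolding S by (simp add: M_cnj B_sym cong: sum.cong)
    also have "\<dots> = ?S" unfolding S by (rule sum.swap)
    finally have "cnj ?S = ?S" .
    then have "Im ?S = 0" by (rule cnj_fixed)
    moreover have "Re ?S = (\<Sum>k\<in>UNIV. (A ** B) $ k $ k)"
      unfolding S by (simp add: A_def matrix_matrix_mult_def B_sym cong: sum.cong)
    moreover have "\<dots> = CARD('d)" unfolding AB by (simp add: mat_def)
    ultimately show ?thesis by (simp add: complex_eq_iff)
  qed
  show ?thesis
    by (rule that[of B \<beta>], unfold_locales) (rule B_sym \<open>\<beta> > 0\<close> coercive trace B_form)+
qed

section \<open>The Gaussian kernel, its derivatives and the heat equation\<close>

context heat_kernel
begin

definition Q :: "real^'d \<Rightarrow> real" where "Q w = w \<bullet> (B *v w)"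

text \<open>The heat kernel at time s^2/4 without its normalising constant; its integral is the same
  for all s and is later called \<open>mass\<close>.\<close>

definition gk :: "real \<Rightarrow> real^'d \<Rightarrow> complex" where
  "gk s w = of_real (exp (- Q w / s\<^sup>2) / s ^ CARD('d))"

text \<open>The symbol of L_i at the real vector B w.\<close>

definition b :: "'n \<Rightarrow> real^'d \<Rightarrow> complex" where
  "b i w = (\<Sum>k\<in>UNIV. c$i$k * of_real (B$k \<bullet> w))"

text \<open>This is L_i applied to \<open>gk s\<close>, in closed form.\<close>

definition hk :: "'n \<Rightarrow> real \<Rightarrow> real^'d \<Rightarrow> complex" where
  "hk i s w = of_real (- 2 / s\<^sup>2) * (b i w * gk s w)"

definition dhk :: "'d \<Rightarrow> 'n \<Rightarrow> real \<Rightarrow> real^'d \<Rightarrow> complex" where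
  "dhk k i s = partial_deriv k (hk i s)"

text \<open>Minus the sum of the L_i^* L_i applied to \<open>gk s\<close>; the sign is that of the
  adjoint.\<close>

definition lap :: "real \<Rightarrow> real^'d \<Rightarrow> complex" where
  "lap s w = (\<Sum>i\<in>UNIV. \<Sum>k\<in>UNIV. cnj (c$i$k) * dhk k i s w)"

lemma mult_B_component: "(B *v w) $ k = B $ k \<bullet> w"
  by (simp add: matrix_vector_mult_def inner_vec_def)

lemma Q_has_derivative: "(Q has_derivative (\<lambda>h. 2 * ((B *v w) \<bullet> h))) (at w)"
proof -
  have "(Q has_derivative (\<lambda>h. w \<bullet> (B *v h) + h \<bullet> (B *v w))) (at w)"
    unfolding Q_def
    by (rule derivative_eq_intros bounded_linear_imp_has_derivative
        matrix_vector_mul_bounded_linear has_derivative_ident refl)+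
  moreover have "w \<bullet> (B *v h) = (B *v w) \<bullet> h" for h
  proof -
    have "transpose B = B" by (simp add: transpose_def vec_eq_iff B_sym)
    then have "w v* B = B *v w" by (metis transpose_matrix_vector)
    then show ?thesis by (simp flip: dot_lmul_matrix)
  qed
  ultimately show ?thesis
    by (simp add: inner_commute)
qed

lemma gk_has_derivative:
  "(gk s has_derivative (\<lambda>h. of_real (- 2 / s\<^sup>2 * ((B *v w) \<bullet> h)) * gk s w)) (at w)"
proof -
  have "((\<lambda>w. exp (- (a * Q w)) * C) has_derivative
      (\<lambda>h. exp (- (a * Q w)) * (- (a * (2 * ((B *v w) \<bullet> h)))) * C)) (at w)" for a C
    by (auto intro!: derivative_eq_intros Q_has_derivative)
  from has_derivative_of_real[OF this] have "((\<lambda>w. complex_of_real (exp (- (a * Q w)) * C))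
      has_derivative
      (\<lambda>h. of_real (exp (- (a * Q w)) * (- (a * (2 * ((B *v w) \<bullet> h)))) * C))) (at w)" for a C .
  from this[of "1 / s\<^sup>2" "1 / s ^ CARD('d)"] show ?thesis
    unfolding gk_def by (simp add: field_simps)
qed

lemma partial_gk: "partial_deriv k (gk s) w = of_real (- 2 / s\<^sup>2) * of_real (B$k \<bullet> w) * gk s w"
  by (subst partial_deriv_eqI[OF gk_has_derivative]) (simp add: inner_axis mult_B_component)

lemma smooth_gk: "smooth (gk s)"
proof (rule smooth_span_smooth[where B = "{gk s}"])
  fix g :: "real^'d \<Rightarrow> complex" and x k
  assume g: "g \<in> {gk s}"
  then show "g differentiable (at x)"
    using gk_has_derivative by (auto simp: differentiable_def)
  have "partial_deriv k (gk s) = (\<lambda>w. (of_real (- 2 / s\<^sup>2) * of_real (B$k \<bullet> w)) * gk s w)"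
    by (simp add: partial_gk fun_eq_iff)
  then show "partial_deriv k g \<in> smooth_span {gk s}"
    using g by (simp only: singleton_iff, intro smooth_span.mult smooth_mult smooth_linear
        smooth_const smooth_span.base) simp
qed (simp add: smooth_span.base)

lemma smooth_b: "smooth (b i)"
  unfolding b_def by (intro smooth_sum smooth_mult smooth_linear smooth_const) simp

lemma smooth_hk: "smooth (hk i s)"
  unfolding hk_def by (intro smooth_mult smooth_const smooth_b smooth_gk)

lemma partial_b: "partial_deriv k (b i) w = (\<Sum>l\<in>UNIV. c$i$l * of_real (B$l$k))"
proof -
  have "(b i has_derivative (\<lambda>h. \<Sum>l\<in>UNIV. c$i$l * of_real (B$l \<bullet> h))) (at w)"
    unfolding b_def by (intro has_derivative_sum has_derivative_mult_right
        has_derivative_linear_of_real)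
  from partial_deriv_eqI[OF this] show ?thesis by (simp add: inner_axis)
qed

lemma dhk_eq: "dhk k i s w = of_real (- 2 / s\<^sup>2) *
    ((\<Sum>l\<in>UNIV. c$i$l * of_real (B$l$k)) + of_real (- 2 / s\<^sup>2) * (b i w * of_real (B$k \<bullet> w)))
        * gk s w"
  unfolding dhk_def hk_def
  by (subst partial_deriv_mult, simp, intro smooth_differentiable smooth_mult smooth_b smooth_gk,
      subst partial_deriv_mult, (intro smooth_differentiable smooth_b smooth_gk)+)
     (simp add: partial_b partial_gk algebra_simps)

text \<open>\<open>B_trace\<close> evaluates the terms where the derivative hits \<open>b i\<close>,
  and \<open>B_form\<close> those where it hits the Gaussian. Both sums are real, so the complex
  coefficients disappear.\<close>

lemma lap_eq: "lap s w = of_real (- 2 / s\<^sup>2 * (CARD('d) - 2 / s\<^sup>2 * Q w)) * gk s w"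
proof -
  have "(\<Sum>i\<in>UNIV. \<Sum>k\<in>UNIV. cnj (c$i$k) * (\<Sum>l\<in>UNIV. c$i$l * of_real (B$l$k))) = of_nat CARD('d)"
    unfolding B_trace[symmetric] by (simp add: sum_distrib_left mult.assoc B_sym)
  moreover have "(\<Sum>i\<in>UNIV. \<Sum>k\<in>UNIV. cnj (c$i$k) * (b i w * of_real (B$k \<bullet> w))) = of_real (Q w)"
  proof -
    have "(\<Sum>k\<in>UNIV. cnj (c$i$k) * (b i w * of_real (B$k \<bullet> w))) = of_real ((cmod (b i w))\<^sup>2)" for i
      unfolding complex_norm_square by (simp add: b_def sum_distrib_left mult_ac)
    then show ?thesis
      using arg_cong[OF B_form[of w], of complex_of_real] by
          (simp add: Q_def b_def mult_B_component)
  qed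
  moreover have "lap s w = of_real (- 2 / s\<^sup>2) *
     ((\<Sum>i\<in>UNIV. \<Sum>k\<in>UNIV. cnj (c$i$k) * (\<Sum>l\<in>UNIV. c$i$l * of_real (B$l$k)))
      + of_real (- 2 / s\<^sup>2) * (\<Sum>i\<in>UNIV. \<Sum>k\<in>UNIV. cnj (c$i$k) * (b i w * of_real (B$k \<bullet> w))))
          * gk s w"
    unfolding lap_def dhk_eq sum_distrib_left sum_distrib_right sum.distrib[symmetric]
    by (intro sum.cong refl) (simp add: algebra_simps sum_distrib_left)
  ultimately show ?thesis by simp
qed

text \<open>The heat equation in the variable s: with \<tau> = s^2/4 the chain rule contributes
  s/2.\<close>

lemma gk_has_vector_derivative:
  assumes "s > 0"
  shows "((\<lambda>s. gk s w) has_vector_derivative (of_real (s / 2) * lap s w)) (at s)"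
proof -
  have "((\<lambda>s. exp (- Q w / s\<^sup>2) / s ^ CARD('d)) has_real_derivative
      (exp (- Q w / s\<^sup>2) * (2 * Q w / s ^ 3) * s ^ CARD('d) - exp (- Q w / s\<^sup>2) *
          (CARD('d) * s ^ (CARD('d) - 1)))
      / (s ^ CARD('d) * s ^ CARD('d))) (at s)"
    using assms by (auto intro!: derivative_eq_intros simp: power2_eq_square power3_eq_cube
        field_simps)
  also have "(exp (- Q w / s\<^sup>2) * (2 * Q w / s ^ 3) * s ^ CARD('d) - exp (- Q w / s\<^sup>2) *
      (CARD('d) * s ^ (CARD('d) - 1)))
      / (s ^ CARD('d) * s ^ CARD('d)) = (s / 2) * (- 2 / s\<^sup>2 * (CARD('d) - 2 / s\<^sup>2 * Q w)) *
          (exp (- Q w / s\<^sup>2) / s ^ CARD('d))"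
  proof -
    obtain n where n: "CARD('d) = Suc n" using zero_less_card_finite[where 'a = 'd] by
        (cases "CARD('d)") auto
    show ?thesis
      using assms unfolding n by (simp add: power2_eq_square power3_eq_cube field_simps)
  qed
  finally show ?thesis
    unfolding has_real_derivative_iff_has_vector_derivative lap_eq gk_def
    by (drule_tac bounded_linear.has_vector_derivative[OF bounded_linear_of_real[where 'a
        = complex]]) (simp add: mult.assoc)
qed

text \<open>Completing the square in \<beta> r^2 - r shows that the Gaussian absorbs exp(1 + r),
  which dominates (1 + r)^m up to m!.\<close>

lemma exp_neg_square_bound:
  assumes "r \<ge> 0"
  shows "exp (- \<beta> * r\<^sup>2) * (1 + r) ^ m \<le> fact m * exp (1 + 1 / (4 * \<beta>))"
proof -
  have "0 \<le> \<beta> * (r - 1 / (2 * \<beta>))\<^sup>2" using \<beta>_pos by simp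
  also have "\<dots> = \<beta> * r\<^sup>2 - r + 1 / (4 * \<beta>)"
    using \<beta>_pos by (simp add: power2_eq_square field_simps)
  finally have *: "- \<beta> * r\<^sup>2 + (1 + r) \<le> 1 + 1 / (4 * \<beta>)" by simp
  have "exp (- \<beta> * r\<^sup>2) * (1 + r) ^ m \<le> exp (- \<beta> * r\<^sup>2) * (fact m * exp (1 + r))"
    using assms by (intro mult_left_mono power_le_fact_exp) auto
  also have "\<dots> = fact m * exp (- \<beta> * r\<^sup>2 + (1 + r))" by (simp only: exp_add mult_ac)
  also have "\<dots> \<le> fact m * exp (1 + 1 / (4 * \<beta>))" using * by simp
  finally show ?thesis .
qed

definition gk_const :: "nat \<Rightarrow> real" where
  "gk_const m = fact m * exp (1 + 1 / (4 * \<beta>))"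

lemma gk_const_pos: "gk_const m > 0"
  by (simp add: gk_const_def)

text \<open>Derivatives of the Gaussian bring powers of |w|/s; a constant for \<open>K + m\<close>
  powers of decay absorbs m of them.\<close>

lemma gk_poly_bound:
  assumes "s > 0"
  shows "(1 + norm w / s) ^ m * cmod (gk s w) \<le> gk_const (K + m) * wt K s w"
proof -
  let ?r = "norm w / s"
  have "\<beta> * ?r\<^sup>2 \<le> Q w / s\<^sup>2"
    using B_coercive[of w] assms by (simp add: Q_def power_divide divide_right_mono)
  then have "exp (- Q w / s\<^sup>2) \<le> exp (- \<beta> * ?r\<^sup>2)" by simp
  then have "exp (- Q w / s\<^sup>2) * (1 + ?r) ^ (K + m) \<le> exp (- \<beta> * ?r\<^sup>2) * (1 + ?r) ^ (K + m)"
    using assms by (intro mult_right_mono) auto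
  also have "\<dots> \<le> gk_const (K + m)"
    unfolding gk_const_def using assms by (intro exp_neg_square_bound) auto
  finally have "(1 + ?r) ^ m * exp (- Q w / s\<^sup>2) * (1 + ?r) ^ K \<le> gk_const (K + m)"
    by (simp add: power_add mult_ac)
  then have "(1 + ?r) ^ m * exp (- Q w / s\<^sup>2) \<le> gk_const (K + m) / (1 + ?r) ^ K"
    using one_plus_norm_power_pos[OF assms, of w K] by (simp add: pos_le_divide_eq)
  then have "(1 + ?r) ^ m * exp (- Q w / s\<^sup>2) / s ^ CARD('d) \<le> gk_const (K + m) /
      (1 + ?r) ^ K / s ^ CARD('d)"
    using assms by (intro divide_right_mono) auto
  then show ?thesis
    using assms by (simp add: gk_def wt_def norm_divide norm_power mult_ac)
qed

text \<open>One crude constant for all coefficients. The summand 1 makes it at most its own square,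
  so that \<open>dhk_bound\<close> can be stated with the square alone.\<close>

definition b_const :: real where
  "b_const = 1 + (\<Sum>i\<in>UNIV. \<Sum>k\<in>UNIV. cmod (c$i$k) * norm (B$k)) + (\<Sum>k\<in>UNIV. norm (B$k))
     + (\<Sum>i\<in>UNIV. \<Sum>l\<in>UNIV. \<Sum>k\<in>UNIV. cmod (c$i$l) * \<bar>B$l$k\<bar>)"

lemma b_const_bounds:
  "b_const \<ge> 1" "cmod (b i w) \<le> b_const * norm w" "\<bar>B$k \<bullet> w\<bar> \<le> b_const * norm w"
  "cmod (\<Sum>l\<in>UNIV. c$i$l * of_real (B$l$k)) \<le> b_const"
proof -
  let ?S1 = "\<Sum>i\<in>UNIV. \<Sum>k\<in>UNIV. cmod (c$i$k) * norm (B$k)" and ?S2 = "\<Sum>k\<in>UNIV. norm (B$k)"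
    and ?S3 = "\<Sum>i\<in>UNIV. \<Sum>l\<in>UNIV. \<Sum>k\<in>UNIV. cmod (c$i$l) * \<bar>B$l$k\<bar>"
  have nn: "?S1 \<ge> 0" "?S2 \<ge> 0" "?S3 \<ge> 0" by (auto intro!: sum_nonneg)
  then show "b_const \<ge> 1" by (simp add: b_const_def)
  have "cmod (b i w) \<le> (\<Sum>k\<in>UNIV. cmod (c$i$k) * (norm (B$k) * norm w))"
    unfolding b_def
    by (intro order_trans[OF norm_sum] sum_mono) (auto simp: norm_mult intro!: mult_left_mono
        Cauchy_Schwarz_ineq2)
  also have "\<dots> = (\<Sum>k\<in>UNIV. cmod (c$i$k) * norm (B$k)) * norm w"
    by (simp add: sum_distrib_right mult.assoc)
  also have "\<dots> \<le> ?S1 * norm w"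
    by (intro mult_right_mono member_le_sum[of i UNIV "\<lambda>i. \<Sum>k\<in>UNIV. cmod (c$i$k) * norm (B$k)"])
        (auto intro!: sum_nonneg)
  also have "\<dots> \<le> b_const * norm w"
    using nn by (intro mult_right_mono) (auto simp: b_const_def)
  finally show "cmod (b i w) \<le> b_const * norm w" .
  have "\<bar>B$k \<bullet> w\<bar> \<le> norm (B$k) * norm w" by (rule Cauchy_Schwarz_ineq2)
  also have "\<dots> \<le> ?S2 * norm w"
    by (intro mult_right_mono member_le_sum[of k UNIV "\<lambda>k. norm (B$k)"]) auto
  also have "\<dots> \<le> b_const * norm w"
    using nn by (intro mult_right_mono) (auto simp: b_const_def)
  finally show "\<bar>B$k \<bullet> w\<bar> \<le> b_const * norm w" .
  have "cmod (\<Sum>l\<in>UNIV. c$i$l * of_real (B$l$k)) \<le> (\<Sum>l\<in>UNIV. \<Sum>k\<in>UNIV. cmod (c$i$l) * \<bar>B$l$k\<bar>)"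
  proof (intro order_trans[OF norm_sum] sum_mono)
    fix l
    show "cmod (c$i$l * of_real (B$l$k)) \<le> (\<Sum>k\<in>UNIV. cmod (c$i$l) * \<bar>B$l$k\<bar>)"
      using member_le_sum[of k UNIV "\<lambda>k. cmod (c$i$l) * \<bar>B$l$k\<bar>"] by (simp add: norm_mult)
  qed
  also have "\<dots> \<le> ?S3"
    by (intro member_le_sum[of i UNIV "\<lambda>i. \<Sum>l\<in>UNIV. \<Sum>k\<in>UNIV. cmod (c$i$l) * \<bar>B$l$k\<bar>"])
        (auto intro!: sum_nonneg)
  also have "\<dots> \<le> b_const" using nn by (simp add: b_const_def)
  finally show "cmod (\<Sum>l\<in>UNIV. c$i$l * of_real (B$l$k)) \<le> b_const" .
qed

lemma gk_bound: "s > 0 \<Longrightarrow> cmod (gk s w) \<le> gk_const K * wt K s w"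
  using gk_poly_bound[of s w 0 K] by simp

lemma hk_bound:
  assumes "s > 0"
  shows "cmod (hk i s w) \<le> 2 * b_const * gk_const (K + 1) / s * wt K s w"
proof -
  have "cmod (hk i s w) = 2 / s\<^sup>2 * cmod (b i w) * cmod (gk s w)"
    using assms by (simp add: hk_def norm_mult norm_divide norm_power)
  also have "\<dots> \<le> 2 / s\<^sup>2 * (b_const * norm w) * cmod (gk s w)"
    by (intro mult_right_mono mult_left_mono b_const_bounds) auto
  also have "\<dots> = 2 * b_const / s * ((norm w / s) * cmod (gk s w))"
    by (simp add: power2_eq_square)
  also have "\<dots> \<le> 2 * b_const / s * ((1 + norm w / s) ^ 1 * cmod (gk s w))"
    using assms b_const_bounds(1) by (intro mult_left_mono mult_right_mono) auto
  also have "\<dots> \<le> 2 * b_const / s * (gk_const (K + 1) * wt K s w)"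
    using assms b_const_bounds(1) by (intro mult_left_mono gk_poly_bound) auto
  finally show ?thesis by simp
qed

lemma dhk_bound:
  assumes "s > 0"
  shows "cmod (dhk k i s w) \<le> 6 * b_const\<^sup>2 * gk_const (K + 2) / s\<^sup>2 * wt K s w"
proof -
  let ?r = "norm w / s"
  have r: "?r \<ge> 0" using assms by simp
  let ?S = "\<Sum>l\<in>UNIV. c$i$l * of_real (B$l$k)"
  have b2: "b_const \<le> b_const\<^sup>2"
    using b_const_bounds(1) by (simp add: power2_eq_square)
  have "cmod (b i w * of_real (B$k \<bullet> w)) \<le> (b_const * norm w) * (b_const * norm w)"
    unfolding norm_mult norm_of_real using b_const_bounds(1) by (intro mult_mono b_const_bounds)
        auto
  then have "2 / s\<^sup>2 * cmod (b i w * of_real (B$k \<bullet> w)) \<le> 2 / s\<^sup>2 *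
      ((b_const * norm w) * (b_const * norm w))"
    by (intro mult_left_mono) auto
  also have "\<dots> = 2 * b_const\<^sup>2 * ?r\<^sup>2"
    by (simp add: power2_eq_square)
  finally have 1: "cmod (of_real (- 2 / s\<^sup>2) * (b i w * of_real (B$k \<bullet> w))) \<le> 2 * b_const\<^sup>2 * ?r\<^sup>2"
    using assms by (simp only: norm_mult[of "of_real (- 2 / s\<^sup>2)"])
        (simp add: norm_divide norm_power)
  have "cmod (?S + of_real (- 2 / s\<^sup>2) * (b i w * of_real (B$k \<bullet> w))) \<le> b_const + 2 * b_const\<^sup>2 * ?r\<^sup>2"
    by (intro order_trans[OF norm_triangle_ineq] add_mono b_const_bounds 1)
  \<comment> \<open>\<open>b_const\<close> is at most its square, and both 1 and (|w|/s)^2 are at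
    most (1 + |w|/s)^2; the coefficients 1 and 2 add up to 3.\<close>
  also have "\<dots> \<le> 3 * b_const\<^sup>2 * (1 + ?r)\<^sup>2"
  proof -
    have "b_const\<^sup>2 * 1 \<le> b_const\<^sup>2 * (1 + ?r)\<^sup>2" "b_const\<^sup>2 * ?r\<^sup>2 \<le> b_const\<^sup>2 * (1 + ?r)\<^sup>2"
      using r by (intro mult_left_mono; simp add: power_mono)+
    then show ?thesis using b2 by linarith
  qed
  finally have 2: "cmod (?S + of_real (- 2 / s\<^sup>2) * (b i w * of_real (B$k \<bullet> w))) \<le> 3 * b_const\<^sup>2 *
      (1 + ?r)\<^sup>2" .
  have "cmod (dhk k i s w) = 2 / s\<^sup>2 * cmod (?S + of_real (- 2 / s\<^sup>2) *
      (b i w * of_real (B$k \<bullet> w))) * cmod (gk s w)"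
    unfolding dhk_eq using assms
    by (simp only: norm_mult[of "of_real (- 2 / s\<^sup>2)"] norm_mult[of _ "gk s w"])
        (simp add: norm_divide norm_power)
  also have "\<dots> \<le> 2 / s\<^sup>2 * (3 * b_const\<^sup>2 * (1 + ?r)\<^sup>2) * cmod (gk s w)"
    by (intro mult_right_mono mult_left_mono 2) auto
  also have "\<dots> = 6 * b_const\<^sup>2 / s\<^sup>2 * ((1 + ?r) ^ 2 * cmod (gk s w))" by simp
  also have "\<dots> \<le> 6 * b_const\<^sup>2 / s\<^sup>2 * (gk_const (K + 2) * wt K s w)"
    using assms by (intro mult_left_mono gk_poly_bound) auto
  finally show ?thesis by simp
qed

end

subsection \<open>Bilinear forms with decaying convolution kernels\<close>

text \<open>A Borel version of \<open>Lp_space\<close> over \<open>lborel\<close>: the forms below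
  are integrals over \<open>lborel \<Otimes>\<^sub>M lborel\<close>, where Borel functions of either
  variable are jointly measurable. Representatives are chosen at the end.\<close>

definition Lq :: "real \<Rightarrow> (real^'d::finite \<Rightarrow> complex) \<Rightarrow> bool" where
  "Lq q f \<longleftrightarrow> f \<in> borel_measurable borel \<and> integrable lborel (\<lambda>x. cmod (f x) powr q)"

lemma LqD: assumes "Lq q f"
  shows "f \<in> borel_measurable borel" "integrable lborel (\<lambda>x. cmod (f x) powr q)"
  using assms by (auto simp: Lq_def)

lemma Lq_nn_integral_finite: "Lq q f \<Longrightarrow> (\<integral>\<^sup>+x. ennreal (cmod (f x) powr q) \<partial>lborel) < \<infinity>"
  using LqD(2)[of q f] unfolding integrable_iff_bounded by simp

lemma Lq_dominated:
  assumes "Lq q f" and g: "g \<in> borel_measurable borel" and le: "\<And>x. cmod (g x) \<le> C * cmod (f x)"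
      and "q > 0"
  shows "Lq q g"
proof -
  have [measurable]: "f \<in> borel_measurable borel" "g \<in> borel_measurable borel"
    using LqD assms by auto
  have "integrable lborel (\<lambda>x. cmod (g x) powr q)"
  proof (rule Bochner_Integration.integrable_bound)
    show "integrable lborel (\<lambda>x. \<bar>C\<bar> powr q * cmod (f x) powr q)"
      using LqD(2)[OF assms(1)] by simp
    have "cmod (g x) powr q \<le> \<bar>C\<bar> powr q * cmod (f x) powr q" for x
    proof -
      have "cmod (g x) \<le> \<bar>C\<bar> * cmod (f x)"
        by (rule order_trans[OF le]) (intro mult_right_mono, auto)
      then have "cmod (g x) powr q \<le> (\<bar>C\<bar> * cmod (f x)) powr q"
        using \<open>q > 0\<close> by (intro powr_mono2) auto
      then show ?thesis by (simp add: powr_mult)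
    qed
    then show "AE x in lborel. norm (cmod (g x) powr q) \<le> norm (\<bar>C\<bar> powr q * cmod (f x) powr q)"
      by (intro AE_I2) (simp add: abs_mult)
  qed measurable
  then show ?thesis using g by (simp add: Lq_def)
qed

lemma Lq_mult_bounded:
  assumes "Lq q f" "h \<in> borel_measurable borel" "\<And>x. cmod (h x) \<le> C" "q > 0"
  shows "Lq q (\<lambda>x. f x * h x)"
proof (rule Lq_dominated[OF assms(1)])
  show "(\<lambda>x. f x * h x) \<in> borel_measurable borel"
    using LqD(1)[OF assms(1)] assms(2) by measurable
  show "cmod (f x * h x) \<le> C * cmod (f x)" for x
    using mult_right_mono[OF assms(3)[of x], of "cmod (f x)"] by (simp add: norm_mult mult.commute)
qed fact

lemma Lq_cmult: "Lq q f \<Longrightarrow> q > 0 \<Longrightarrow> Lq q (\<lambda>x. a * f x)"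
  using Lq_mult_bounded[of q f "\<lambda>_. a" "cmod a"] by (simp add: mult.commute)

lemma Lq_cnj: "Lq q f \<Longrightarrow> Lq q (\<lambda>x. cnj (f x))"
  unfolding Lq_def by (auto intro: borel_measurable_continuous_on[OF
      continuous_on_cnj[OF continuous_on_id]])

lemma norm_add_powr_le:
  fixes z w :: "'a::real_normed_vector"
  assumes "q > 0"
  shows "norm (z + w) powr q \<le> 2 powr q * (norm z powr q + norm w powr q)"
proof -
  have "norm (z + w) \<le> 2 * max (norm z) (norm w)"
    using norm_triangle_ineq[of z w] by linarith
  then have "norm (z + w) powr q \<le> (2 * max (norm z) (norm w)) powr q"
    using assms by (intro powr_mono2) auto
  also have "\<dots> = 2 powr q * max (norm z) (norm w) powr q" by (simp add: powr_mult le_max_iff_disj)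
  also have "\<dots> \<le> 2 powr q * (norm z powr q + norm w powr q)"
    by (intro mult_left_mono) (auto simp: max_def)
  finally show ?thesis .
qed

lemma Lq_add:
  assumes "Lq q f" "Lq q g" "q > 0"
  shows "Lq q (\<lambda>x. f x + g x)"
proof -
  have [measurable]: "f \<in> borel_measurable borel" "g \<in> borel_measurable borel"
    using LqD assms by auto
  have "integrable lborel (\<lambda>x. cmod (f x + g x) powr q)"
  proof (rule Bochner_Integration.integrable_bound)
    show "integrable lborel (\<lambda>x. 2 powr q * (cmod (f x) powr q + cmod (g x) powr q))"
      using LqD(2)[OF assms(1)] LqD(2)[OF assms(2)] by simp
    show "AE x in lborel. norm (cmod (f x + g x) powr q) \<le> norm
        (2 powr q * (cmod (f x) powr q + cmod (g x) powr q))"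
      using norm_add_powr_le[OF \<open>q > 0\<close>] by (intro AE_I2) (simp add: abs_mult)
  qed measurable
  then show ?thesis by (simp add: Lq_def)
qed

lemma Lq_zero: "Lq q (\<lambda>x. 0)"
  by (simp add: Lq_def)

lemma Lq_sum: "finite I \<Longrightarrow> (\<And>i. i \<in> I \<Longrightarrow> Lq q (f i)) \<Longrightarrow> q > 0 \<Longrightarrow> Lq q (\<lambda>x. \<Sum>i\<in>I. f i x)"
  by (induction I rule: finite_induct) (auto intro: Lq_add Lq_zero)

text \<open>The constant is left existential because this predicate serves convergence and Fubini;
  quantitative bounds on kernels are carried separately.\<close>

definition kern :: "real \<Rightarrow> (real^'d::finite \<Rightarrow> complex) \<Rightarrow> bool" where
  "kern s k \<longleftrightarrow> k \<in> borel_measurable borel \<and> (\<exists>C. \<forall>w. cmod (k w) \<le> C * wt (CARD('d) + 1) s w)"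

lemma kern_borel: "kern s k \<Longrightarrow> k \<in> borel_measurable borel"
  by (simp add: kern_def)

lemma kern_cmult: "kern s k \<Longrightarrow> kern s (\<lambda>w. a * k w)"
proof -
  assume k: "kern s k"
  then obtain C where C: "\<And>w. cmod (k w) \<le> C * wt (CARD('a) + 1) s w" by (auto simp: kern_def)
  have "cmod (a * k w) \<le> (cmod a * C) * wt (CARD('a) + 1) s w" for w
    using mult_left_mono[OF C[of w], of "cmod a"] by (simp add: norm_mult mult.assoc)
  then show ?thesis using kern_borel[OF k] unfolding kern_def by
      (intro conjI exI[of _ "cmod a * C"]) auto
qed

lemma kern_add: "kern s k \<Longrightarrow> kern s l \<Longrightarrow> kern s (\<lambda>w. k w + l w)"
proof -
  assume kl: "kern s k" "kern s l"
  then obtain C D where "\<And>w. cmod (k w) \<le> C * wt (CARD('a) + 1) s w" "\<And>w. cmod (l w) \<le> D * wt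
      (CARD('a) + 1) s w"
    unfolding kern_def by auto
  then have "cmod (k w + l w) \<le> (C + D) * wt (CARD('a) + 1) s w" for w
    unfolding distrib_right by (intro order_trans[OF norm_triangle_ineq] add_mono)
  then show ?thesis
    using kl[THEN kern_borel] unfolding kern_def by (intro conjI exI[of _ "C + D"]) auto
qed

lemma kern_zero: "kern s (\<lambda>w. 0)"
  unfolding kern_def by (auto intro!: exI[of _ 0])

lemma kern_sum: "finite I \<Longrightarrow> (\<And>i. i \<in> I \<Longrightarrow> kern s (k i)) \<Longrightarrow> kern s (\<lambda>w. \<Sum>i\<in>I. k i w)"
  by (induction I rule: finite_induct) (auto intro: kern_add kern_zero)

lemma wt_le_power: "s > 0 \<Longrightarrow> wt K s (w::'a::euclidean_space) \<le> 1 / s ^ DIM('a)"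
  using wt_antimono[of s 0 K w] by (simp add: wt_def)

lemma le_one_plus_powr: "x \<ge> 0 \<Longrightarrow> q \<ge> 1 \<Longrightarrow> x \<le> 1 + x powr (q::real)"
proof (cases "x \<le> 1")
  case False
  assume "q \<ge> 1"
  then have "x powr 1 \<le> x powr q" using False by (intro powr_mono) auto
  then show ?thesis using False by simp
qed (auto intro: add_increasing2)

text \<open>The weight is both bounded and integrable, so the estimate |f| \<le> 1 + |f|^q
  suffices.\<close>

lemma kern_integrable:
  fixes f :: "real^'d::finite \<Rightarrow> complex"
  assumes "Lq q f" "q \<ge> 1" "s > 0" and h: "h \<in> borel_measurable borel"
    and le: "\<And>y. cmod (h y) \<le> C * wt (CARD('d) + 1) s (x - y)"
  shows "integrable lborel (\<lambda>y. f y * h y)"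
proof (rule integrableI_bounded)
  have [measurable]: "f \<in> borel_measurable borel" "h \<in> borel_measurable borel"
    using LqD assms by auto
  show "(\<lambda>y. f y * h y) \<in> borel_measurable lborel" by measurable
  have C: "C \<ge> 0"
    using order_trans[OF norm_ge_zero le, of 0] wt_pos[OF \<open>s > 0\<close>] by
        (metis mult_less_0_iff not_less order.asym)
  let ?D = "C / s ^ CARD('d)"
  have D: "?D \<ge> 0" using C \<open>s > 0\<close> by simp
  have pw: "cmod (f y * h y) \<le> C * wt (CARD('d) + 1) s (x - y) + ?D * cmod (f y) powr q" for y
  proof -
    have "cmod (f y * h y) \<le> (1 + cmod (f y) powr q) * (C * wt (CARD('d) + 1) s (x - y))"
      unfolding norm_mult using assms C by (intro mult_mono le le_one_plus_powr) auto
    also have "\<dots> \<le> C * wt (CARD('d) + 1) s (x - y) + ?D * cmod (f y) powr q"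
      using mult_left_mono[OF wt_le_power[OF \<open>s > 0\<close>, of "CARD('d) + 1" "x - y"], of
          "C * cmod (f y) powr q"] C
      by (simp add: algebra_simps)
    finally show ?thesis .
  qed
  have "(\<integral>\<^sup>+y. ennreal (cmod (f y * h y)) \<partial>lborel)
     \<le> (\<integral>\<^sup>+y. ennreal C * ennreal (wt (CARD('d) + 1) s (x - y)) + ennreal ?D * ennreal
         (cmod (f y) powr q) \<partial>lborel)"
    using pw C D \<open>s > 0\<close> by (intro nn_integral_mono)
        (simp add: wt_nonneg ennreal_leI flip: ennreal_mult ennreal_plus)
  also have "\<dots> = ennreal C * (\<integral>\<^sup>+y. ennreal (wt (CARD('d) + 1) s (x - y)) \<partial>lborel) + ennreal ?D *
      (\<integral>\<^sup>+y. ennreal (cmod (f y) powr q) \<partial>lborel)"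
    by (simp add: nn_integral_add nn_integral_cmult)
  also have "\<dots> \<le> ennreal C * ennreal (wt_const TYPE(real^'d)) + ennreal ?D *
      (\<integral>\<^sup>+y. ennreal (cmod (f y) powr q) \<partial>lborel)"
    using wt_integral_le(1)[OF \<open>s > 0\<close>, of x] by (intro add_right_mono mult_left_mono) simp_all
  also have "\<dots> < \<infinity>"
    using Lq_nn_integral_finite[OF assms(1)] by (simp add: ennreal_mult_less_top)
  finally show "(\<integral>\<^sup>+y. ennreal (cmod (f y * h y)) \<partial>lborel) < \<infinity>" .
qed

lemma kern_integrable_snd:
  fixes g :: "real^'d::finite \<Rightarrow> complex"
  assumes "Lq q g" "q \<ge> 1" "s > 0" "kern s k"
  shows "integrable lborel (\<lambda>z. g z * k (y - z))"
proof -
  obtain C where "\<And>w. cmod (k w) \<le> C * wt (CARD('d) + 1) s w" using assms(4) by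
      (auto simp: kern_def)
  then show ?thesis
    using kern_borel[OF assms(4)] by (intro kern_integrable[OF assms(1-3), where x = y and C
        = C]) auto
qed

lemma kern_integrable_fst:
  fixes g :: "real^'d::finite \<Rightarrow> complex"
  assumes "Lq q g" "q \<ge> 1" "s > 0" "kern s k"
  shows "integrable lborel (\<lambda>y. g y * k (y - z))"
proof -
  obtain C where "\<And>w. cmod (k w) \<le> C * wt (CARD('d) + 1) s w" using assms(4) by
      (auto simp: kern_def)
  then have "cmod (k (y - z)) \<le> C * wt (CARD('d) + 1) s (z - y)" for y
    by (subst wt_commute)
  then show ?thesis
    using kern_borel[OF assms(4)] by (intro kern_integrable[OF assms(1-3), where x = z and C
        = C]) auto
qed

definition bil :: "(real^'d::finite \<Rightarrow> complex) \<Rightarrow> (real^'d \<Rightarrow> complex) \<Rightarrow> (real^'d \<Rightarrow> complex) \<Rightarrow>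
    complex" where
  "bil f g k = (LINT p|(lborel \<Otimes>\<^sub>M lborel). f (fst p) * g (snd p) * k (fst p - snd p))"

lemma conjugate_exponent_gt_1:
  fixes p p' :: real
  assumes "1 < p" "1 / p + 1 / p' = 1"
  shows "p' > 1"
proof -
  have "1 / p < 1" "1 / p > 0" using assms by simp_all
  then have "1 / p' < 1" "1 / p' > 0" using assms by linarith+
  then show ?thesis by (simp add: divide_less_eq)
qed

lemma mult_le_powr_add:
  fixes x y p p' :: real
  assumes "1 < p" "1 / p + 1 / p' = 1" "x \<ge> 0" "y \<ge> 0"
  shows "x * y \<le> x powr p + y powr p'"
proof -
  have "p' > 1" by (rule conjugate_exponent_gt_1[OF assms(1,2)])
  have "x * y \<le> x powr p / p + y powr p' / p'"
    using assms \<open>p' > 1\<close> by (intro Youngs_inequality) auto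
  also have "\<dots> \<le> x powr p + y powr p'"
    using assms \<open>p' > 1\<close> by (intro add_mono) (auto simp: divide_le_eq mult_le_cancel_left1)
  finally show ?thesis .
qed

text \<open>Young's inequality pointwise, after which the weight is integrated over the variable
  that no longer occurs. The bound is a sum, not a product, of norms; \<open>bil_balance\<close>
  provides the scaling where smallness matters.\<close>

lemma bil_nn_integral_wt_le:
  fixes f g :: "real^'d::finite \<Rightarrow> complex"
  assumes "Lq p f" "Lq p' g" "1 < p" "1 / p + 1 / p' = 1" "s > 0"
  shows "(\<integral>\<^sup>+y. \<integral>\<^sup>+z. ennreal (cmod (f y) * cmod (g z) * wt (CARD('d) + 1) s (y - z)) \<partial>lborel \<partial>lborel)
    \<le> ennreal (wt_const TYPE(real^'d)) * ((\<integral>\<^sup>+y. ennreal (cmod (f y) powr p) \<partial>lborel) +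
        (\<integral>\<^sup>+z. ennreal (cmod (g z) powr p') \<partial>lborel))"
proof -
  have [measurable]: "f \<in> borel_measurable borel" "g \<in> borel_measurable borel"
    using LqD assms by auto
  let ?w = "\<lambda>y z. ennreal (wt (CARD('d) + 1) s (y - z))" and ?C = "ennreal (wt_const TYPE(real^'d))"
  have w1: "(\<integral>\<^sup>+y. ?w y z \<partial>lborel) \<le> ?C" and w2: "(\<integral>\<^sup>+z. ?w y z \<partial>lborel) \<le> ?C" for y z :: "real^'d"
    using wt_integral_le(2)[OF \<open>s > 0\<close>, of z] wt_integral_le(1)[OF \<open>s > 0\<close>, of y] by simp_all
  have "(\<integral>\<^sup>+y. \<integral>\<^sup>+z. ennreal (cmod (f y) * cmod (g z) * wt (CARD('d) + 1) s (y - z)) \<partial>lborel \<partial>lborel)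
    \<le> (\<integral>\<^sup>+y. \<integral>\<^sup>+z. ennreal (cmod (f y) powr p) * ?w y z + ennreal (cmod (g z) powr p')
        * ?w y z \<partial>lborel \<partial>lborel)"
  proof (intro nn_integral_mono)
    fix y z
    have "cmod (f y) * cmod (g z) * wt (CARD('d) + 1) s (y - z)
        \<le> (cmod (f y) powr p + cmod (g z) powr p') * wt (CARD('d) + 1) s (y - z)"
      using assms by (intro mult_right_mono mult_le_powr_add wt_nonneg) auto
    then show "ennreal (cmod (f y) * cmod (g z) * wt (CARD('d) + 1) s (y - z))
        \<le> ennreal (cmod (f y) powr p) * ?w y z + ennreal (cmod (g z) powr p') * ?w y z"
      using \<open>s > 0\<close> by (simp add: wt_nonneg ennreal_leI distrib_right flip: ennreal_mult
          ennreal_plus)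
  qed
  also have "\<dots> = (\<integral>\<^sup>+y. \<integral>\<^sup>+z. ennreal (cmod (f y) powr p) * ?w y z \<partial>lborel \<partial>lborel)
      + (\<integral>\<^sup>+y. \<integral>\<^sup>+z. ennreal (cmod (g z) powr p') * ?w y z \<partial>lborel \<partial>lborel)"
    by (simp add: nn_integral_add)
  also have "(\<integral>\<^sup>+y. \<integral>\<^sup>+z. ennreal (cmod (g z) powr p') * ?w y z \<partial>lborel \<partial>lborel)
      = (\<integral>\<^sup>+z. \<integral>\<^sup>+y. ennreal (cmod (g z) powr p') * ?w y z \<partial>lborel \<partial>lborel)"
    by (rule lborel_pair.Fubini') measurable
  also have "\<dots> = (\<integral>\<^sup>+z. ennreal (cmod (g z) powr p') * (\<integral>\<^sup>+y. ?w y z \<partial>lborel) \<partial>lborel)"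
    by (intro nn_integral_cong nn_integral_cmult) measurable
  also have "(\<integral>\<^sup>+y. \<integral>\<^sup>+z. ennreal (cmod (f y) powr p) * ?w y z \<partial>lborel \<partial>lborel)
      = (\<integral>\<^sup>+y. ennreal (cmod (f y) powr p) * (\<integral>\<^sup>+z. ?w y z \<partial>lborel) \<partial>lborel)"
    by (intro nn_integral_cong nn_integral_cmult) measurable
  also have "(\<integral>\<^sup>+y. ennreal (cmod (f y) powr p) * (\<integral>\<^sup>+z. ?w y z \<partial>lborel) \<partial>lborel)
      + (\<integral>\<^sup>+z. ennreal (cmod (g z) powr p') * (\<integral>\<^sup>+y. ?w y z \<partial>lborel) \<partial>lborel)
    \<le> (\<integral>\<^sup>+y. ennreal (cmod (f y) powr p) * ?C \<partial>lborel) + (\<integral>\<^sup>+z. ennreal (cmod (g z) powr p')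
        * ?C \<partial>lborel)"
    by (intro add_mono nn_integral_mono mult_left_mono w1 w2) auto
  also have "\<dots> = ?C * ((\<integral>\<^sup>+y. ennreal (cmod (f y) powr p) \<partial>lborel) +
      (\<integral>\<^sup>+z. ennreal (cmod (g z) powr p') \<partial>lborel))"
    by (simp add: nn_integral_multc distrib_right[symmetric] mult.commute[of ?C])
  finally show ?thesis .
qed

lemma bil_nn_integral_le:
  fixes f g :: "real^'d::finite \<Rightarrow> complex"
  assumes "Lq p f" "Lq p' g" "1 < p" "1 / p + 1 / p' = 1" "s > 0" "C \<ge> 0"
    and [measurable]: "k \<in> borel_measurable borel" and le: "\<And>w. cmod (k w) \<le> C * wt
        (CARD('d) + 1) s w"
  shows "(\<integral>\<^sup>+q. ennreal (cmod (f (fst q) * g (snd q) * k (fst q - snd q))) \<partial>(lborel \<Otimes>\<^sub>M lborel))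
    \<le> ennreal (C * wt_const TYPE(real^'d)) * ((\<integral>\<^sup>+y. ennreal (cmod (f y) powr p) \<partial>lborel) +
        (\<integral>\<^sup>+z. ennreal (cmod (g z) powr p') \<partial>lborel))"
proof -
  have [measurable]: "f \<in> borel_measurable borel" "g \<in> borel_measurable borel"
    using LqD assms by auto
  have "(\<integral>\<^sup>+q. ennreal (cmod (f (fst q) * g (snd q) * k (fst q - snd q))) \<partial>(lborel \<Otimes>\<^sub>M lborel))
    = (\<integral>\<^sup>+y. \<integral>\<^sup>+z. ennreal (cmod (f y * g z * k (y - z))) \<partial>lborel \<partial>lborel)"
    by (subst lborel.nn_integral_fst[symmetric]) auto
  also have "\<dots> \<le> (\<integral>\<^sup>+y. \<integral>\<^sup>+z. ennreal C * ennreal (cmod (f y) * cmod (g z) * wt (CARD('d) + 1) s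
      (y - z)) \<partial>lborel \<partial>lborel)"
  proof (intro nn_integral_mono)
    fix y z
    have "cmod (f y * g z * k (y - z)) \<le> cmod (f y) * cmod (g z) * (C * wt (CARD('d) + 1) s
        (y - z))"
      unfolding norm_mult by (intro mult_left_mono le) auto
    then show "ennreal (cmod (f y * g z * k (y - z))) \<le> ennreal C * ennreal
        (cmod (f y) * cmod (g z) * wt (CARD('d) + 1) s (y - z))"
      using assms by (simp add: wt_nonneg ennreal_leI mult_ac flip: ennreal_mult)
  qed
  also have "\<dots> = ennreal C * (\<integral>\<^sup>+y. \<integral>\<^sup>+z. ennreal (cmod (f y) * cmod (g z) * wt (CARD('d) + 1) s
      (y - z)) \<partial>lborel \<partial>lborel)"
    by (simp add: nn_integral_cmult)
  also have "\<dots> \<le> ennreal C * (ennreal (wt_const TYPE(real^'d)) *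
      ((\<integral>\<^sup>+y. ennreal (cmod (f y) powr p) \<partial>lborel) + (\<integral>\<^sup>+z. ennreal (cmod (g z) powr p') \<partial>lborel)))"
    by (intro mult_left_mono bil_nn_integral_wt_le assms) auto
  finally show ?thesis
    using assms wt_const_pos[where 'a = "real^'d"] by (simp add: ennreal_mult mult.assoc)
qed

lemma kern_const:
  fixes k :: "real^'d::finite \<Rightarrow> complex"
  assumes "kern s k" "s > 0"
  obtains C where "C \<ge> 0" "\<And>w. cmod (k w) \<le> C * wt (CARD('d) + 1) s w"
proof -
  obtain C where C: "\<And>w. cmod (k w) \<le> C * wt (CARD('d) + 1) s w" using assms by
      (auto simp: kern_def)
  have "cmod (k w) \<le> \<bar>C\<bar> * wt (CARD('d) + 1) s w" for w
    by (rule order_trans[OF C]) (intro mult_right_mono wt_nonneg assms, simp)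
  then show ?thesis by (intro that[of "\<bar>C\<bar>"]) auto
qed

context
  fixes p p' s :: real
  assumes pp': "1 < p" "1 / p + 1 / p' = 1" and s: "s > 0"
begin

lemma bil_integrable:
  fixes f g k :: "real^'d::finite \<Rightarrow> complex"
  assumes "Lq p f" "Lq p' g" "kern s k"
  shows "integrable (lborel \<Otimes>\<^sub>M lborel) (\<lambda>q. f (fst q) * g (snd q) * k (fst q - snd q))"
proof (rule integrableI_bounded)
  have [measurable]: "f \<in> borel_measurable borel" "g \<in> borel_measurable borel"
      "k \<in> borel_measurable borel"
    using LqD kern_borel assms by auto
  show "(\<lambda>q. f (fst q) * g (snd q) * k (fst q - snd q)) \<in> borel_measurable (lborel \<Otimes>\<^sub>M lborel)" by
      measurable
  obtain C where "C \<ge> 0" "\<And>w. cmod (k w) \<le> C * wt (CARD('d) + 1) s w" using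
      kern_const[OF assms(3) s] by blast
  then show "(\<integral>\<^sup>+q. ennreal (cmod (f (fst q) * g (snd q) * k (fst q - snd q)))
      \<partial>(lborel \<Otimes>\<^sub>M lborel)) < \<infinity>"
    using assms pp' s Lq_nn_integral_finite[OF assms(1)] Lq_nn_integral_finite[OF assms(2)]
    by (intro le_less_trans[OF bil_nn_integral_le[of p f p' g s C k]])
        (auto simp: ennreal_mult_less_top)
qed

lemma bil_fst:
  assumes "Lq p f" "Lq p' g" "kern s k"
  shows "bil f g k = (LINT y|lborel. f y * (LINT z|lborel. g z * k (y - z)))"
    and "integrable lborel (\<lambda>y. f y * (LINT z|lborel. g z * k (y - z)))"
proof -
  note i = bil_integrable[OF assms]
  have eq: "(LINT z|lborel. f y * g z * k (y - z)) = f y * (LINT z|lborel. g z * k (y - z))" for y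
    by (simp add: mult.assoc)
  show "bil f g k = (LINT y|lborel. f y * (LINT z|lborel. g z * k (y - z)))"
    unfolding bil_def lborel_pair.integral_fst'[OF i, symmetric] by (simp add: eq)
  show "integrable lborel (\<lambda>y. f y * (LINT z|lborel. g z * k (y - z)))"
    using lborel_pair.integrable_fst'[OF i] by (simp add: eq)
qed

lemma bil_snd:
  assumes "Lq p f" "Lq p' g" "kern s k"
  shows "bil f g k = (LINT z|lborel. g z * (LINT y|lborel. f y * k (y - z)))"
    and "integrable lborel (\<lambda>z. g z * (LINT y|lborel. f y * k (y - z)))"
proof -
  have i: "integrable (lborel \<Otimes>\<^sub>M lborel) (\<lambda>(y, z). f y * g z * k (y - z))"
    using bil_integrable[OF assms] by (simp add: case_prod_beta')
  have eq: "(LINT y|lborel. f y * g z * k (y - z)) = g z * (LINT y|lborel. f y * k (y - z))" for z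
    by (simp only: mult.commute[of "f _" "g z"] mult.assoc integral_mult_right_zero)
  show "bil f g k = (LINT z|lborel. g z * (LINT y|lborel. f y * k (y - z)))"
    unfolding bil_def using lborel_pair.integral_snd[OF i] by (simp add: eq case_prod_beta')
  show "integrable lborel (\<lambda>z. g z * (LINT y|lborel. f y * k (y - z)))"
    using lborel_pair.integrable_snd[OF i] by (simp add: eq)
qed

lemma bil_sum_kernel:
  assumes "Lq p f" "Lq p' g" "\<And>i. i \<in> I \<Longrightarrow> kern s (k i)"
  shows "bil f g (\<lambda>w. \<Sum>i\<in>I. k i w) = (\<Sum>i\<in>I. bil f g (k i))"
  unfolding bil_def sum_distrib_left
  by (rule Bochner_Integration.integral_sum) (intro bil_integrable assms)

text \<open>Lifts an identity valid for every fixed y, such as \<open>curl_step\<close>, to the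
  double integrals.\<close>

lemma bil_cong_fst:
  assumes "Lq p f" "Lq p' g1" "kern s k1" "Lq p' g2" "kern s k2" "Lq p' g3" "kern s k3"
    and "\<And>y. (LINT z|lborel. g1 z * k1 (y - z)) = (LINT z|lborel. g2 z * k2 (y - z)) +
        (LINT z|lborel. g3 z * k3 (y - z))"
  shows "bil f g1 k1 = bil f g2 k2 + bil f g3 k3"
  using assms by (simp add: bil_fst distrib_left)

text \<open>The counterpart for every fixed z. The sums are there because \<open>div_step\<close>
  holds only after summation over j.\<close>

lemma bil_cong_snd:
  assumes "\<And>j. j \<in> J \<Longrightarrow> Lq p (f1 j)" "\<And>j. j \<in> J \<Longrightarrow> kern s (k1 j)"
    "\<And>j. j \<in> J \<Longrightarrow> Lq p (f2 j)" "\<And>j. j \<in> J \<Longrightarrow> kern s (k2 j)" "Lq p f3" "kern s k3" "Lq p' g"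
    and "\<And>z. (\<Sum>j\<in>J. LINT y|lborel. f1 j y * k1 j (y - z)) + (\<Sum>j\<in>J. LINT y|lborel. f2 j y * k2 j
        (y - z))
          = (LINT y|lborel. f3 y * k3 (y - z))"
  shows "(\<Sum>j\<in>J. bil (f1 j) g (k1 j)) + (\<Sum>j\<in>J. bil (f2 j) g (k2 j)) = bil f3 g k3"
proof -
  have "(\<Sum>j\<in>J. bil (f1 j) g (k1 j)) = (LINT z|lborel.
      (\<Sum>j\<in>J. g z * (LINT y|lborel. f1 j y * k1 j (y - z))))"
    "(\<Sum>j\<in>J. bil (f2 j) g (k2 j)) = (LINT z|lborel.
        (\<Sum>j\<in>J. g z * (LINT y|lborel. f2 j y * k2 j (y - z))))"
    using assms by (subst Bochner_Integration.integral_sum; simp add: bil_snd)+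
  then have "(\<Sum>j\<in>J. bil (f1 j) g (k1 j)) + (\<Sum>j\<in>J. bil (f2 j) g (k2 j))
      = (LINT z|lborel. ((\<Sum>j\<in>J. g z * (LINT y|lborel. f1 j y * k1 j (y - z)))
          + (\<Sum>j\<in>J. g z * (LINT y|lborel. f2 j y * k2 j (y - z)))))"
    using assms by (simp add: bil_snd)
  also have "\<dots> = bil f3 g k3"
    using assms by (simp add: bil_snd flip: sum_distrib_left distrib_left)
  finally show ?thesis .
qed

end

section \<open>Weak identities tested against decaying functions\<close>

lemma test_partial: "\<psi> \<in> test_functions \<Longrightarrow> partial_deriv k \<psi> \<in> test_functions"
proof -
  assume \<psi>: "\<psi> \<in> test_functions"
  have "{x. partial_deriv k \<psi> x \<noteq> 0} \<subseteq> closure {x. \<psi> x \<noteq> 0}"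
  proof (rule subsetI, rule ccontr)
    fix x assume x: "x \<in> {x. partial_deriv k \<psi> x \<noteq> 0}" "x \<notin> closure {x. \<psi> x \<noteq> 0}"
    \<comment> \<open>The complement of the closed support is open and \<psi> vanishes on
      it.\<close>
    have "(\<psi> has_derivative (\<lambda>_. 0)) (at x)"
    proof (rule has_derivative_transform_within_open)
      show "((\<lambda>_. 0) has_derivative (\<lambda>_. 0)) (at x)" by simp
      show "open (- closure {x. \<psi> x \<noteq> 0})" by (intro open_Compl) simp
      show "0 = \<psi> y" if "y \<in> - closure {x. \<psi> x \<noteq> 0}" for y
        using that closure_subset[of "{x. \<psi> x \<noteq> 0}"] by auto
    qed (use x in auto)
    then show False using x(1) partial_deriv_eqI by fastforce
  qed
  moreover have "bounded (closure {x. \<psi> x \<noteq> 0})"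
    using \<psi> by (intro compact_imp_bounded) (simp add: test_functions_def)
  ultimately have "bounded {x. partial_deriv k \<psi> x \<noteq> 0}"
    by (rule bounded_subset[rotated])
  then show ?thesis
    using \<psi> smooth_partial by (auto simp: test_functions_def)
qed

lemma test_kern: "\<psi> \<in> test_functions \<Longrightarrow> kern 1 \<psi>"
proof -
  assume \<psi>: "\<psi> \<in> test_functions"
  let ?S = "closure {x. \<psi> x \<noteq> 0}" and ?N = "CARD('a)"
  have "smooth \<psi>" "compact ?S" using \<psi> by (auto simp: test_functions_def)
  then have "continuous_on ?S (\<lambda>x. (1 + norm x) ^ (?N + 1) * cmod (\<psi> x))"
    using smooth_continuous[of \<psi>] by (intro continuous_intros) (auto intro: continuous_on_subset)
  then have "compact ((\<lambda>x. (1 + norm x) ^ (?N + 1) * cmod (\<psi> x)) ` ?S)"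
    using \<open>compact ?S\<close> by (rule compact_continuous_image)
  then have "bounded ((\<lambda>x. (1 + norm x) ^ (?N + 1) * cmod (\<psi> x)) ` ?S)"
    by (rule compact_imp_bounded)
  then obtain C where C: "C > 0" "\<And>x. x \<in> ?S \<Longrightarrow> (1 + norm x) ^ (?N + 1) * cmod (\<psi> x) \<le> C"
    unfolding bounded_pos by fastforce
  have "cmod (\<psi> x) \<le> C * wt (?N + 1) 1 x" for x
  proof (cases "x \<in> ?S")
    case True
    have "(1 + norm x) ^ (?N + 1) > 0" using one_plus_norm_power_pos[of 1 x "?N + 1"] by simp
    then show ?thesis using C(2)[OF True] by (simp add: wt_def pos_le_divide_eq mult.commute)
  next
    case False
    then have "\<psi> x = 0" using closure_subset[of "{x. \<psi> x \<noteq> 0}"] by auto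
    then show ?thesis using C(1) wt_nonneg[of 1 "?N + 1" x] by simp
  qed
  then show ?thesis
    using smooth_borel[OF \<open>smooth \<psi>\<close>] by (auto simp: kern_def)
qed

lemma test_integrable:
  assumes "Lq q f" "q \<ge> 1" "\<psi> \<in> test_functions"
  shows "integrable lborel (\<lambda>x. f x * \<psi> x)"
proof -
  obtain C where "\<And>x. cmod (\<psi> x) \<le> C * wt (CARD('a) + 1) 1 x"
    using test_kern[OF assms(3)] unfolding kern_def by blast
  then have "cmod (\<psi> x) \<le> C * wt (CARD('a) + 1) 1 (0 - x)" for x
    unfolding diff_0 wt_uminus .
  then show ?thesis
    by (rule kern_integrable[OF assms(1,2) zero_less_one kern_borel[OF test_kern[OF assms(3)]]])
qed

text \<open>The Gaussian test functions to come are not compactly supported; decay of the function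
  and of its first derivatives about one point makes all integrals in the cutoff argument
  converge.\<close>

lemma weak_identity_Lq:
  fixes f :: "'d::finite \<Rightarrow> real^'d \<Rightarrow> complex"
  assumes weak: "\<And>\<psi>. \<psi> \<in> test_functions \<Longrightarrow>
      (\<Sum>k\<in>UNIV. LINT x|lborel. f k x * partial_deriv k \<psi> x) = (LINT x|lborel. g x * \<psi> x)"
    and Lq: "\<And>k. Lq q (f k)" "Lq q g" "q \<ge> 1" and \<psi>: "smooth \<psi>" and "s > 0"
    and decay: "\<And>y. cmod (\<psi> y) \<le> C * wt (CARD('d) + 1) s (x - y)"
      "\<And>k y. cmod (partial_deriv k \<psi> y) \<le> C' * wt (CARD('d) + 1) s (x - y)"
  shows "(\<Sum>k\<in>UNIV. LINT x|lborel. f k x * partial_deriv k \<psi> x) = (LINT x|lborel. g x * \<psi> x)"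
proof (rule weak_identity_extend[OF weak \<psi>])
  show "integrable lborel (\<lambda>y. f k y * partial_deriv k \<psi> y)"
      "integrable lborel (\<lambda>y. f k y * \<psi> y)" for k
    using smooth_borel[OF \<psi>] partial_deriv_borel[OF \<psi>] decay
    by (rule_tac kern_integrable[OF Lq(1,3) \<open>s > 0\<close>]; blast)+
  show "integrable lborel (\<lambda>y. g y * \<psi> y)"
    using smooth_borel[OF \<psi>] decay(1) by (rule kern_integrable[OF Lq(2,3) \<open>s > 0\<close>])
qed

section \<open>Integration by parts with the heat kernel\<close>

context heat_kernel
begin

lemma kern_gk: "s > 0 \<Longrightarrow> kern s (gk s)"
  unfolding kern_def using smooth_borel[OF smooth_gk] gk_bound by blast

lemma kern_hk: "s > 0 \<Longrightarrow> kern s (hk i s)"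
  unfolding kern_def using smooth_borel[OF smooth_hk] hk_bound by blast

lemma kern_dhk: "s > 0 \<Longrightarrow> kern s (dhk k i s)"
  unfolding kern_def dhk_def using partial_deriv_borel[OF smooth_hk] dhk_bound[unfolded dhk_def]
      by blast

text \<open>Minus L_j^* L_i applied to \<open>gk s\<close>; the diagonal terms add up to
  \<open>lap\<close>.\<close>

definition dL :: "'n \<Rightarrow> 'n \<Rightarrow> real \<Rightarrow> real^'d \<Rightarrow> complex" where
  "dL j i s w = (\<Sum>k\<in>UNIV. cnj (c$j$k) * dhk k i s w)"

lemma kern_dL: "s > 0 \<Longrightarrow> kern s (dL j i s)"
  unfolding dL_def by (intro kern_sum kern_cmult kern_dhk) auto

lemma lap_dL: "lap s = (\<lambda>w. \<Sum>i\<in>UNIV. dL i i s w)"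
  by (simp add: lap_def dL_def fun_eq_iff)

lemma hk_translate_eq: "(\<lambda>y. hk i s (y - z)) = (\<lambda>y. hk i s (- z + 1 *\<^sub>R y))"
  "(\<lambda>z. hk i s (y - z)) = (\<lambda>z. hk i s (y + (- 1) *\<^sub>R z))"
  by simp_all

lemma smooth_hk_translate: "smooth (\<lambda>y. hk i s (y - z))" "smooth (\<lambda>z. hk i s (y - z))"
  unfolding hk_translate_eq by (intro smooth_affine_comp smooth_hk)+

lemma partial_hk_translate:
  "partial_deriv k (\<lambda>y. hk i s (y - z)) y = dhk k i s (y - z)"
  "partial_deriv k (\<lambda>z. hk i s (y - z)) z = - dhk k i s (y - z)"
  unfolding hk_translate_eq
  by (subst partial_deriv_affine_comp; simp add: smooth_differentiable[OF smooth_hk] dhk_def)+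

lemma LINT_dL_snd:
  assumes "Lq q g" "q \<ge> 1" "s > 0"
  shows "(LINT z|lborel. g z * dL j i s (y - z)) = (\<Sum>k\<in>UNIV. cnj (c$j$k) *
      (LINT z|lborel. g z * dhk k i s (y - z)))"
proof -
  have i: "integrable lborel (\<lambda>z. g z * dhk k i s (y - z))" for k
    by (rule kern_integrable_snd[OF assms kern_dhk[OF \<open>s > 0\<close>]])
  have "(LINT z|lborel. g z * dL j i s (y - z)) =
      (LINT z|lborel. (\<Sum>k\<in>UNIV. cnj (c$j$k) * (g z * dhk k i s (y - z))))"
    by (simp add: dL_def sum_distrib_left mult_ac)
  also have "\<dots> = (\<Sum>k\<in>UNIV. LINT z|lborel. cnj (c$j$k) * (g z * dhk k i s (y - z)))"
    by (rule Bochner_Integration.integral_sum) (intro integrable_mult_right i)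
  finally show ?thesis by simp
qed

lemma LINT_dL_fst:
  assumes "Lq q g" "q \<ge> 1" "s > 0"
  shows "(LINT y|lborel. g y * dL j i s (y - z)) = (\<Sum>k\<in>UNIV. cnj (c$j$k) *
      (LINT y|lborel. g y * dhk k i s (y - z)))"
proof -
  have i: "integrable lborel (\<lambda>y. g y * dhk k i s (y - z))" for k
    by (rule kern_integrable_fst[OF assms kern_dhk[OF \<open>s > 0\<close>]])
  have "(LINT y|lborel. g y * dL j i s (y - z)) =
      (LINT y|lborel. (\<Sum>k\<in>UNIV. cnj (c$j$k) * (g y * dhk k i s (y - z))))"
    by (simp add: dL_def sum_distrib_left mult_ac)
  also have "\<dots> = (\<Sum>k\<in>UNIV. LINT y|lborel. cnj (c$j$k) * (g y * dhk k i s (y - z)))"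
    by (rule Bochner_Integration.integral_sum) (intro integrable_mult_right i)
  finally show ?thesis by simp
qed

text \<open>The Hermitian product conjugates W, so the curl equation is tested against the conjugate
  of the kernel and the result is conjugated. The index j passes from W to the adjoint derivative,
  which prepares a divergence in y; the error has only one derivative on the kernel.\<close>

lemma curl_step:
  fixes W :: "'n \<Rightarrow> real^'d \<Rightarrow> complex"
  assumes curl: "\<And>i j \<psi>. \<psi> \<in> test_functions \<Longrightarrow>
      (\<Sum>k\<in>UNIV. LINT x|lborel. (c$j$k * W i x - c$i$k * W j x) * partial_deriv k \<psi> x) =
          (LINT x|lborel. R i j x * \<psi> x)"
    and Lq: "\<And>j. Lq q (W j)" "\<And>i j. Lq q (R i j)" "q \<ge> 1" and s: "s > 0"
  shows "(LINT z|lborel. cnj (W j z) * dL i i s (y - z))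
    = (LINT z|lborel. cnj (W i z) * dL j i s (y - z)) + (LINT z|lborel. cnj (R i j z) * hk i s
        (y - z))"
proof -
  have q: "q > 0" using Lq by simp
  define \<psi> where "\<psi> z = cnj (hk i s (y - z))" for z
  have part: "partial_deriv k \<psi> z = - cnj (dhk k i s (y - z))" for k z
    unfolding \<psi>_def by (subst partial_deriv_cnj)
      (simp_all add: smooth_differentiable[OF smooth_hk_translate(2)] partial_hk_translate)
  obtain C where C: "\<And>w. cmod (hk i s w) \<le> C * wt (CARD('d) + 1) s w"
    using kern_const[OF kern_hk[OF s] s] by blast
  have "(\<Sum>k\<in>UNIV. LINT x|lborel. (c$j$k * W i x - c$i$k * W j x) * partial_deriv k \<psi> x) =
      (LINT x|lborel. R i j x * \<psi> x)"
  proof (rule weak_identity_Lq[where q = q and s = s and x = y])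
    show "Lq q (\<lambda>x. c$j$k * W i x - c$i$k * W j x)" for k
      using Lq_add[OF Lq_cmult[OF Lq(1) q, of "c$j$k" i] Lq_cmult[OF Lq(1) q, of "- c$i$k" j] q]
          by simp
    show "smooth \<psi>" unfolding \<psi>_def by (intro smooth_cnj smooth_hk_translate)
    show "cmod (\<psi> z) \<le> C * wt (CARD('d) + 1) s (y - z)" for z using C by (simp add: \<psi>_def)
    show "cmod (partial_deriv k \<psi> z) \<le> (6 * b_const\<^sup>2 * gk_const (CARD('d) + 1 + 2) / s\<^sup>2) * wt
        (CARD('d) + 1) s (y - z)" for k z
      unfolding part norm_minus_cancel complex_mod_cnj by (rule dhk_bound[OF s])
  qed (rule curl Lq s, assumption?)+
  from arg_cong[OF this, of cnj]
  have "(\<Sum>k\<in>UNIV. LINT x|lborel. cnj ((c$j$k * W i x - c$i$k * W j x) * partial_deriv k \<psi> x)) =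
      (LINT x|lborel. cnj (R i j x * \<psi> x))"
    by (simp only: cnj_sum Bochner_Integration.integral_cnj)
  moreover have "cnj ((c$j$k * W i x - c$i$k * W j x) * partial_deriv k \<psi> x)
      = cnj (c$i$k) * (cnj (W j x) * dhk k i s (y - x)) - cnj (c$j$k) * (cnj (W i x) * dhk k i s
          (y - x))" for k x
    by (simp add: part left_diff_distrib mult.assoc)
  moreover have "cnj (R i j x * \<psi> x) = cnj (R i j x) * hk i s (y - x)" for x
    by (simp add: \<psi>_def)
  ultimately have "(LINT z|lborel. cnj (R i j z) * hk i s (y - z))
      = (\<Sum>k\<in>UNIV. LINT z|lborel. (cnj (c$i$k) * (cnj (W j z) * dhk k i s (y - z)) - cnj (c$j$k) *
          (cnj (W i z) * dhk k i s (y - z))))"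
    by (simp only:)
  also have "\<dots> = (\<Sum>k\<in>UNIV. cnj (c$i$k) * (LINT z|lborel. cnj (W j z) * dhk k i s (y - z)) - cnj
      (c$j$k) * (LINT z|lborel. cnj (W i z) * dhk k i s (y - z)))"
    using kern_integrable_snd[OF Lq_cnj[OF Lq(1)] Lq(3) s kern_dhk[OF s]]
    by (intro sum.cong refl, subst Bochner_Integration.integral_diff) auto
  also have "\<dots> = (LINT z|lborel. cnj (W j z) * dL i i s (y - z)) - (LINT z|lborel. cnj (W i z)
      * dL j i s (y - z))"
    by (simp add: LINT_dL_snd[OF Lq_cnj[OF Lq(1)] Lq(3) s] sum_subtractf)
  finally show ?thesis by simp
qed

text \<open>The test function is \<open>\<Phi> y * hk i s (y - z)\<close>, and the product rule lets
  the derivative fall on the kernel or on \<Phi>. Only the sum over j is controlled, which is why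
  the curl step has to free W of the index j first.\<close>

lemma div_step:
  fixes V :: "'n \<Rightarrow> real^'d \<Rightarrow> complex"
  assumes div: "\<And>\<psi>. \<psi> \<in> test_functions \<Longrightarrow>
      (\<Sum>k\<in>UNIV. LINT x|lborel. (\<Sum>j\<in>UNIV. cnj (c$j$k) * V j x) * partial_deriv k \<psi> x) =
          (LINT x|lborel. D x * \<psi> x)"
    and Lq: "\<And>j. Lq q (V j)" "Lq q D" "q \<ge> 1" and s: "s > 0"
    and \<Phi>: "smooth \<Phi>" "\<And>x. cmod (\<Phi> x) \<le> C1" "\<And>k x. cmod (partial_deriv k \<Phi> x) \<le> C2"
  shows "(\<Sum>j\<in>UNIV. LINT y|lborel. (V j y * \<Phi> y) * dL j i s (y - z))
     + (\<Sum>j\<in>UNIV. LINT y|lborel. (V j y * (\<Sum>k\<in>UNIV. cnj (c$j$k) * partial_deriv k \<Phi> y)) * hk i s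
         (y - z))
    = (LINT y|lborel. (D y * \<Phi> y) * hk i s (y - z))"
proof -
  have q: "q > 0" using Lq by simp
  have C12: "C1 \<ge> 0" "C2 \<ge> 0"
    using order_trans[OF norm_ge_zero \<Phi>(2)] order_trans[OF norm_ge_zero \<Phi>(3)] by auto
  define \<psi> where "\<psi> y = \<Phi> y * hk i s (y - z)" for y
  have part: "partial_deriv k \<psi> y = \<Phi> y * dhk k i s (y - z) + partial_deriv k \<Phi> y * hk i s
      (y - z)" for k y
    unfolding \<psi>_def by (subst partial_deriv_mult)
      (simp_all add: smooth_differentiable[OF smooth_hk_translate(1)] smooth_differentiable[OF
          \<Phi>(1)] partial_hk_translate)
  let ?w = "\<lambda>y. wt (CARD('d) + 1) s (z - y)"
  obtain C where C: "C \<ge> 0" "\<And>w. cmod (hk i s w) \<le> C * wt (CARD('d) + 1) s w"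
    using kern_const[OF kern_hk[OF s] s] by blast
  have hk_le: "cmod (hk i s (y - z)) \<le> C * ?w y" for y
    using C(2)[of "y - z"] by (simp only: wt_commute[of _ _ z y])
  define E where "E = 6 * b_const\<^sup>2 * gk_const (CARD('d) + 1 + 2) / s\<^sup>2"
  have E: "E \<ge> 0" unfolding E_def using gk_const_pos[of "CARD('d) + 1 + 2"] by simp
  have dhk_le: "cmod (dhk k i s (y - z)) \<le> E * ?w y" for k y
    using dhk_bound[OF s, of k i "y - z" "CARD('d) + 1"] by
        (simp only: wt_commute[of _ _ z y] E_def)
  have V_int: "integrable lborel (\<lambda>y. V j y * \<Phi> y * dhk k i s (y - z))"
    "integrable lborel (\<lambda>y. V j y * partial_deriv k \<Phi> y * hk i s (y - z))" for j k
    using \<Phi> q Lq smooth_borel partial_deriv_borel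
    by (intro kern_integrable_fst[OF _ Lq(3) s] kern_hk kern_dhk s Lq_mult_bounded[OF Lq(1)];
        blast)+
  have "(LINT y|lborel. D y * \<psi> y) = (\<Sum>k\<in>UNIV. LINT y|lborel. (\<Sum>j\<in>UNIV. cnj (c$j$k) * V j y)
      * partial_deriv k \<psi> y)"
  proof (rule weak_identity_Lq[where q = q and s = s and x = z, symmetric])
    show "Lq q (\<lambda>x. \<Sum>j\<in>UNIV. cnj (c$j$k) * V j x)" for k
      by (intro Lq_sum Lq_cmult Lq q) simp
    show "smooth \<psi>" unfolding \<psi>_def by (intro smooth_mult \<Phi> smooth_hk_translate)
    show "cmod (\<psi> y) \<le> (C1 * C) * ?w y" for y
      unfolding \<psi>_def norm_mult mult.assoc using C12 by (intro mult_mono \<Phi> hk_le) auto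
    show "cmod (partial_deriv k \<psi> y) \<le> (C1 * E + C2 * C) * ?w y" for k y
      unfolding part distrib_right mult.assoc using C12
      by (intro order_trans[OF norm_triangle_ineq] add_mono)
          (unfold norm_mult, (intro mult_mono \<Phi> hk_le dhk_le; simp)+)
  qed (rule div Lq s, assumption?)+
  also have "\<dots> = (\<Sum>k\<in>UNIV. \<Sum>j\<in>UNIV. cnj (c$j$k) * (LINT y|lborel. V j y * \<Phi> y * dhk k i s (y - z))
      + cnj (c$j$k) * (LINT y|lborel. V j y * partial_deriv k \<Phi> y * hk i s (y - z)))"
  proof (intro sum.cong refl)
    fix k
    have "(LINT y|lborel. (\<Sum>j\<in>UNIV. cnj (c$j$k) * V j y) * partial_deriv k \<psi> y)
        = (LINT y|lborel. (\<Sum>j\<in>UNIV. cnj (c$j$k) * (V j y * \<Phi> y * dhk k i s (y - z)) + cnj (c$j$k)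
            * (V j y * partial_deriv k \<Phi> y * hk i s (y - z))))"
      unfolding part sum_distrib_right
      by (intro Bochner_Integration.integral_cong refl sum.cong) (simp add: algebra_simps)
    also have "\<dots> = (\<Sum>j\<in>UNIV. LINT y|lborel. (cnj (c$j$k) * (V j y * \<Phi> y * dhk k i s (y - z))
        + cnj (c$j$k) * (V j y * partial_deriv k \<Phi> y * hk i s (y - z))))"
      using V_int by (intro Bochner_Integration.integral_sum) auto
    also have "\<dots> = (\<Sum>j\<in>UNIV. cnj (c$j$k) * (LINT y|lborel. V j y * \<Phi> y * dhk k i s (y - z))
      + cnj (c$j$k) * (LINT y|lborel. V j y * partial_deriv k \<Phi> y * hk i s (y - z)))"
      using V_int by (intro sum.cong refl, subst Bochner_Integration.integral_add) auto
    finally show "(LINT y|lborel. (\<Sum>j\<in>UNIV. cnj (c$j$k) * V j y) * partial_deriv k \<psi> y) = \<dots>" .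
  qed
  also have "\<dots> = (\<Sum>j\<in>UNIV. \<Sum>k\<in>UNIV. cnj (c$j$k) * (LINT y|lborel. V j y * \<Phi> y * dhk k i s (y - z)))
      + (\<Sum>j\<in>UNIV. \<Sum>k\<in>UNIV. cnj (c$j$k) * (LINT y|lborel. V j y * partial_deriv k \<Phi> y * hk i s
          (y - z)))"
    unfolding sum.distrib by (intro arg_cong2[where f = "(+)"] sum.swap)
  also have "(\<Sum>j\<in>UNIV. \<Sum>k\<in>UNIV. cnj (c$j$k) * (LINT y|lborel. V j y * \<Phi> y * dhk k i s (y - z)))
      = (\<Sum>j\<in>UNIV. LINT y|lborel. (V j y * \<Phi> y) * dL j i s (y - z))"
    using \<Phi> q Lq smooth_borel by (intro sum.cong refl LINT_dL_fst[symmetric, OF _ Lq(3) s]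
        Lq_mult_bounded[OF Lq(1)]; blast)
  also have "(\<Sum>j\<in>UNIV. \<Sum>k\<in>UNIV. cnj (c$j$k) * (LINT y|lborel. V j y * partial_deriv k \<Phi> y
      * hk i s (y - z)))
      = (\<Sum>j\<in>UNIV. LINT y|lborel. (V j y * (\<Sum>k\<in>UNIV. cnj (c$j$k) * partial_deriv k \<Phi> y)) * hk i s
          (y - z))"
  proof (intro sum.cong refl)
    fix j
    have "(LINT y|lborel. (V j y * (\<Sum>k\<in>UNIV. cnj (c$j$k) * partial_deriv k \<Phi> y)) * hk i s (y - z))
        = (LINT y|lborel. (\<Sum>k\<in>UNIV. cnj (c$j$k) * (V j y * partial_deriv k \<Phi> y * hk i s (y - z))))"
      by (simp add: sum_distrib_left sum_distrib_right mult_ac)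
    also have "\<dots> = (\<Sum>k\<in>UNIV. LINT y|lborel. cnj (c$j$k) * (V j y * partial_deriv k \<Phi> y * hk i s
        (y - z)))"
      using V_int by (intro Bochner_Integration.integral_sum) auto
    finally show "(\<Sum>k\<in>UNIV. cnj (c$j$k) * (LINT y|lborel. V j y * partial_deriv k \<Phi> y * hk i s
        (y - z)))
      = (LINT y|lborel. (V j y * (\<Sum>k\<in>UNIV. cnj (c$j$k) * partial_deriv k \<Phi> y)) * hk i s
          (y - z))" by simp
  qed
  finally show ?thesis
    by (simp add: \<psi>_def mult.assoc)
qed

text \<open>All kernels on the right contain one derivative and have size 1/s, against 1/s^2 for
  \<open>lap\<close>. The other derivative has fallen on \<Phi> or has been absorbed by D and
  R.\<close>

lemma div_curl_identity:
  fixes V W :: "'n \<Rightarrow> real^'d \<Rightarrow> complex"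
  assumes pp': "1 < p" "1 / p + 1 / p' = 1" and s: "s > 0"
    and div: "\<And>\<psi>. \<psi> \<in> test_functions \<Longrightarrow>
      (\<Sum>k\<in>UNIV. LINT x|lborel. (\<Sum>j\<in>UNIV. cnj (c$j$k) * V j x) * partial_deriv k \<psi> x) =
          (LINT x|lborel. D x * \<psi> x)"
    and curl: "\<And>i j \<psi>. \<psi> \<in> test_functions \<Longrightarrow>
      (\<Sum>k\<in>UNIV. LINT x|lborel. (c$j$k * W i x - c$i$k * W j x) * partial_deriv k \<psi> x) =
          (LINT x|lborel. R i j x * \<psi> x)"
    and Lq: "\<And>j. Lq p (V j)" "Lq p D" "\<And>j. Lq p' (W j)" "\<And>i j. Lq p' (R i j)"
    and \<Phi>: "smooth \<Phi>" "\<And>x. cmod (\<Phi> x) \<le> C1" "\<And>k x. cmod (partial_deriv k \<Phi> x) \<le> C2"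
  shows "(\<Sum>j\<in>UNIV. bil (\<lambda>y. V j y * \<Phi> y) (\<lambda>z. cnj (W j z)) (lap s))
    = (\<Sum>i\<in>UNIV. bil (\<lambda>y. D y * \<Phi> y) (\<lambda>z. cnj (W i z)) (hk i s)
        - (\<Sum>j\<in>UNIV. bil (\<lambda>y. V j y * (\<Sum>k\<in>UNIV. cnj (c$j$k) * partial_deriv k \<Phi> y))
            (\<lambda>z. cnj (W i z)) (hk i s))
        + (\<Sum>j\<in>UNIV. bil (\<lambda>y. V j y * \<Phi> y) (\<lambda>z. cnj (R i j z)) (hk i s)))"
proof -
  have p: "p > 0" "p \<ge> 1" "p' \<ge> 1" using pp' conjugate_exponent_gt_1[OF pp'] by auto
  note b = smooth_borel[OF \<Phi>(1)] partial_deriv_borel[OF \<Phi>(1)]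
  have V\<Phi>: "Lq p (\<lambda>y. V j y * \<Phi> y)" for j
    by (rule Lq_mult_bounded[OF Lq(1) b(1) \<Phi>(2) p(1)])
  have D\<Phi>: "Lq p (\<lambda>y. D y * \<Phi> y)"
    by (rule Lq_mult_bounded[OF Lq(2) b(1) \<Phi>(2) p(1)])
  have VL: "Lq p (\<lambda>y. V j y * (\<Sum>k\<in>UNIV. cnj (c$j$k) * partial_deriv k \<Phi> y))" for j
  proof -
    have "(\<lambda>y. V j y * (\<Sum>k\<in>UNIV. cnj (c$j$k) * partial_deriv k \<Phi> y))
        = (\<lambda>y. \<Sum>k\<in>UNIV. cnj (c$j$k) * (V j y * partial_deriv k \<Phi> y))"
      by (simp add: sum_distrib_left mult_ac)
    then show ?thesis
      by (simp only:) (intro Lq_sum Lq_cmult Lq_mult_bounded[OF Lq(1) b(2) \<Phi>(3)] p finite)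
  qed
  note cW = Lq_cnj[OF Lq(3)] and cR = Lq_cnj[OF Lq(4)]
  have "bil (\<lambda>y. V j y * \<Phi> y) (\<lambda>z. cnj (W j z)) (lap s)
      = (\<Sum>i\<in>UNIV. bil (\<lambda>y. V j y * \<Phi> y) (\<lambda>z. cnj (W i z)) (dL j i s) + bil (\<lambda>y. V j y * \<Phi> y)
          (\<lambda>z. cnj (R i j z)) (hk i s))" for j
  proof -
    have "bil (\<lambda>y. V j y * \<Phi> y) (\<lambda>z. cnj (W j z)) (lap s)
        = (\<Sum>i\<in>UNIV. bil (\<lambda>y. V j y * \<Phi> y) (\<lambda>z. cnj (W j z)) (dL i i s))"
      unfolding lap_dL by (rule bil_sum_kernel[OF pp' s V\<Phi> cW]) (rule kern_dL[OF s])
    also have "\<dots> = (\<Sum>i\<in>UNIV. bil (\<lambda>y. V j y * \<Phi> y) (\<lambda>z. cnj (W i z)) (dL j i s) + bil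
        (\<lambda>y. V j y * \<Phi> y) (\<lambda>z. cnj (R i j z)) (hk i s))"
      by (intro sum.cong refl bil_cong_fst[OF pp' s V\<Phi> cW kern_dL cW kern_dL cR kern_hk]
          curl_step[OF curl Lq(3,4) p(3)] s)
    finally show ?thesis .
  qed
  \<comment> \<open>The curl identity was used for fixed j and summed over i; the divergence
    identity needs fixed i and a sum over j.\<close>
  then have *: "(\<Sum>j\<in>UNIV. bil (\<lambda>y. V j y * \<Phi> y) (\<lambda>z. cnj (W j z)) (lap s))
      = (\<Sum>i\<in>UNIV. (\<Sum>j\<in>UNIV. bil (\<lambda>y. V j y * \<Phi> y) (\<lambda>z. cnj (W i z)) (dL j i s))
          + (\<Sum>j\<in>UNIV. bil (\<lambda>y. V j y * \<Phi> y) (\<lambda>z. cnj (R i j z)) (hk i s)))"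
    unfolding sum.distrib[symmetric] by (simp only:) (rule sum.swap)
  have "(\<Sum>j\<in>UNIV. bil (\<lambda>y. V j y * \<Phi> y) (\<lambda>z. cnj (W i z)) (dL j i s))
      + (\<Sum>j\<in>UNIV. bil (\<lambda>y. V j y * (\<Sum>k\<in>UNIV. cnj (c$j$k) * partial_deriv k \<Phi> y))
          (\<lambda>z. cnj (W i z)) (hk i s))
      = bil (\<lambda>y. D y * \<Phi> y) (\<lambda>z. cnj (W i z)) (hk i s)" for i
    by (rule bil_cong_snd[OF pp' s V\<Phi> kern_dL[OF s] VL kern_hk[OF s] D\<Phi> kern_hk[OF s] cW])
       (rule div_step[OF div Lq(1,2) p(2) s \<Phi>])
  then have "(\<Sum>j\<in>UNIV. bil (\<lambda>y. V j y * \<Phi> y) (\<lambda>z. cnj (W i z)) (dL j i s))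
      = bil (\<lambda>y. D y * \<Phi> y) (\<lambda>z. cnj (W i z)) (hk i s)
      - (\<Sum>j\<in>UNIV. bil (\<lambda>y. V j y * (\<Sum>k\<in>UNIV. cnj (c$j$k) * partial_deriv k \<Phi> y))
          (\<lambda>z. cnj (W i z)) (hk i s))" for i
    by (simp only: eq_diff_eq)
  with * show ?thesis by (simp only:)
qed

end

subsection \<open>Approximate identities\<close>

text \<open>One integer truncates both support and height, with |g|^q as dominating function. Having
  R \<ge> 1 keeps the clamp in \<open>bounded_approx_continuous\<close> away from division by
  zero.\<close>

lemma Lq_truncate:
  fixes g :: "real^'d::finite \<Rightarrow> complex"
  assumes "Lq q g" "q > 0" "e > 0"
  obtains R where "R \<ge> 1"
    "(LINT x|lborel. cmod (g x - (if norm x \<le> R \<and> cmod (g x) \<le> R then g x else 0)) powr q) < e"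
proof -
  have [measurable]: "g \<in> borel_measurable borel" using LqD assms by auto
  let ?g = "\<lambda>n x. (if norm x \<le> real n \<and> cmod (g x) \<le> real n then g x else 0)"
  have "(\<lambda>n. LINT x|lborel. cmod (g x - ?g n x) powr q) \<longlonglongrightarrow> (LINT x|(lborel::(real^'d) measure). 0)"
  proof (rule integral_dominated_convergence[where w = "\<lambda>x. cmod (g x) powr q"])
    show "AE x in lborel. (\<lambda>n. cmod (g x - ?g n x) powr q) \<longlonglongrightarrow> 0"
    proof (intro AE_I2 tendsto_eventually)
      fix x :: "real^'d"
      obtain m :: nat where "max (norm x) (cmod (g x)) \<le> real m" using real_arch_simple by blast
      then show "\<forall>\<^sub>F n in sequentially. cmod (g x - ?g n x) powr q = 0"
        by (intro eventually_sequentiallyI[of m]) auto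
    qed
    show "AE x in lborel. norm (cmod (g x - ?g n x) powr q) \<le> cmod (g x) powr q" for n
      by (intro AE_I2) auto
  qed (use LqD(2)[OF assms(1)] in auto)
  then have "(\<lambda>n. LINT x|lborel. cmod (g x - ?g n x) powr q) \<longlonglongrightarrow> 0" by simp
  then have "\<forall>\<^sub>F n in sequentially. (LINT x|lborel. cmod (g x - ?g n x) powr q) < e"
    by (rule order_tendstoD) fact
  then obtain m where m: "\<And>n. n \<ge> m \<Longrightarrow> (LINT x|lborel. cmod (g x - ?g n x) powr q) < e"
    unfolding eventually_sequentially by blast
  define n where "n = max m 1"
  have "n \<ge> 1" "(LINT x|lborel. cmod (g x - ?g n x) powr q) < e"
    using m[of n] unfolding n_def by (linarith, simp only: max.cobounded1)
  then show ?thesis by (intro that[of "real n"]) auto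
qed

text \<open>Measurability provides continuous functions converging almost everywhere. Clamping their
  values to modulus R and cutting them off beyond radius R + 1 supplies a dominating function and
  does not change the limit, because g obeys the same bounds.\<close>

lemma bounded_approx_continuous:
  fixes g :: "real^'d::finite \<Rightarrow> complex"
  assumes [measurable]: "g \<in> borel_measurable borel" and g: "\<And>x. cmod (g x) \<le> R"
      "\<And>x. norm x > R \<Longrightarrow> g x = 0"
    and "R \<ge> 1" "q > 0" "e > 0"
  obtains h where "continuous_on UNIV h" "\<And>x. cmod (h x) \<le> R" "\<And>x. norm x > R + 1 \<Longrightarrow> h x = 0"
    "(LINT x|lborel. cmod (g x - h x) powr q) < e"
proof -
  have "g \<in> borel_measurable lebesgue"
    by (rule measurable_completion) simp
  then have "g measurable_on UNIV"
    using measurable_on_iff_borel_measurable[of UNIV g] by simp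
  then obtain N k where N: "negligible N" and k: "\<And>n. continuous_on UNIV (k n)"
    and lim: "\<And>x. x \<notin> N \<Longrightarrow> (\<lambda>n. k n x) \<longlonglongrightarrow> g x"
    unfolding measurable_on_def by auto
  define clamp where "clamp z = of_real (R / max R (cmod z)) * z" for z :: complex
  define \<theta> where "\<theta> x = max 0 (min 1 (R + 1 - norm x))" for x :: "real^'d"
  define h where "h n x = of_real (\<theta> x) * clamp (k n x)" for n x
  have cc: "isCont clamp z" for z
    unfolding clamp_def using \<open>R \<ge> 1\<close> by (intro continuous_intros) auto
  have clamp_le: "cmod (clamp z) \<le> R" for z
    using \<open>R \<ge> 1\<close> by (auto simp: clamp_def norm_mult norm_divide max_def field_simps)
  have h_cont: "continuous_on UNIV (h n)" for n
    unfolding h_def \<theta>_def clamp_def using \<open>R \<ge> 1\<close> by (intro continuous_intros k) auto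
  have \<theta>: "0 \<le> \<theta> x" "\<theta> x \<le> 1" for x by (auto simp: \<theta>_def)
  have h_le: "cmod (h n x) \<le> R" for n x
    using mult_mono[OF \<theta>(2)[of x] clamp_le[of "k n x"]] \<theta>(1)[of x] by (simp add: h_def norm_mult)
  have h_0: "h n x = 0" if "norm x > R + 1" for n x
    using that by (simp add: h_def \<theta>_def)
  have h_lim: "(\<lambda>n. h n x) \<longlonglongrightarrow> g x" if "x \<notin> N" for x
  proof -
    have "(\<lambda>n. h n x) \<longlonglongrightarrow> of_real (\<theta> x) * clamp (g x)"
      unfolding h_def by (intro tendsto_intros isCont_tendsto_compose[OF cc lim] that)
    also have "of_real (\<theta> x) * clamp (g x) = g x"
    proof (cases "norm x \<le> R")
      case True
      then show ?thesis using g(1)[of x] \<open>R \<ge> 1\<close> by (simp add: \<theta>_def clamp_def max_def)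
    qed (use g(2)[of x] in \<open>simp add: clamp_def\<close>)
    finally show ?thesis .
  qed
  have [measurable]: "h n \<in> borel_measurable borel" for n
    by (rule borel_measurable_continuous_onI[OF h_cont])
  have "AE x in lborel. x \<notin> N"
    using AE_not_in[OF N[unfolded negligible_iff_null_sets]] by (simp only: AE_completion_iff)
  have "(\<lambda>n. LINT x|lborel. cmod (g x - h n x) powr q) \<longlonglongrightarrow> (LINT x|(lborel::(real^'d) measure). 0)"
  proof (rule integral_dominated_convergence[where w = "\<lambda>x. (2 * R) powr q * indicator
      (cball 0 (R + 1)) x"])
    show "integrable lborel (\<lambda>x::real^'d. (2 * R) powr q * indicator (cball 0 (R + 1)) x)"
      by (intro integrable_mult_right integrable_real_indicator)
          (auto simp: emeasure_lborel_cball_finite[unfolded infinity_ennreal_def])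
    show "AE x in lborel. (\<lambda>n. cmod (g x - h n x) powr q) \<longlonglongrightarrow> 0"
      using \<open>AE x in lborel. x \<notin> N\<close>
    proof eventually_elim
      case (elim x)
      have "(\<lambda>n. cmod (g x - h n x)) \<longlonglongrightarrow> cmod (g x - g x)"
        by (intro tendsto_intros h_lim elim)
      then have "(\<lambda>n. cmod (g x - h n x) powr q) \<longlonglongrightarrow> cmod (g x - g x) powr q"
        using \<open>q > 0\<close> by (intro tendsto_powr2) auto
      then show ?case by simp
    qed
    show "AE x in lborel. norm (cmod (g x - h n x) powr q) \<le> (2 * R) powr q * indicator
        (cball 0 (R + 1)) x" for n
    proof (intro AE_I2)
      fix x
      show "norm (cmod (g x - h n x) powr q) \<le> (2 * R) powr q * indicator (cball 0 (R + 1)) x"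
      proof (cases "norm x \<le> R + 1")
        case True
        have "cmod (g x - h n x) \<le> 2 * R"
          using norm_triangle_ineq4[of "g x" "h n x"] g(1)[of x] h_le[of n x] by simp
        then have "cmod (g x - h n x) powr q \<le> (2 * R) powr q"
          using \<open>q > 0\<close> by (intro powr_mono2) auto
        then show ?thesis using True by simp
      next
        case False
        then show ?thesis using g(2)[of x] h_0[of x n] by simp
      qed
    qed
  qed auto
  then have "(\<lambda>n. LINT x|lborel. cmod (g x - h n x) powr q) \<longlonglongrightarrow> 0" by simp
  then have "\<forall>\<^sub>F n in sequentially. (LINT x|lborel. cmod (g x - h n x) powr q) < e"
    by (rule order_tendstoD) fact
  then obtain n where n: "(LINT x|lborel. cmod (g x - h n x) powr q) < e"
    by (auto dest: eventually_happens)
  show ?thesis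
    by (rule that[of "h n"]) (use h_cont h_le h_0 n in auto)
qed

lemma Lq_bounded_support:
  fixes h :: "real^'d::finite \<Rightarrow> complex"
  assumes [measurable]: "h \<in> borel_measurable borel" and le: "\<And>x. cmod (h x) \<le> M"
      "\<And>x. norm x > R \<Longrightarrow> h x = 0" and "q > 0"
  shows "Lq q h"
proof -
  have M: "M \<ge> 0" using order_trans[OF norm_ge_zero le(1)] .
  have "integrable lborel (\<lambda>x. cmod (h x) powr q)"
  proof (rule Bochner_Integration.integrable_bound)
    show "integrable lborel (\<lambda>x::real^'d. M powr q * indicator (cball 0 R) x)"
      by (intro integrable_mult_right integrable_real_indicator)
          (auto simp: emeasure_lborel_cball_finite[unfolded infinity_ennreal_def])
    have "cmod (h x) powr q \<le> M powr q * indicator (cball 0 R) x" for x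
      using le[of x] \<open>q > 0\<close> M by (cases "norm x \<le> R") (auto intro: powr_mono2)
    then show "AE x in lborel. norm (cmod (h x) powr q) \<le> norm (M powr q * indicator (cball 0 R) x)"
      by (intro AE_I2) (simp add: abs_mult)
  qed measurable
  then show ?thesis by (simp add: Lq_def)
qed

lemma Lq_dense_continuous:
  fixes g :: "real^'d::finite \<Rightarrow> complex"
  assumes "Lq q g" "q > 0" "e > 0"
  obtains h R where "continuous_on UNIV h" "\<And>x. cmod (h x) \<le> R" "\<And>x. norm x > R \<Longrightarrow> h x = 0" "R \<ge> 0"
    "Lq q h" "Lq q (\<lambda>x. g x - h x)" "(LINT x|lborel. cmod (g x - h x) powr q) < e"
proof -
  have [measurable]: "g \<in> borel_measurable borel" using LqD assms by auto
  \<comment> \<open>\<open>norm_add_powr_le\<close> costs a factor 2^q, and there are two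
    errors.\<close>
  define e' where "e' = e / (2 * 2 powr q)"
  have e': "e' > 0" using \<open>e > 0\<close> by (simp add: e'_def)
  obtain R where R: "R \<ge> 1" "(LINT x|lborel. cmod
      (g x - (if norm x \<le> R \<and> cmod (g x) \<le> R then g x else 0)) powr q) < e'"
    by (rule Lq_truncate[OF assms(1,2) e'])
  define g1 where "g1 x = (if norm x \<le> R \<and> cmod (g x) \<le> R then g x else 0)" for x
  have [measurable]: "g1 \<in> borel_measurable borel" unfolding g1_def by measurable
  have g1: "cmod (g1 x) \<le> R" "norm x > R \<Longrightarrow> g1 x = 0" for x using R(1) by (auto simp: g1_def)
  obtain h where h: "continuous_on UNIV h" "\<And>x. cmod (h x) \<le> R" "\<And>x. norm x > R + 1 \<Longrightarrow> h x = 0"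
    "(LINT x|lborel. cmod (g1 x - h x) powr q) < e'"
    by (rule bounded_approx_continuous[of g1 R q e']) (use g1 R e' \<open>q > 0\<close> in auto)
  have [measurable]: "h \<in> borel_measurable borel"
    by (rule borel_measurable_continuous_onI[OF h(1)])
  have Lh: "Lq q h" by (rule Lq_bounded_support[of h R "R + 1"]) (use h \<open>q > 0\<close> in auto)
  have Lg1: "Lq q g1" by (rule Lq_bounded_support[of g1 R R]) (use g1 \<open>q > 0\<close> in auto)
  have diff: "Lq q u \<Longrightarrow> Lq q v \<Longrightarrow> Lq q (\<lambda>x. u x - v x)" for u v :: "real^'d \<Rightarrow> complex"
    using Lq_add[of q u "\<lambda>x. -1 * v x"] Lq_cmult[of q v "-1"] \<open>q > 0\<close> by simp
  have "(LINT x|lborel. cmod (g x - h x) powr q) \<le> (LINT x|lborel. 2 powr q *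
      (cmod (g x - g1 x) powr q + cmod (g1 x - h x) powr q))"
  proof (rule integral_mono)
    show "cmod (g x - h x) powr q \<le> 2 powr q * (cmod (g x - g1 x) powr q + cmod
        (g1 x - h x) powr q)" for x
      using norm_add_powr_le[OF \<open>q > 0\<close>, of "g x - g1 x" "g1 x - h x"] by simp
  qed (use diff[OF assms(1) Lh, THEN LqD(2)] diff[OF assms(1) Lg1, THEN LqD(2)]
      diff[OF Lg1 Lh, THEN LqD(2)] in auto)
  also have "\<dots> = 2 powr q * ((LINT x|lborel. cmod (g x - g1 x) powr q) +
      (LINT x|lborel. cmod (g1 x - h x) powr q))"
    using diff[OF assms(1) Lg1, THEN LqD(2)] diff[OF Lg1 Lh, THEN LqD(2)] by simp
  also have "\<dots> < 2 powr q * (e' + e')"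
    using R(2) h(4) by (intro mult_strict_left_mono add_strict_mono) (auto simp: g1_def)
  also have "\<dots> = e" by (simp add: e'_def)
  finally have "(LINT x|lborel. cmod (g x - h x) powr q) < e" .
  \<comment> \<open>R + 1 serves both as the bound on the values and as the radius of the
    support.\<close>
  moreover have "cmod (h x) \<le> R + 1" for x using h(2)[of x] by linarith
  ultimately show ?thesis
    using R(1) by (intro that[of h "R + 1"] h Lh diff assms) auto
qed

lemma lborel_integral_affine:
  fixes F :: "real^'d::finite \<Rightarrow> complex"
  assumes [measurable]: "F \<in> borel_measurable borel" and "r \<noteq> 0"
  shows "(LINT z|lborel. F z) = \<bar>r\<bar> ^ CARD('d) *\<^sub>R (LINT w|lborel. F (y + r *\<^sub>R w))"
proof -
  have "(LINT z|lborel. F z) = (LINT z|density (distr lborel borel (\<lambda>x. y + r *\<^sub>R x))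
      (\<lambda>_. \<bar>r\<bar> ^ DIM(real^'d)). F z)"
    using lborel_affine[OF \<open>r \<noteq> 0\<close>, of y] by simp
  also have "\<dots> = (LINT z|distr lborel borel (\<lambda>x. y + r *\<^sub>R x). \<bar>r\<bar> ^ DIM(real^'d) *\<^sub>R F z)"
    by (intro integral_density) auto
  also have "\<dots> = (LINT w|lborel. \<bar>r\<bar> ^ DIM(real^'d) *\<^sub>R F (y + r *\<^sub>R w))"
    by (intro integral_distr) auto
  finally show ?thesis by simp
qed

section \<open>The Gaussian as an approximate identity\<close>

context heat_kernel
begin

lemma gk_rescale: "s > 0 \<Longrightarrow> gk s (s *\<^sub>R w) = of_real (1 / s ^ CARD('d)) * gk 1 w"
  by (simp add: gk_def Q_def matrix_vector_mult_scaleR power2_eq_square)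

lemma gk_borel [measurable]: "gk s \<in> borel_measurable borel"
  by (rule smooth_borel[OF smooth_gk])

text \<open>Substituting z = y - s w fixes the kernel and puts s into the argument of h, where
  continuity of h can be used.\<close>

lemma gk_convolution_eq:
  assumes [measurable]: "h \<in> borel_measurable borel" and "s > 0"
  shows "(LINT z|lborel. h z * gk s (y - z)) = (LINT w|lborel. h (y - s *\<^sub>R w) * gk 1 w)"
proof -
  have "(LINT z|lborel. h z * gk s (y - z)) = \<bar>- s\<bar> ^ CARD('d) *\<^sub>R
      (LINT w|lborel. h (y + (- s) *\<^sub>R w) * gk s (y - (y + (- s) *\<^sub>R w)))"
    using \<open>s > 0\<close> by (intro lborel_integral_affine) auto
  also have "\<dots> = (LINT w|lborel. s ^ CARD('d) *\<^sub>R
      (h (y - s *\<^sub>R w) * (of_real (1 / s ^ CARD('d)) * gk 1 w)))"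
    using \<open>s > 0\<close> by (simp add: gk_rescale)
  also have "\<dots> = (LINT w|lborel. h (y - s *\<^sub>R w) * gk 1 w)"
    using \<open>s > 0\<close> by (intro Bochner_Integration.integral_cong) (auto simp: scaleR_conv_of_real)
  finally show ?thesis .
qed

definition mass :: complex where "mass = (LINT w|lborel. gk 1 w)"

lemma wt_integrable:
  assumes "s > 0"
  shows "integrable lborel (\<lambda>w::real^'d. wt (CARD('d) + 1) s w)"
proof (rule integrableI_bounded)
  show "(\<integral>\<^sup>+w. ennreal (norm (wt (CARD('d) + 1) s (w::real^'d))) \<partial>lborel) < \<infinity>"
    using le_less_trans[OF wt_integral_le(2)[OF assms, of "0::real^'d"] ennreal_less_top] assms
        by (simp add: wt_nonneg)
qed simp

lemma gk_integrable: "integrable lborel (gk 1)"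
proof (rule Bochner_Integration.integrable_bound)
  show "integrable lborel (\<lambda>w::real^'d. gk_const (CARD('d) + 1) * wt (CARD('d) + 1) 1 w)"
    by (intro integrable_mult_right wt_integrable) simp
  show "AE w in lborel. cmod (gk 1 w) \<le> norm (gk_const (CARD('d) + 1) * wt (CARD('d) + 1) 1 w)"
    using order_trans[OF gk_bound abs_ge_self] by (intro AE_I2) (simp add: gk_const_pos)
qed simp

text \<open>A strictly positive integrand with integral zero would make the whole space a null
  set.\<close>

lemma mass_nonzero: "mass \<noteq> 0"
proof
  assume "mass = 0"
  have gk1: "gk 1 w = of_real (exp (- Q w))" for w by (simp add: gk_def)
  have i: "integrable lborel (\<lambda>w. exp (- Q w))"
    using integrable_Re[OF gk_integrable] by (simp add: gk1)
  have "complex_of_real (LINT w|lborel. exp (- Q w)) = 0"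
    using \<open>mass = 0\<close> by (simp add: mass_def gk1)
  then have "(LINT w|lborel. exp (- Q w)) = 0" by simp
  then have "AE w in lborel. exp (- Q w) = 0"
    using integral_nonneg_eq_0_iff_AE[OF i] by simp
  then have "AE w in (lborel::(real^'d) measure). False" by simp
  then have "emeasure lborel (UNIV :: (real^'d) set) = 0"
    by (simp add: AE_iff_null null_sets_def)
  then show False by simp
qed

text \<open>The inner convolutions converge pointwise to \<open>h y * mass\<close>. Dominated
  convergence in y needs a bound uniform in n that is integrable against an arbitrary f in L^p,
  hence one with decay in y.\<close>

lemma bil_gk_tendsto_continuous:
  assumes f: "Lq p f" and pp': "1 < p" "1 / p + 1 / p' = 1"
    and h: "continuous_on UNIV h" "\<And>x. cmod (h x) \<le> R" "\<And>x. norm x > R \<Longrightarrow> h x = 0" "R \<ge> 0"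
    and s: "\<And>n. 0 < s n" "\<And>n. s n \<le> 1" "s \<longlonglongrightarrow> 0"
  shows "(\<lambda>n. bil f h (gk (s n))) \<longlonglongrightarrow> mass * (LINT y|lborel. f y * h y)"
proof -
  let ?K = "CARD('d) + 1"
  have [measurable]: "h \<in> borel_measurable borel" "f \<in> borel_measurable borel"
    using borel_measurable_continuous_onI[OF h(1)] LqD[OF f] by auto
  have p': "p' > 1" by (rule conjugate_exponent_gt_1[OF pp'])
  have Lh: "Lq p' h" by (rule Lq_bounded_support[of h R R]) (use h p' in auto)
  define u where "u n y = (LINT w|lborel. h (y - s n *\<^sub>R w) * gk 1 w)" for n y
  have "(LINT z|lborel. h z * gk (s n) (y - z)) = u n y" for n y
    unfolding u_def by (rule gk_convolution_eq) (auto intro: s)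
  then have bil_eq: "bil f h (gk (s n)) = (LINT y|lborel. f y * u n y)" for n
    unfolding bil_fst(1)[OF pp' s(1)[of n] f Lh kern_gk[OF s(1)]] by simp
  have u_meas [measurable]: "u n \<in> borel_measurable borel" for n
    unfolding u_def by measurable
  have u_lim: "(\<lambda>n. u n y) \<longlonglongrightarrow> h y * mass" for y
  proof -
    have "(\<lambda>n. u n y) \<longlonglongrightarrow> (LINT w|lborel. h y * gk 1 w)"
      unfolding u_def
    proof (rule integral_dominated_convergence[where w = "\<lambda>w. R * cmod (gk 1 w)"])
      show "integrable lborel (\<lambda>w. R * cmod (gk 1 w))" using gk_integrable by simp
      show "AE w in lborel. (\<lambda>n. h (y - s n *\<^sub>R w) * gk 1 w) \<longlonglongrightarrow> h y * gk 1 w"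
      proof (intro AE_I2 tendsto_mult tendsto_const)
        fix w
        have "(\<lambda>n. y - s n *\<^sub>R w) \<longlonglongrightarrow> y - 0 *\<^sub>R w" by (intro tendsto_intros s)
        then have "(\<lambda>n. y - s n *\<^sub>R w) \<longlonglongrightarrow> y" by simp
        moreover have "isCont h y" using h(1) by (simp add: continuous_on_eq_continuous_at)
        ultimately show "(\<lambda>n. h (y - s n *\<^sub>R w)) \<longlonglongrightarrow> h y" by (rule isCont_tendsto_compose[rotated])
      qed
      show "AE w in lborel. cmod (h (y - s n *\<^sub>R w) * gk 1 w) \<le> R * cmod (gk 1 w)" for n
        unfolding norm_mult by (intro AE_I2 mult_right_mono h) auto
    qed measurable
    then show ?thesis by (simp add: mass_def)
  qed
  \<comment> \<open>Where h does not vanish, s \<le> 1 gives 1 + |y| \<le> (1 + R) (1 + |w|). Half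
    of the Gaussian decay in w is thus converted into decay in y, whence the power of 1 + R and the
    doubled exponent in \<open>gk_const\<close>.\<close>
  define E where "E = R * gk_const (2 * ?K) * (1 + R) ^ ?K * wt_const TYPE(real^'d)"
  have u_le: "cmod (u n y) \<le> E * wt ?K 1 y" for n y
  proof -
    have pw: "cmod (h (y - s n *\<^sub>R w) * gk 1 w) \<le> R * gk_const (2 * ?K) * (1 + R) ^ ?K * wt ?K 1 y
        * wt ?K 1 w" for w
    proof (cases "norm (y - s n *\<^sub>R w) \<le> R")
      case True
      have "norm y \<le> norm (y - s n *\<^sub>R w) + norm (s n *\<^sub>R w)"
        using norm_triangle_ineq[of "y - s n *\<^sub>R w" "s n *\<^sub>R w"] by simp
      also have "\<dots> \<le> R + 1 * norm w"
        using True s(1)[of n] s(2)[of n] mult_right_mono[OF s(2)[of n] norm_ge_zero[of w]]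
        by (intro add_mono) auto
      finally have "norm y \<le> R + 1 * norm w" .
      moreover have "(1 + R) * (1 + norm w) = 1 + (R + 1 * norm w) + R * norm w"
        by (simp add: algebra_simps)
      moreover have "0 \<le> R * norm w" using \<open>R \<ge> 0\<close> by simp
      ultimately have "1 + norm y \<le> (1 + R) * (1 + norm w)" by linarith
      then have "(1 + norm y) ^ ?K \<le> (1 + R) ^ ?K * (1 + norm w) ^ ?K"
        unfolding power_mult_distrib[symmetric] by (intro power_mono) auto
      then have "1 / (1 + norm w) ^ ?K \<le> (1 + R) ^ ?K * wt ?K 1 y"
        using one_plus_norm_power_pos[of 1 y ?K] one_plus_norm_power_pos[of 1 w ?K]
        by (simp add: wt_def field_simps)
      then have *: "wt ?K 1 w * (1 / (1 + norm w) ^ ?K) \<le> wt ?K 1 w * ((1 + R) ^ ?K * wt ?K 1 y)"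
        by (intro mult_left_mono wt_nonneg) auto
      have "cmod (h (y - s n *\<^sub>R w) * gk 1 w) \<le> R * (gk_const (2 * ?K) * wt (2 * ?K) 1 w)"
        unfolding norm_mult using h(2) \<open>R \<ge> 0\<close> by (intro mult_mono gk_bound) auto
      also have "\<dots> = R * gk_const (2 * ?K) * (wt ?K 1 w * (1 / (1 + norm w) ^ ?K))"
        unfolding wt_double by simp
      also have "\<dots> \<le> R * gk_const (2 * ?K) * (wt ?K 1 w * ((1 + R) ^ ?K * wt ?K 1 y))"
        using \<open>R \<ge> 0\<close> gk_const_pos[of "2 * ?K"] by (intro mult_left_mono *) auto
      finally show ?thesis by (simp add: mult_ac)
    next
      case False
      then show ?thesis
        using h(3) \<open>R \<ge> 0\<close> gk_const_pos[of "2 * ?K"] wt_nonneg[of 1 ?K y] wt_nonneg[of 1 ?K w] by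
            simp
    qed
    have int: "integrable lborel (\<lambda>w. R * gk_const (2 * ?K) * (1 + R) ^ ?K * wt ?K 1 y * wt ?K 1
        (w::real^'d))"
      by (intro integrable_mult_right wt_integrable) simp
    have int': "integrable lborel (\<lambda>w. h (y - s n *\<^sub>R w) * gk 1 w)"
      by (rule Bochner_Integration.integrable_bound[OF int])
        (measurable, intro AE_I2, unfold real_norm_def, rule order_trans[OF pw abs_ge_self])
    have "cmod (u n y) \<le> (LINT w|lborel. cmod (h (y - s n *\<^sub>R w) * gk 1 w))"
      unfolding u_def by (rule Bochner_Integration.integral_norm_bound)
    also have "\<dots> \<le> (LINT w|lborel. R * gk_const (2 * ?K) * (1 + R) ^ ?K * wt ?K 1 y * wt ?K 1
        (w::real^'d))"
      by (rule Bochner_Integration.integral_mono[OF integrable_norm[OF int'] int pw])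
    also have "\<dots> = R * gk_const (2 * ?K) * (1 + R) ^ ?K * wt ?K 1 y * (LINT w|lborel. wt ?K 1
        (w::real^'d))"
      by simp
    also have "\<dots> \<le> R * gk_const (2 * ?K) * (1 + R) ^ ?K * wt ?K 1 y * wt_const TYPE(real^'d)"
    proof (rule mult_left_mono)
      have "ennreal (LINT w|lborel. wt ?K 1 (w::real^'d)) =
          (\<integral>\<^sup>+w. ennreal (wt ?K 1 (w::real^'d)) \<partial>lborel)"
        by (rule nn_integral_eq_integral[OF wt_integrable[OF zero_less_one], symmetric])
           (intro AE_I2 wt_nonneg zero_less_one)
      also have "\<dots> \<le> ennreal (wt_const TYPE(real^'d))"
        using wt_integral_le(2)[of 1 "0::real^'d"] by simp
      finally show "(LINT w|lborel. wt ?K 1 (w::real^'d)) \<le> wt_const TYPE(real^'d)"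
        using wt_const_pos[where 'a = "real^'d"] by (simp add: ennreal_le_iff)
    qed (use \<open>R \<ge> 0\<close> gk_const_pos[of "2 * ?K"] wt_nonneg[of 1 ?K y] in auto)
    finally show ?thesis by (simp add: E_def mult_ac)
  qed
  have "(\<lambda>n. LINT y|lborel. f y * u n y) \<longlonglongrightarrow> (LINT y|lborel. f y * (h y * mass))"
  proof (rule integral_dominated_convergence[where w = "\<lambda>y. cmod (f y) * (E * wt ?K 1 y)"])
    have "integrable lborel (\<lambda>y. f y * of_real (E * wt ?K 1 y))"
      using pp' by (intro kern_integrable[OF f _ zero_less_one, where x = 0 and C = "\<bar>E\<bar>"])
        (auto simp: abs_mult wt_nonneg simp del: of_real_mult)
    from integrable_norm[OF this] have "integrable lborel (\<lambda>y. cmod (f y) * \<bar>E * wt ?K 1 y\<bar>)"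
      by (simp add: norm_mult abs_mult)
    moreover have "\<bar>E * wt ?K 1 y\<bar> = E * wt ?K 1 y" for y :: "real^'d"
      using order_trans[OF norm_ge_zero u_le] by (simp add: abs_of_nonneg)
    ultimately show "integrable lborel (\<lambda>y. cmod (f y) * (E * wt ?K 1 y))" by simp
    show "AE y in lborel. (\<lambda>n. f y * u n y) \<longlonglongrightarrow> f y * (h y * mass)"
      by (intro AE_I2 tendsto_intros u_lim)
    show "AE y in lborel. cmod (f y * u n y) \<le> cmod (f y) * (E * wt ?K 1 y)" for n
      unfolding norm_mult by (intro AE_I2 mult_left_mono u_le) auto
  qed measurable
  moreover have "f y * (h y * mass) = mass * (f y * h y)" for y by simp
  ultimately show ?thesis
    unfolding bil_eq by (simp only: integral_mult_right_zero)
qed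

end

lemma bil_norm_le:
  fixes f g :: "real^'d::finite \<Rightarrow> complex"
  assumes f: "Lq p f" and g: "Lq p' g" and pp': "1 < p" "1 / p + 1 / p' = 1" and "s > 0" "C \<ge> 0"
    and k: "k \<in> borel_measurable borel" "\<And>w. cmod (k w) \<le> C * wt (CARD('d) + 1) s w"
  shows "cmod (bil f g k) \<le> C * wt_const TYPE(real^'d) * ((LINT y|lborel. cmod (f y) powr p) +
      (LINT z|lborel. cmod (g z) powr p'))"
proof -
  have "kern s k" using k by (auto simp: kern_def)
  have nn: "(\<integral>\<^sup>+y. ennreal (cmod (f y) powr p) \<partial>lborel) = ennreal (LINT y|lborel. cmod (f y) powr p)"
    "(\<integral>\<^sup>+y. ennreal (cmod (g y) powr p') \<partial>lborel) = ennreal (LINT y|lborel. cmod (g y) powr p')"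
    by (rule nn_integral_eq_integral[OF LqD(2)[OF f]], simp)
        (rule nn_integral_eq_integral[OF LqD(2)[OF g]], simp)
  have nonneg: "0 \<le> (LINT y|lborel. cmod (f y) powr p)" "0 \<le> (LINT y|lborel. cmod (g y) powr p')"
    by (simp_all add: integral_nonneg_AE)
  have "ennreal (cmod (bil f g k)) \<le> (\<integral>\<^sup>+q. ennreal
      (cmod (f (fst q) * g (snd q) * k (fst q - snd q))) \<partial>(lborel \<Otimes>\<^sub>M lborel))"
    unfolding bil_def by (rule integral_norm_bound_ennreal[OF bil_integrable[OF pp' \<open>s > 0\<close> f g
        \<open>kern s k\<close>]])
  also have "\<dots> \<le> ennreal (C * wt_const TYPE(real^'d)) *
      (ennreal (LINT y|lborel. cmod (f y) powr p) + ennreal (LINT y|lborel. cmod (g y) powr p'))"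
    using bil_nn_integral_le[OF f g pp' \<open>s > 0\<close> \<open>C \<ge> 0\<close> k] unfolding nn .
  also have "\<dots> = ennreal (C * wt_const TYPE(real^'d) * ((LINT y|lborel. cmod (f y) powr p) +
      (LINT z|lborel. cmod (g z) powr p')))"
    using nonneg \<open>C \<ge> 0\<close> wt_const_pos[where 'a = "real^'d"] by (simp add: ennreal_mult)
  finally show ?thesis
    using nonneg \<open>C \<ge> 0\<close> wt_const_pos[where 'a = "real^'d"] by (simp add: ennreal_le_iff)
qed

lemma Lq_mult_integrable:
  assumes f: "Lq p f" and g: "Lq p' g" and pp': "1 < p" "1 / p + 1 / p' = 1"
  shows "integrable lborel (\<lambda>y. f y * g y)"
    and "cmod (LINT y|lborel. f y * g y) \<le> (LINT y|lborel. cmod (f y) powr p) +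
        (LINT y|lborel. cmod (g y) powr p')"
proof -
  have [measurable]: "f \<in> borel_measurable borel" "g \<in> borel_measurable borel"
    using LqD f g by auto
  have le: "cmod (f y * g y) \<le> cmod (f y) powr p + cmod (g y) powr p'" for y
    unfolding norm_mult using pp' by (intro mult_le_powr_add) auto
  have i: "integrable lborel (\<lambda>y. cmod (f y) powr p + cmod (g y) powr p')"
    using LqD(2)[OF f] LqD(2)[OF g] by simp
  show fg: "integrable lborel (\<lambda>y. f y * g y)"
    by (rule Bochner_Integration.integrable_bound[OF i], measurable, intro AE_I2, unfold
        real_norm_def, rule order_trans[OF le abs_ge_self])
  have "cmod (LINT y|lborel. f y * g y) \<le> (LINT y|lborel. cmod (f y * g y))"
    by (rule Bochner_Integration.integral_norm_bound)
  also have "\<dots> \<le> (LINT y|lborel. cmod (f y) powr p + cmod (g y) powr p')"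
    by (rule Bochner_Integration.integral_mono[OF integrable_norm[OF fg] i le])
  also have "\<dots> = (LINT y|lborel. cmod (f y) powr p) + (LINT y|lborel. cmod (g y) powr p')"
    using LqD(2)[OF f] LqD(2)[OF g] by simp
  finally show "cmod (LINT y|lborel. f y * g y) \<le> (LINT y|lborel. cmod (f y) powr p) +
      (LINT y|lborel. cmod (g y) powr p')" .
qed

lemma bil_add_snd:
  assumes "1 < p" "1 / p + 1 / p' = 1" "s > 0" "Lq p f" "Lq p' g1" "Lq p' g2" "kern s k"
  shows "bil f (\<lambda>z. g1 z + g2 z) k = bil f g1 k + bil f g2 k"
  unfolding bil_def using bil_integrable[OF assms(1-4,5,7)] bil_integrable[OF assms(1-4,6,7)]
  by (simp add: distrib_left distrib_right)

text \<open>Scaling one factor up and the other down leaves the form unchanged, but lets one term of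
  the additive Young bound be made as small as desired.\<close>

lemma bil_balance: "\<eta> \<noteq> 0 \<Longrightarrow> bil (\<lambda>y. \<eta> * f y) (\<lambda>z. g z / \<eta>) k = bil f g k"
  unfolding bil_def by (intro Bochner_Integration.integral_cong) auto

lemma LINT_cmod_scaled_powr:
  assumes "a > 0"
  shows "(LINT y|lborel. cmod (of_real a * f y) powr q) = a powr q *
      (LINT y|lborel. cmod (f y) powr q)"
  using assms by (simp add: norm_mult powr_mult)

context heat_kernel
begin

text \<open>Density of continuous functions in L^p' together with a bound on the forms that is
  uniform in s. As that bound is a sum, f is first scaled by \<eta> to make its share small, and
  only then is g approximated.\<close>

lemma bil_gk_tendsto:
  assumes f: "Lq p f" and g: "Lq p' g" and pp': "1 < p" "1 / p + 1 / p' = 1"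
    and s: "\<And>n. 0 < s n" "\<And>n. s n \<le> 1" "s \<longlonglongrightarrow> 0"
  shows "(\<lambda>n. bil f g (gk (s n))) \<longlonglongrightarrow> mass * (LINT y|lborel. f y * g y)"
proof (rule tendstoI)
  fix e :: real assume e: "e > 0"
  have p': "p' > 1" by (rule conjugate_exponent_gt_1[OF pp'])
  define A where "A = gk_const (CARD('d) + 1) * wt_const TYPE(real^'d)"
  have A: "A > 0" unfolding A_def by (intro mult_pos_pos gk_const_pos wt_const_pos)
  \<comment> \<open>M controls the forms through A and the limit functional through
    \<open>cmod mass\<close>.\<close>
  define M where "M = A + cmod mass"
  have M: "M > 0" using A by (simp add: M_def add_pos_nonneg)
  define F where "F = (LINT y|lborel. cmod (f y) powr p)"
  have F: "F \<ge> 0" unfolding F_def by (simp add: integral_nonneg_AE)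
  \<comment> \<open>Chosen so that M \<eta>^p F stays below e/4; F + 1 avoids division by
    zero.\<close>
  define \<eta> where "\<eta> = (e / (4 * M * (F + 1))) powr (1 / p)"
  have \<eta>: "\<eta> > 0" using e M F by (auto simp: \<eta>_def)
  have \<eta>F: "M * (\<eta> powr p * F) < e / 4"
  proof -
    have "\<eta> powr p = e / (4 * M * (F + 1))"
      using pp' e M F by (simp add: \<eta>_def powr_powr)
    then have "M * (\<eta> powr p * F) = e / 4 * (F / (F + 1))" using M by simp
    also have "\<dots> < e / 4 * 1" using e F by (intro mult_strict_left_mono) auto
    finally show ?thesis by simp
  qed
  \<comment> \<open>The approximation error must beat the factor (1/\<eta>)^p', so d is chosen after
    \<eta>.\<close>
  define d where "d = e / 4 / (M * (1 / \<eta>) powr p')"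
  have d: "d > 0" using e M \<eta> by (simp add: d_def)
  have "p' > 0" using p' by simp
  obtain h R where h: "continuous_on UNIV h" "\<And>x. cmod (h x) \<le> R" "\<And>x. norm x > R \<Longrightarrow> h x = 0" "R \<ge> 0"
    "Lq p' h" "Lq p' (\<lambda>x. g x - h x)" "(LINT x|lborel. cmod (g x - h x) powr p') < d"
    by (rule Lq_dense_continuous[OF g \<open>p' > 0\<close> d]) blast
  define X where "X = \<eta> powr p * F + (1 / \<eta>) powr p' * (LINT x|lborel. cmod (g x - h x) powr p')"
  have MX: "M * X < e / 2"
  proof -
    have "M * (1 / \<eta>) powr p' * (LINT x|lborel. cmod (g x - h x) powr p') < M * (1 / \<eta>) powr p' * d"
      using M \<eta> h(7) by (intro mult_strict_left_mono) auto
    also have "\<dots> = e / 4" using M \<eta> by (simp add: d_def)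
    finally show ?thesis using \<eta>F by (simp add: X_def distrib_left)
  qed
  have Lf: "Lq p (\<lambda>y. of_real \<eta> * f y)" using pp' by (intro Lq_cmult f) auto
  have Lr: "Lq p' (\<lambda>y. of_real (1 / \<eta>) * (g y - h y))" using p' by (intro Lq_cmult h) auto
  have X_eq: "(LINT y|lborel. cmod (of_real \<eta> * f y) powr p) +
      (LINT y|lborel. cmod (of_real (1 / \<eta>) * (g y - h y)) powr p') = X"
    using \<eta> by (subst (1 2) LINT_cmod_scaled_powr) (auto simp: X_def F_def)
  have bil_r: "cmod (bil f (\<lambda>z. g z - h z) (gk (s n))) \<le> A * X" for n
  proof -
    have "bil f (\<lambda>z. g z - h z) (gk (s n)) = bil (\<lambda>y. of_real \<eta> * f y)
        (\<lambda>y. of_real (1 / \<eta>) * (g y - h y)) (gk (s n))"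
      using bil_balance[of "of_real \<eta>" f "\<lambda>z. g z - h z"] \<eta> by (simp add: field_simps)
    also have "cmod \<dots> \<le> gk_const (CARD('d) + 1) * wt_const TYPE(real^'d) *
        ((LINT y|lborel. cmod (of_real \<eta> * f y) powr p) +
            (LINT y|lborel. cmod (of_real (1 / \<eta>) * (g y - h y)) powr p'))"
      by (rule bil_norm_le[OF Lf Lr pp' s(1)])
          (auto intro: less_imp_le gk_const_pos gk_bound[OF s(1)] simp del: One_nat_def)
    finally show ?thesis unfolding X_eq A_def .
  qed
  have int_r: "cmod (LINT y|lborel. f y * (g y - h y)) \<le> X"
  proof -
    have "(LINT y|lborel. f y * (g y - h y)) = (LINT y|lborel. (of_real \<eta> * f y) *
        (of_real (1 / \<eta>) * (g y - h y)))"
      using \<eta> by (intro Bochner_Integration.integral_cong) auto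
    then show ?thesis
      using Lq_mult_integrable(2)[OF Lf Lr pp'] unfolding X_eq by simp
  qed
  have split_bil: "bil f g (gk (s n)) = bil f h (gk (s n)) + bil f (\<lambda>z. g z - h z) (gk (s n))" for n
    using bil_add_snd[OF pp' s(1) f h(5,6) kern_gk[OF s(1)], of n] by simp
  have split_int: "(LINT y|lborel. f y * g y) = (LINT y|lborel. f y * h y) +
      (LINT y|lborel. f y * (g y - h y))"
  proof -
    have "f y * g y = f y * h y + f y * (g y - h y)" for y by (simp add: right_diff_distrib)
    then show ?thesis
      by (simp only:) (rule Bochner_Integration.integral_add[OF Lq_mult_integrable(1)[OF f h(5)
          pp'] Lq_mult_integrable(1)[OF f h(6) pp']])
  qed
  have "(\<lambda>n. bil f h (gk (s n))) \<longlonglongrightarrow> mass * (LINT y|lborel. f y * h y)"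
    by (rule bil_gk_tendsto_continuous[OF f pp' h(1-4) s])
  then have "\<forall>\<^sub>F n in sequentially. dist (bil f h (gk (s n))) (mass * (LINT y|lborel. f y * h y))
      < e / 2"
    using e by (intro tendstoD) auto
  then show "\<forall>\<^sub>F n in sequentially. dist (bil f g (gk (s n))) (mass * (LINT y|lborel. f y * g y))
      < e"
  proof eventually_elim
    case (elim n)
    let ?a = "bil f h (gk (s n)) - mass * (LINT y|lborel. f y * h y)"
      and ?b = "bil f (\<lambda>z. g z - h z) (gk (s n))" and ?d =
          "mass * (LINT y|lborel. f y * (g y - h y))"
    have eq: "bil f g (gk (s n)) - mass * (LINT y|lborel. f y * g y) = ?a + (?b - ?d)"
      by (subst split_bil, subst split_int) (simp add: distrib_left)
    have "cmod (?a + (?b - ?d)) \<le> cmod ?a + (cmod ?b + cmod ?d)"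
      by (intro order_trans[OF norm_triangle_ineq] add_left_mono norm_triangle_ineq4)
    also have "\<dots> < e / 2 + e / 2"
    proof (rule add_strict_mono)
      have "cmod (mass * (LINT y|lborel. f y * (g y - h y))) \<le> cmod mass * X"
        unfolding norm_mult by (intro mult_left_mono int_r) simp
      then have "cmod (bil f (\<lambda>z. g z - h z) (gk (s n))) + cmod
          (mass * (LINT y|lborel. f y * (g y - h y))) \<le> M * X"
        using bil_r[of n] by (simp add: M_def distrib_right)
      then show "cmod (bil f (\<lambda>z. g z - h z) (gk (s n))) + cmod
          (mass * (LINT y|lborel. f y * (g y - h y))) < e / 2"
        using MX by linarith
      show "cmod ?a < e / 2" using elim unfolding dist_norm .
    qed
    finally have "cmod (?a + (?b - ?d)) < e" by simp
    then show ?case unfolding dist_norm eq .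
  qed
qed

section \<open>Integration of the heat equation in s\<close>

definition c_const :: real where "c_const = (\<Sum>i\<in>UNIV. \<Sum>k\<in>UNIV. cmod (c$i$k))"

lemma c_const_nonneg: "c_const \<ge> 0"
  unfolding c_const_def by (intro sum_nonneg) auto

definition lap_const :: real where
  "lap_const = c_const * (6 * b_const\<^sup>2 * gk_const (CARD('d) + 1 + 2))"

lemma lap_const_nonneg: "lap_const \<ge> 0"
  unfolding lap_const_def using c_const_nonneg gk_const_pos[of "CARD('d) + 1 + 2"] by simp

lemma lap_bound:
  assumes "s > 0"
  shows "cmod (lap s w) \<le> lap_const / s\<^sup>2 * wt (CARD('d) + 1) s w"
proof -
  have "cmod (lap s w) \<le> (\<Sum>i\<in>UNIV. \<Sum>k\<in>UNIV. cmod (c$i$k) * (6 * b_const\<^sup>2 * gk_const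
      (CARD('d) + 1 + 2) / s\<^sup>2 * wt (CARD('d) + 1) s w))"
    unfolding lap_def
  proof (intro order_trans[OF norm_sum] sum_mono)
    fix i k
    show "cmod (cnj (c$i$k) * dhk k i s w) \<le> cmod (c$i$k) * (6 * b_const\<^sup>2 * gk_const
        (CARD('d) + 1 + 2) / s\<^sup>2 * wt (CARD('d) + 1) s w)"
      unfolding norm_mult complex_mod_cnj by (intro mult_left_mono dhk_bound assms) auto
  qed
  also have "\<dots> = c_const * (6 * b_const\<^sup>2 * gk_const (CARD('d) + 1 + 2) / s\<^sup>2 * wt
      (CARD('d) + 1) s w)"
    by (simp only: c_const_def sum_distrib_right)
  finally show ?thesis by (simp add: lap_const_def)
qed

text \<open>Fubini requires joint measurability in both points and s; the closed form
  \<open>lap_eq\<close> exhibits it.\<close>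

lemma lap_measurable_pair:
  "(\<lambda>(q, s). lap s (fst q - snd q)) \<in> borel_measurable ((lborel \<Otimes>\<^sub>M lborel) \<Otimes>\<^sub>M lborel)"
proof -
  have [measurable]: "Q \<in> borel_measurable borel"
    using Q_has_derivative by (intro borel_measurable_continuous_onI
        has_derivative_continuous_on) (auto intro: has_derivative_at_withinI)
  show ?thesis unfolding lap_eq gk_def case_prod_beta' by measurable
qed

text \<open>The fundamental theorem of calculus is applied to the kernel at each pair of points, and
  Fubini moves the form inside. Away from s = 0 all the kernels are dominated by one weight at scale
  t.\<close>

lemma bil_gk_FTC:
  assumes f: "Lq p f" and g: "Lq p' g" and pp': "1 < p" "1 / p + 1 / p' = 1" and e: "0 < e" "e \<le> t"
  shows "integrable lborel (\<lambda>s. indicator {e..t} s *\<^sub>R (of_real (s / 2) * bil f g (lap s)))"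
    and "bil f g (gk t) - bil f g (gk e) = (LINT s|lborel. indicator {e..t} s *\<^sub>R
        (of_real (s / 2) * bil f g (lap s)))"
proof -
  let ?K = "CARD('d) + 1"
  let ?H = "\<lambda>q. f (fst q) * g (snd q)"
  let ?G = "\<lambda>q s. indicator {e..t} s *\<^sub>R (of_real (s / 2) * (?H q * lap s (fst q - snd q)))"
  have t: "t > 0" using e by linarith
  have [measurable]: "f \<in> borel_measurable borel" "g \<in> borel_measurable borel"
    using LqD f g by auto
  note lap_measurable_pair[measurable]
  have meas: "case_prod ?G \<in> borel_measurable ((lborel \<Otimes>\<^sub>M lborel) \<Otimes>\<^sub>M lborel)"
  proof -
    have "(\<lambda>q. indicator {e..t} (snd q) *\<^sub>R (of_real (snd q / 2) *
        (?H (fst q) * (case q of (q, s) \<Rightarrow> lap s (fst q - snd q)))))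
      \<in> borel_measurable ((lborel \<Otimes>\<^sub>M lborel) \<Otimes>\<^sub>M (lborel::real measure))"
      by measurable
    then show ?thesis by (simp add: case_prod_beta')
  qed
  \<comment> \<open>Worst cases on [e, t]: 1/s^2 \<le> 1/e^2, rescaling from s to t costs at most
    (t/e)^N, and s/2 \<le> t. The blow-up as e tends to 0 is harmless, since E only justifies
    Fubini.\<close>
  define E where "E = lap_const / e\<^sup>2 * (t / e) ^ CARD('d) * t"
  have E: "E \<ge> 0" using e t lap_const_nonneg by (simp add: E_def)
  have le: "cmod (?G q s) \<le> cmod (?H q * of_real (E * wt ?K t (fst q - snd q)))
      * indicator {e..t} s" for q s
  proof (cases "s \<in> {e..t}")
    case True
    then have s: "s > 0" "e \<le> s" "s \<le> t" using e by auto
    have "cmod (lap s (fst q - snd q)) \<le> lap_const / s\<^sup>2 * wt ?K s (fst q - snd q)"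
      by (rule lap_bound[OF s(1)])
    also have "\<dots> \<le> lap_const / e\<^sup>2 * ((t / s) ^ CARD('d) * wt ?K t (fst q - snd q))"
    proof (intro mult_mono)
      show "lap_const / s\<^sup>2 \<le> lap_const / e\<^sup>2"
        using s e lap_const_nonneg by (intro divide_left_mono power_mono) auto
      show "wt ?K s (fst q - snd q) \<le> (t / s) ^ CARD('d) * wt ?K t (fst q - snd q)"
        using wt_rescale[OF s(1,3), of ?K "fst q - snd q"] by simp
    qed (use s e lap_const_nonneg in \<open>auto intro: wt_nonneg\<close>)
    also have "\<dots> \<le> lap_const / e\<^sup>2 * ((t / e) ^ CARD('d) * wt ?K t (fst q - snd q))"
      using s e t lap_const_nonneg
      by (intro mult_left_mono mult_right_mono power_mono divide_left_mono wt_nonneg) auto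
    finally have "cmod (lap s (fst q - snd q)) \<le> lap_const / e\<^sup>2 * ((t / e) ^ CARD('d) * wt ?K t
        (fst q - snd q))" .
    then have "s / 2 * cmod (lap s (fst q - snd q)) \<le> t *
        (lap_const / e\<^sup>2 * ((t / e) ^ CARD('d) * wt ?K t (fst q - snd q)))"
      using s t by (intro mult_mono) auto
    also have "\<dots> = E * wt ?K t (fst q - snd q)" by (simp add: E_def mult_ac)
    finally have "cmod (?H q) * (s / 2 * cmod (lap s (fst q - snd q))) \<le> cmod (?H q) *
        (E * wt ?K t (fst q - snd q))"
      by (rule mult_left_mono) simp
    then show ?thesis
      using True s E wt_nonneg[OF t, of ?K "fst q - snd q"] by (simp add: norm_mult mult_ac)
  qed simp
  have kE: "kern t (\<lambda>w::real^'d. complex_of_real (E * wt ?K t w))"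
    unfolding kern_def using E t by (intro conjI exI[of _ E])
        (auto simp: wt_nonneg abs_mult simp del: of_real_mult)
  have int: "integrable ((lborel \<Otimes>\<^sub>M lborel) \<Otimes>\<^sub>M lborel) (case_prod ?G)"
  proof (rule integrableI_bounded[OF meas])
    have "(\<integral>\<^sup>+x. ennreal (norm (case_prod ?G x)) \<partial>((lborel \<Otimes>\<^sub>M lborel) \<Otimes>\<^sub>M lborel))
       = (\<integral>\<^sup>+q. \<integral>\<^sup>+s. ennreal (cmod (?G q s)) \<partial>lborel \<partial>(lborel \<Otimes>\<^sub>M lborel))"
      using meas by (subst lborel.nn_integral_fst[symmetric]) (auto simp: case_prod_beta')
    also have "\<dots> \<le> (\<integral>\<^sup>+q. \<integral>\<^sup>+s. ennreal (cmod (?H q * of_real (E * wt ?K t (fst q - snd q))))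
        * indicator {e..t} s \<partial>lborel \<partial>(lborel \<Otimes>\<^sub>M lborel))"
    proof (intro nn_integral_mono)
      have ind: "ennreal (X * indicator S r) = ennreal X * indicator S r" for X and r :: real and S
        by (cases "r \<in> S") auto
      show "ennreal (cmod (?G q s)) \<le> ennreal
          (cmod (?H q * of_real (E * wt ?K t (fst q - snd q)))) * indicator {e..t} s" for q s
        unfolding ind[symmetric] by (rule ennreal_leI[OF le])
    qed
    also have "\<dots> = (\<integral>\<^sup>+q. ennreal (cmod (?H q * of_real (E * wt ?K t (fst q - snd q))))
        \<partial>(lborel \<Otimes>\<^sub>M lborel)) * ennreal (t - e)"
      using e by (simp add: nn_integral_cmult_indicator nn_integral_multc)
    also have "\<dots> < \<infinity>"
      using bil_integrable[OF pp' t f g kE] unfolding integrable_iff_bounded by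
          (auto simp: ennreal_mult_less_top)
    finally show "(\<integral>\<^sup>+x. ennreal (norm (case_prod ?G x)) \<partial>((lborel \<Otimes>\<^sub>M lborel) \<Otimes>\<^sub>M lborel)) < \<infinity>" .
  qed
  have sf: "pair_sigma_finite (lborel \<Otimes>\<^sub>M lborel :: ((real^'d) \<times> (real^'d)) measure)
      (lborel :: real measure)"
    unfolding lborel_prod ..
  have inner_s: "(LINT q|(lborel \<Otimes>\<^sub>M lborel). ?G q s) = indicator {e..t} s *\<^sub>R
      (of_real (s / 2) * bil f g (lap s))" for s
    unfolding bil_def by simp
  have inner_q: "(LINT s|lborel. ?G q s) = ?H q * gk t (fst q - snd q) - ?H q * gk e
      (fst q - snd q)" for q
  proof -
    let ?w = "fst q - snd q"
    have "(LINT s|lborel. indicator {e..t} s *\<^sub>R (of_real (s / 2) * lap s ?w)) = gk t ?w - gk e ?w"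
    proof (rule integral_FTC_atLeastAtMost[OF e(2)])
      show "((\<lambda>s. gk s ?w) has_vector_derivative of_real (s / 2) * lap s ?w)
          (at s within {e..t})" if "e \<le> s" for s
        using that e by (intro has_vector_derivative_at_within[OF gk_has_vector_derivative]) auto
      show "continuous_on {e..t} (\<lambda>s. of_real (s / 2) * lap s ?w)"
        unfolding lap_eq gk_def using e by (intro continuous_intros) auto
    qed
    moreover have "?G q s = ?H q * (indicator {e..t} s *\<^sub>R (of_real (s / 2) * lap s ?w))" for s
      by (simp add: mult_ac)
    ultimately show ?thesis
      by (simp only: integral_mult_right_zero right_diff_distrib)
  qed
  show "integrable lborel (\<lambda>s. indicator {e..t} s *\<^sub>R (of_real (s / 2) * bil f g (lap s)))"
    using pair_sigma_finite.integrable_snd[OF sf int] unfolding inner_s .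
  have "(LINT s|lborel. indicator {e..t} s *\<^sub>R (of_real (s / 2) * bil f g (lap s)))
      = (LINT q|(lborel \<Otimes>\<^sub>M lborel). (LINT s|lborel. ?G q s))"
    using pair_sigma_finite.Fubini_integral[OF sf int] unfolding inner_s .
  also have "\<dots> = bil f g (gk t) - bil f g (gk e)"
    unfolding inner_q bil_def
    using bil_integrable[OF pp' t f g kern_gk[OF t]] bil_integrable[OF pp' e(1) f g
        kern_gk[OF e(1)]]
    by (rule Bochner_Integration.integral_diff)
  finally show "bil f g (gk t) - bil f g (gk e) = (LINT s|lborel. indicator {e..t} s *\<^sub>R
      (of_real (s / 2) * bil f g (lap s)))" ..
qed

text \<open>The antiderivative is 2 E sqrt s / sqrt t, so for nonnegative E the integral is at most
  2 E whatever the lower limit.\<close>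

lemma integral_inverse_sqrt:
  assumes "0 < e" "e \<le> t"
  shows "(LINT s|lborel. indicator {e..t} s *\<^sub>R (E / (sqrt s * sqrt t))) = 2 * E *
      (sqrt t - sqrt e) / sqrt t"
    and "integrable lborel (\<lambda>s. indicator {e..t} s *\<^sub>R (E / (sqrt s * sqrt t)))"
proof -
  have t: "t > 0" using assms by linarith
  have cont: "continuous_on {e..t} (\<lambda>s. E / (sqrt s * sqrt t))"
    using assms t by (intro continuous_intros) auto
  have "(LINT s|lborel. indicator {e..t} s *\<^sub>R (E / (sqrt s * sqrt t))) = 2 * E * sqrt t / sqrt t
      - 2 * E * sqrt e / sqrt t"
  proof (rule integral_FTC_atLeastAtMost[OF assms(2) _ cont])
    fix s assume "e \<le> s"
    then have "s > 0" using assms by linarith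
    then have "((\<lambda>s. 2 * E * sqrt s / sqrt t) has_real_derivative (E / (sqrt s * sqrt t)))
        (at s within {e..t})"
      using t by (auto intro!: derivative_eq_intros simp: field_simps)
    then show "((\<lambda>s. 2 * E * sqrt s / sqrt t) has_vector_derivative (E / (sqrt s * sqrt t)))
        (at s within {e..t})"
      by (simp add: has_real_derivative_iff_has_vector_derivative)
  qed
  then show "(LINT s|lborel. indicator {e..t} s *\<^sub>R (E / (sqrt s * sqrt t))) = 2 * E *
      (sqrt t - sqrt e) / sqrt t"
    by (simp add: diff_divide_distrib right_diff_distrib)
  show "integrable lborel (\<lambda>s. indicator {e..t} s *\<^sub>R (E / (sqrt s * sqrt t)))"
    using borel_integrable_atLeastAtMost'[OF cont] unfolding set_integrable_def .
qed

text \<open>The value at a small scale is the value at scale t minus an integral. The resulting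
  bound is independent of the small scale, which may therefore tend to 0 and turn the forms into
  \<open>mass\<close> times the integral of the product.\<close>

lemma mass_integral_bound:
  fixes f g :: "'n \<Rightarrow> real^'d \<Rightarrow> complex"
  assumes f: "\<And>j. Lq p (f j)" and g: "\<And>j. Lq p' (g j)" and pp': "1 < p" "1 / p + 1 / p' = 1"
    and t: "0 < t" "t \<le> 1" and "E \<ge> 0"
    and lap: "\<And>s. 0 < s \<Longrightarrow> s \<le> t \<Longrightarrow> cmod (of_real (s / 2) * (\<Sum>j\<in>UNIV. bil (f j) (g j) (lap s)))
        \<le> E / (sqrt s * sqrt t)"
    and gk: "cmod (\<Sum>j\<in>UNIV. bil (f j) (g j) (gk t)) \<le> E'"
  shows "cmod (mass * (\<Sum>j\<in>UNIV. LINT y|lborel. f j y * g j y)) \<le> E' + 2 * E"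
proof -
  have step: "cmod (\<Sum>j\<in>UNIV. bil (f j) (g j) (gk e)) \<le> E' + 2 * E" if e: "0 < e" "e \<le> t" for e
  proof -
    let ?u = "\<lambda>j s. indicator {e..t} s *\<^sub>R (of_real (s / 2) * bil (f j) (g j) (lap s))"
    note FTC = bil_gk_FTC[OF f g pp' e]
    have i: "integrable lborel (\<lambda>s. \<Sum>j\<in>UNIV. ?u j s)"
      by (intro Bochner_Integration.integrable_sum FTC)
    have eq: "(\<Sum>j\<in>UNIV. bil (f j) (g j) (gk t)) - (\<Sum>j\<in>UNIV. bil (f j) (g j) (gk e)) =
        (LINT s|lborel. (\<Sum>j\<in>UNIV. ?u j s))"
      unfolding sum_subtractf[symmetric] FTC(2) by
          (rule Bochner_Integration.integral_sum[symmetric]) (rule FTC(1))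
    have "cmod (LINT s|lborel. (\<Sum>j\<in>UNIV. ?u j s)) \<le> (LINT s|lborel. cmod (\<Sum>j\<in>UNIV. ?u j s))"
      by (rule Bochner_Integration.integral_norm_bound)
    also have "\<dots> \<le> (LINT s|lborel. indicator {e..t} s *\<^sub>R (E / (sqrt s * sqrt t)))"
    proof (rule Bochner_Integration.integral_mono[OF integrable_norm[OF i]
        integral_inverse_sqrt(2)[OF e]])
      fix s
      have "(\<Sum>j\<in>UNIV. ?u j s) = indicator {e..t} s *\<^sub>R
          (of_real (s / 2) * (\<Sum>j\<in>UNIV. bil (f j) (g j) (lap s)))"
        by (simp only: sum_distrib_left scaleR_sum_right)
      then show "cmod (\<Sum>j\<in>UNIV. ?u j s) \<le> indicator {e..t} s *\<^sub>R (E / (sqrt s * sqrt t))"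
        using lap[of s] e by (simp add: indicator_def)
    qed
    also have "\<dots> = 2 * E * ((sqrt t - sqrt e) / sqrt t)"
      unfolding integral_inverse_sqrt(1)[OF e] by simp
    also have "\<dots> \<le> 2 * E * 1"
      using e t \<open>E \<ge> 0\<close> by (intro mult_left_mono) (auto simp: divide_le_eq)
    finally have "cmod ((\<Sum>j\<in>UNIV. bil (f j) (g j) (gk t)) - (\<Sum>j\<in>UNIV. bil (f j) (g j) (gk e)))
        \<le> 2 * E"
      unfolding eq by simp
    then show ?thesis
      using gk norm_triangle_sub[of "\<Sum>j\<in>UNIV. bil (f j) (g j) (gk e)" "\<Sum>j\<in>UNIV. bil (f j) (g j)
          (gk t)"]
      by (simp add: norm_minus_commute)
  qed
  define s where "s n = t * inverse (real (Suc n))" for n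
  have s: "0 < s n" "s n \<le> t" "s n \<le> 1" for n
  proof -
    have "inverse (real (Suc n)) \<le> 1" by (simp add: field_simps)
    then have "s n \<le> t * 1" unfolding s_def using t by (intro mult_left_mono) auto
    then show "s n \<le> t" "s n \<le> 1" using t by auto
  qed (use t in \<open>simp add: s_def\<close>)
  have s0: "s \<longlonglongrightarrow> 0"
    unfolding s_def using tendsto_mult[OF tendsto_const[of t] LIMSEQ_inverse_real_of_nat] by simp
  have "(\<lambda>n. \<Sum>j\<in>UNIV. bil (f j) (g j) (gk (s n))) \<longlonglongrightarrow>
      (\<Sum>j\<in>UNIV. mass * (LINT y|lborel. f j y * g j y))"
    by (intro tendsto_sum bil_gk_tendsto[OF f g pp' s(1,3) s0])
  then have "(\<lambda>n. cmod (\<Sum>j\<in>UNIV. bil (f j) (g j) (gk (s n)))) \<longlonglongrightarrow> cmod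
      (\<Sum>j\<in>UNIV. mass * (LINT y|lborel. f j y * g j y))"
    by (rule tendsto_norm)
  then have "cmod (\<Sum>j\<in>UNIV. mass * (LINT y|lborel. f j y * g j y)) \<le> E' + 2 * E"
    by (rule LIMSEQ_le_const2) (use step s in blast)
  then show ?thesis by (simp only: sum_distrib_left)
qed

end

subsection \<open>The pointwise bound\<close>

text \<open>The set of infinite values lies in every superlevel set, whose measure is O(1/l) by the
  weak type bound.\<close>

lemma maximal_fun_AE_finite:
  fixes f :: "'a::euclidean_space \<Rightarrow> ennreal"
  assumes [measurable]: "f \<in> borel_measurable borel" and fin: "(\<integral>\<^sup>+y. f y \<partial>lborel) < \<infinity>"
  shows "AE x in lborel. maximal_fun f x < \<infinity>"
proof -
  let ?S = "{x. maximal_fun f x = \<infinity>}"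
  obtain i where i: "(\<integral>\<^sup>+y. f y \<partial>lborel) = ennreal i" "i \<ge> 0"
    using fin by (cases "\<integral>\<^sup>+y. f y \<partial>lborel") auto
  define I where "I = 5 ^ DIM('a) * i"
  have "(5::ennreal) ^ DIM('a) = ennreal (5 ^ DIM('a))" by (simp flip: ennreal_power)
  then have I: "5 ^ DIM('a) * (\<integral>\<^sup>+y. f y \<partial>lborel) = ennreal I" "I \<ge> 0"
    using i by (simp_all add: I_def ennreal_mult)
  have le: "emeasure lborel ?S \<le> ennreal (I / l)" if "l > 0" for l
  proof -
    have "ennreal l * emeasure lborel ?S \<le> ennreal l
        * emeasure lborel {x. ennreal l < maximal_fun f x}"
      by (intro mult_left_mono emeasure_mono) auto
    also have "\<dots> \<le> ennreal I"
      unfolding I(1)[symmetric] by (rule maximal_fun_weak_type[OF assms(1) that])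
    finally have "ennreal (1 / l) * (ennreal l * emeasure lborel ?S) \<le> ennreal (1 / l) * ennreal I"
      by (rule mult_left_mono) simp
    then show ?thesis
      using that I by (simp add: mult.assoc[symmetric] flip: ennreal_mult)
  qed
  have "emeasure lborel ?S \<le> ennreal 0"
  proof (rule tendsto_lowerbound)
    have "(\<lambda>n. I * inverse (real (Suc n))) \<longlonglongrightarrow> I * 0"
      by (intro tendsto_mult tendsto_const LIMSEQ_inverse_real_of_nat)
    then show "(\<lambda>n. ennreal (I * inverse (real (Suc n)))) \<longlonglongrightarrow> ennreal 0"
      by (intro tendsto_ennrealI) simp
    show "\<forall>\<^sub>F n in sequentially. emeasure lborel ?S \<le> ennreal (I * inverse (real (Suc n)))"
      using le[of "real (Suc n)" for n] by (intro always_eventually allI) (simp add: divide_inverse)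
  qed simp
  then have "?S \<in> null_sets lborel" by (intro null_setsI) auto
  then have "AE x in lborel. x \<notin> ?S" by (rule AE_not_in)
  then show ?thesis by eventually_elim (auto simp: top.not_eq_extremum)
qed

text \<open>This is (M u^a)^(1/a) with a = 1/\<alpha>; it is bounded on L^p when p \<alpha> > 1,
  that is a < p. With \<alpha> as parameter the two exponents of a product add up to 1 +
  \<delta>.\<close>

definition mf :: "real \<Rightarrow> ('a::euclidean_space \<Rightarrow> real) \<Rightarrow> 'a \<Rightarrow> real" where
  "mf \<alpha> u x = enn2real (maximal_fun (\<lambda>y. ennreal (u y powr (1 / \<alpha>))) x) powr \<alpha>"

text \<open>Guards against the default of \<open>enn2real\<close>, under which an infinite maximal
  function would give \<open>mf\<close> the value 0.\<close>

definition mf_finite :: "real \<Rightarrow> ('a::euclidean_space \<Rightarrow> real) \<Rightarrow> 'a \<Rightarrow> bool" where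
  "mf_finite \<alpha> u x \<longleftrightarrow> maximal_fun (\<lambda>y. ennreal (u y powr (1 / \<alpha>))) x < \<infinity>"

lemma mf_nonneg: "mf \<alpha> u x \<ge> 0"
  by (simp add: mf_def)

lemma mf_measurable [measurable]:
  "u \<in> borel_measurable borel \<Longrightarrow> mf \<alpha> u \<in> borel_measurable borel"
  unfolding mf_def[abs_def] by measurable

text \<open>Since p \<alpha> > 1, the function u^(1/\<alpha>) is at most 1 + u^p, and u^p is
  integrable.\<close>

lemma mf_AE_finite:
  fixes u :: "'a::euclidean_space \<Rightarrow> real"
  assumes [measurable]: "u \<in> borel_measurable borel" and nonneg: "\<And>x. u x \<ge> 0" and "\<alpha> > 0"
      "p * \<alpha> > 1"
    and int: "integrable lborel (\<lambda>x. u x powr p)"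
  shows "AE x in lborel. mf_finite \<alpha> u x"
proof -
  have le: "ennreal (u y powr (1 / \<alpha>)) \<le> ennreal (u y powr p) + 1" for y
  proof -
    have "u y powr (1 / \<alpha>) \<le> 1 + (u y powr (1 / \<alpha>)) powr (p * \<alpha>)"
      using assms by (intro le_one_plus_powr) auto
    also have "(u y powr (1 / \<alpha>)) powr (p * \<alpha>) = u y powr p"
      using \<open>\<alpha> > 0\<close> by (simp add: powr_powr)
    finally have "ennreal (u y powr (1 / \<alpha>)) \<le> ennreal (u y powr p + 1)"
      by (intro ennreal_leI) simp
    then show ?thesis by simp
  qed
  have "AE x in lborel. maximal_fun (\<lambda>y. ennreal (u y powr p)) x < \<infinity>"
    using int unfolding integrable_iff_bounded by (intro maximal_fun_AE_finite) auto
  then show ?thesis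
  proof eventually_elim
    case (elim x)
    have "maximal_fun (\<lambda>y. ennreal (u y powr (1 / \<alpha>))) x \<le> maximal_fun (\<lambda>y. ennreal (u y powr p)
        + 1) x"
      by (intro maximal_fun_mono le)
    also have "\<dots> \<le> maximal_fun (\<lambda>y. ennreal (u y powr p)) x + 1"
      by (intro maximal_fun_add_const) measurable
    also have "\<dots> < \<infinity>" using elim by simp
    finally show ?case unfolding mf_finite_def .
  qed
qed

definition max_const :: "'a::euclidean_space itself \<Rightarrow> real \<Rightarrow> real" where
  "max_const _ q = q * (2 * 5 ^ DIM('a)) * 2 powr (q - 1) / (q - 1)"

lemma max_const_nonneg: "q > 1 \<Longrightarrow> max_const TYPE('a::euclidean_space) q \<ge> 0"
  by (simp add: max_const_def)

text \<open>The strong type bound for u^(1/\<alpha>) at the exponent p \<alpha> > 1; the powers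
  recombine to u^p.\<close>

lemma mf_strong_type:
  fixes u :: "'a::euclidean_space \<Rightarrow> real"
  assumes [measurable]: "u \<in> borel_measurable borel" and nonneg: "\<And>x. u x \<ge> 0" and "\<alpha> > 0"
      "p * \<alpha> > 1"
    and int: "integrable lborel (\<lambda>x. u x powr p)"
  shows "(\<integral>\<^sup>+x. ennreal (mf \<alpha> u x powr p) \<partial>lborel) \<le> ennreal (max_const TYPE('a) (p * \<alpha>) *
      (LINT x|lborel. u x powr p))"
proof -
  have "(\<integral>\<^sup>+x. ennreal (mf \<alpha> u x powr p) \<partial>lborel)
      = (\<integral>\<^sup>+x. ennreal (enn2real (maximal_fun (\<lambda>y. ennreal (u y powr (1 / \<alpha>))) x) powr (p * \<alpha>))
          \<partial>lborel)"
    by (simp add: mf_def powr_powr mult.commute)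
  also have "\<dots> \<le> ennreal (max_const TYPE('a) (p * \<alpha>)) *
      (\<integral>\<^sup>+x. ennreal ((u x powr (1 / \<alpha>)) powr (p * \<alpha>)) \<partial>lborel)"
    unfolding max_const_def using assms by (intro maximal_fun_strong_type) auto
  also have "(\<integral>\<^sup>+x. ennreal ((u x powr (1 / \<alpha>)) powr (p * \<alpha>)) \<partial>lborel) = ennreal
      (LINT x|lborel. u x powr p)"
    using \<open>\<alpha> > 0\<close> nn_integral_eq_integral[OF int] by (simp add: powr_powr)
  finally show ?thesis
    using max_const_nonneg[OF \<open>p * \<alpha> > 1\<close>, where 'a = 'a] by
        (simp add: ennreal_mult' integral_nonneg_AE)
qed

text \<open>Hoelder's inequality from Young's, after dividing X by a and Y by b. As a or b may
  vanish, slightly larger numbers are used and a limit is taken. The constants add because Young's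
  inequality is additive.\<close>

lemma nn_integral_mult_le:
  fixes X Y :: "'a \<Rightarrow> real"
  assumes [measurable]: "X \<in> borel_measurable M" "Y \<in> borel_measurable M"
    and nonneg: "\<And>x. X x \<ge> 0" "\<And>x. Y x \<ge> 0" and pp': "1 < p" "1 / p + 1 / p' = 1" "p' > 1"
    and AB: "A \<ge> 0" "A' \<ge> 0" "a \<ge> 0" "b \<ge> 0"
    and le: "(\<integral>\<^sup>+x. ennreal (X x powr p) \<partial>M) \<le> ennreal (A * a powr p)"
        "(\<integral>\<^sup>+x. ennreal (Y x powr p') \<partial>M) \<le> ennreal (A' * b powr p')"
  shows "(\<integral>\<^sup>+x. ennreal (X x * Y x) \<partial>M) \<le> ennreal ((A + A') * (a * b))"
proof (rule tendsto_lowerbound)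
  let ?e = "\<lambda>n. inverse (real (Suc n))"
  have "(\<lambda>n. (A + A') * ((a + ?e n) * (b + ?e n))) \<longlonglongrightarrow> (A + A') * ((a + 0) * (b + 0))"
    by (intro tendsto_mult tendsto_add tendsto_const LIMSEQ_inverse_real_of_nat)
  then show "(\<lambda>n. ennreal ((A + A') * ((a + ?e n) * (b + ?e n)))) \<longlonglongrightarrow> ennreal ((A + A') * (a * b))"
    by (intro tendsto_ennrealI) simp
  have "(\<integral>\<^sup>+x. ennreal (X x * Y x) \<partial>M) \<le> ennreal ((A + A') * (a1 * b1))"
    if a1: "a1 > 0" "a \<le> a1" and b1: "b1 > 0" "b \<le> b1" for a1 b1
  proof -
    have pw: "X x * Y x \<le> a1 * b1 * (X x powr p / a1 powr p + Y x powr p' / b1 powr p')" for x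
    proof -
      have "(X x / a1) * (Y x / b1) \<le> (X x / a1) powr p + (Y x / b1) powr p'"
        using nonneg a1 b1 pp' by (intro mult_le_powr_add) auto
      then have "a1 * b1 * ((X x / a1) * (Y x / b1)) \<le> a1 * b1 *
          ((X x / a1) powr p + (Y x / b1) powr p')"
        using a1 b1 by (intro mult_left_mono) auto
      then show ?thesis using a1 b1 nonneg by (simp add: powr_divide)
    qed
    have "(\<integral>\<^sup>+x. ennreal (X x * Y x) \<partial>M)
       \<le> (\<integral>\<^sup>+x. ennreal (a1 * b1) * (ennreal (1 / a1 powr p) * ennreal (X x powr p) + ennreal
           (1 / b1 powr p') * ennreal (Y x powr p')) \<partial>M)"
      using pw a1 b1 by (intro nn_integral_mono)
          (simp add: ennreal_leI flip: ennreal_mult ennreal_plus)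
    also have "\<dots> = ennreal (a1 * b1) * (ennreal (1 / a1 powr p) * (\<integral>\<^sup>+x. ennreal (X x powr p) \<partial>M)
        + ennreal (1 / b1 powr p') * (\<integral>\<^sup>+x. ennreal (Y x powr p') \<partial>M))"
      by (simp add: nn_integral_cmult nn_integral_add)
    also have "\<dots> \<le> ennreal (a1 * b1) * (ennreal (1 / a1 powr p) * ennreal (A * a1 powr p)
        + ennreal (1 / b1 powr p') * ennreal (A' * b1 powr p'))"
    proof (intro mult_left_mono add_mono)
      have "A * a powr p \<le> A * a1 powr p" "A' * b powr p' \<le> A' * b1 powr p'"
        using AB a1 b1 pp' by (intro mult_left_mono powr_mono2; simp)+
      then show "(\<integral>\<^sup>+x. ennreal (X x powr p) \<partial>M) \<le> ennreal (A * a1 powr p)"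
          "(\<integral>\<^sup>+x. ennreal (Y x powr p') \<partial>M) \<le> ennreal (A' * b1 powr p')"
        using le by (meson ennreal_leI order_trans)+
    qed auto
    also have "\<dots> = ennreal ((A + A') * (a1 * b1))"
      using AB a1 b1 by (simp add: mult_ac flip: ennreal_mult ennreal_plus)
    finally show ?thesis .
  qed
  note bound = this
  show "\<forall>\<^sub>F n in sequentially. (\<integral>\<^sup>+x. ennreal (X x * Y x) \<partial>M) \<le> ennreal
      ((A + A') * ((a + ?e n) * (b + ?e n)))"
  proof (intro always_eventually allI)
    fix n
    have "?e n > 0" by simp
    then have "0 < a + ?e n" "a \<le> a + ?e n" "0 < b + ?e n" "b \<le> b + ?e n"
      using AB by linarith+
    then show "(\<integral>\<^sup>+x. ennreal (X x * Y x) \<partial>M) \<le> ennreal ((A + A') * ((a + ?e n) * (b + ?e n)))"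
      by (rule bound)
  qed
qed auto

lemma mf_product_integral:
  fixes u v :: "'a::euclidean_space \<Rightarrow> real"
  assumes u: "u \<in> borel_measurable borel" "\<And>x. u x \<ge> 0" "integrable lborel (\<lambda>x. u x powr p)"
    and v: "v \<in> borel_measurable borel" "\<And>x. v x \<ge> 0" "integrable lborel (\<lambda>x. v x powr p')"
    and pp': "1 < p" "1 / p + 1 / p' = 1" "p' > 1" and \<alpha>: "\<alpha> > 0" "p * \<alpha> > 1" and \<beta>: "\<beta> > 0"
        "p' * \<beta> > 1"
  shows "(\<integral>\<^sup>+x. ennreal (mf \<alpha> u x * mf \<beta> v x) \<partial>lborel)
    \<le> ennreal ((max_const TYPE('a) (p * \<alpha>) + max_const TYPE('a) (p' * \<beta>)) *
        ((LINT x|lborel. u x powr p) powr (1 / p) * (LINT x|lborel. v x powr p') powr (1 / p')))"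
proof (rule nn_integral_mult_le[OF _ _ mf_nonneg mf_nonneg pp'])
  have nn: "0 \<le> (LINT x|lborel. u x powr p)" "0 \<le> (LINT x|lborel. v x powr p')"
    by (simp_all add: integral_nonneg_AE)
  show "(\<integral>\<^sup>+x. ennreal (mf \<alpha> u x powr p) \<partial>lborel) \<le> ennreal (max_const TYPE('a) (p * \<alpha>) *
      ((LINT x|lborel. u x powr p) powr (1 / p)) powr p)"
    using mf_strong_type[OF u(1,2) \<alpha> u(3)] nn pp' by (simp add: powr_powr)
  show "(\<integral>\<^sup>+x. ennreal (mf \<beta> v x powr p') \<partial>lborel) \<le> ennreal (max_const TYPE('a) (p' * \<beta>) *
      ((LINT x|lborel. v x powr p') powr (1 / p')) powr p')"
    using mf_strong_type[OF v(1,2) \<beta> v(3)] nn pp' by (simp add: powr_powr)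
qed (use u v \<alpha> \<beta> max_const_nonneg in auto)

text \<open>The smallness of \<delta> turns the loss (t/s)^(N\<delta>) into a square root; any fixed
  power of t/s below the first would also be integrable in s in the end.\<close>

lemma bilinear_mf:
  fixes u v :: "'a::euclidean_space \<Rightarrow> real"
    and \<delta> :: real
  assumes u: "u \<in> borel_measurable borel" "\<And>x. u x \<ge> 0" "mf_finite \<alpha> u x"
    and v: "v \<in> borel_measurable borel" "\<And>x. v x \<ge> 0" "mf_finite \<beta> v x"
    and st: "0 < s" "s \<le> t"
    and exps: "0 < \<delta>" "\<delta> \<le> \<alpha>" "\<delta> \<le> \<beta>" "\<alpha> + \<beta> = 1 + \<delta>" "DIM('a) * \<delta> \<le> 1 / 2"
  shows "(\<integral>\<^sup>+y. \<integral>\<^sup>+z. ennreal (u y * v z * wt (2 * (DIM('a) + 1)) s (y - z) * wt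
      (2 * (DIM('a) + 1)) t (x - y)) \<partial>lborel \<partial>lborel)
    \<le> ennreal (3 * (wt_const TYPE('a))\<^sup>2 * sqrt (t / s) * (mf \<alpha> u x * mf \<beta> v x))"
proof -
  have \<alpha>\<beta>: "\<alpha> > 0" "\<beta> > 0" using exps by linarith+
  have "(\<integral>\<^sup>+y. \<integral>\<^sup>+z. ennreal (u y * v z * wt (2 * (DIM('a) + 1)) s (y - z) * wt (2 * (DIM('a) + 1))
      t (x - y)) \<partial>lborel \<partial>lborel)
    = (\<integral>\<^sup>+y. \<integral>\<^sup>+z. ennreal ((u y powr (1 / \<alpha>)) powr \<alpha> * (v z powr (1 / \<beta>)) powr \<beta> * wt
        (2 * (DIM('a) + 1)) s (y - z) * wt (2 * (DIM('a) + 1)) t (x - y)) \<partial>lborel \<partial>lborel)"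
    using \<alpha>\<beta> u(2) v(2) by (simp add: powr_powr)
  also have "\<dots> \<le> ennreal (3 * (wt_const TYPE('a))\<^sup>2 * ((t / s) ^ DIM('a)) powr \<delta> * mf \<alpha> u x
      * mf \<beta> v x)"
    unfolding mf_def using assms by (intro bilinear_wt_bound) (auto simp: mf_finite_def)
  also have "\<dots> \<le> ennreal (3 * (wt_const TYPE('a))\<^sup>2 * sqrt (t / s) * (mf \<alpha> u x * mf \<beta> v x))"
  proof -
    have "((t / s) ^ DIM('a)) powr \<delta> = (t / s) powr (DIM('a) * \<delta>)"
      using st by (simp add: powr_realpow[symmetric] powr_powr)
    also have "\<dots> \<le> (t / s) powr (1 / 2)"
      using st exps by (intro powr_mono) auto
    also have "\<dots> = sqrt (t / s)"
      using st by (simp add: powr_half_sqrt)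
    finally have "3 * (wt_const TYPE('a))\<^sup>2 * ((t / s) ^ DIM('a)) powr \<delta> * (mf \<alpha> u x * mf \<beta> v x)
        \<le> 3 * (wt_const TYPE('a))\<^sup>2 * sqrt (t / s) * (mf \<alpha> u x * mf \<beta> v x)"
      by (intro mult_right_mono mult_left_mono mult_nonneg_nonneg mf_nonneg) auto
    then show ?thesis by (simp add: mult.assoc ennreal_leI)
  qed
  finally show ?thesis .
qed

text \<open>Absolute convergence comes with the estimate. The decay about x is carried by f, as for
  a product with a dilated Schwartz function, and the kernel decays in y - z.\<close>

lemma bil_mf_bound:
  fixes f g k :: "real^'d::finite \<Rightarrow> complex"
    and \<delta> :: real
  assumes [measurable]: "f \<in> borel_measurable borel" "g \<in> borel_measurable borel"
      "k \<in> borel_measurable borel"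
    and u: "u \<in> borel_measurable borel" "\<And>x. u x \<ge> 0" "mf_finite \<alpha> u x"
    and v: "v \<in> borel_measurable borel" "\<And>x. v x \<ge> 0" "mf_finite \<beta> v x"
    and st: "0 < s" "s \<le> t"
    and exps: "0 < \<delta>" "\<delta> \<le> \<alpha>" "\<delta> \<le> \<beta>" "\<alpha> + \<beta> = 1 + \<delta>" "CARD('d) * \<delta> \<le> 1 / 2"
    and f: "\<And>y. cmod (f y) \<le> Cf * (u y * wt (2 * (CARD('d) + 1)) t (x - y))" and g:
        "\<And>z. cmod (g z) \<le> v z"
    and k: "\<And>w. cmod (k w) \<le> Ck * wt (2 * (CARD('d) + 1)) s w" and C: "Cf \<ge> 0" "Ck \<ge> 0"
  shows "cmod (bil f g k) \<le> Cf * Ck * (3 * (wt_const TYPE(real^'d))\<^sup>2 * sqrt (t / s) *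
      (mf \<alpha> u x * mf \<beta> v x))"
    (is "_ \<le> ?R")
proof -
  let ?K = "2 * (CARD('d) + 1)" and ?h = "\<lambda>q. f (fst q) * g (snd q) * k (fst q - snd q)"
  note [measurable] = u(1) v(1)
  have t: "t > 0" using st by linarith
  have R: "?R \<ge> 0" using C st t by (intro mult_nonneg_nonneg mf_nonneg) auto
  have pw: "cmod (f y * g z * k (y - z)) \<le> Cf * Ck * (u y * v z * wt ?K s (y - z) * wt ?K t
      (x - y))" for y z
  proof -
    have "cmod (f y * g z * k (y - z)) \<le> Cf * (u y * wt ?K t (x - y)) * v z *
        (Ck * wt ?K s (y - z))"
      unfolding norm_mult using C u v t by (intro mult_mono f g k mult_nonneg_nonneg wt_nonneg) auto
    then show ?thesis by (simp only: mult_ac)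
  qed
  have "(\<integral>\<^sup>+q. ennreal (cmod (?h q)) \<partial>(lborel \<Otimes>\<^sub>M lborel)) =
      (\<integral>\<^sup>+y. \<integral>\<^sup>+z. ennreal (cmod (f y * g z * k (y - z))) \<partial>lborel \<partial>lborel)"
    by (subst lborel.nn_integral_fst[symmetric]) auto
  also have "\<dots> \<le> (\<integral>\<^sup>+y. \<integral>\<^sup>+z. ennreal (Cf * Ck) * ennreal (u y * v z * wt ?K s (y - z) * wt ?K t
      (x - y)) \<partial>lborel \<partial>lborel)"
    by (intro nn_integral_mono) (simp only: ennreal_mult'[OF mult_nonneg_nonneg[OF C],
        symmetric], rule ennreal_leI[OF pw])
  also have "\<dots> = ennreal (Cf * Ck) * (\<integral>\<^sup>+y. \<integral>\<^sup>+z. ennreal (u y * v z * wt ?K s (y - z) * wt ?K t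
      (x - y)) \<partial>lborel \<partial>lborel)"
    by (simp add: nn_integral_cmult)
  also have "\<dots> \<le> ennreal (Cf * Ck) * ennreal (3 * (wt_const TYPE(real^'d))\<^sup>2 * sqrt (t / s) *
      (mf \<alpha> u x * mf \<beta> v x))"
    using bilinear_mf[OF u v st exps(1-4)] exps(5) by (intro mult_left_mono) auto
  also have "\<dots> = ennreal ?R"
    using C st t mf_nonneg[of \<alpha> u x] mf_nonneg[of \<beta> v x] by (subst ennreal_mult) auto
  finally have le: "(\<integral>\<^sup>+q. ennreal (cmod (?h q)) \<partial>(lborel \<Otimes>\<^sub>M lborel)) \<le> ennreal ?R" .
  have "integrable (lborel \<Otimes>\<^sub>M lborel) ?h"
  proof (rule integrableI_bounded)
    show "(\<integral>\<^sup>+q. ennreal (cmod (?h q)) \<partial>(lborel \<Otimes>\<^sub>M lborel)) < \<infinity>"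
      using le_less_trans[OF le] by simp
  qed measurable
  from order_trans[OF integral_norm_bound_ennreal[OF this] le]
  show ?thesis using R unfolding bil_def by (simp only: ennreal_le_iff)
qed

section \<open>Dilates of Schwartz functions\<close>

lemma schwartz_wt_bound:
  fixes \<phi> :: "real^'d::finite \<Rightarrow> complex"
  assumes "\<phi> \<in> schwartz_functions"
  obtains C where "C \<ge> 0" "\<And>w. cmod (\<phi> w) \<le> C * wt K 1 w" "\<And>k w. cmod (partial_deriv k \<phi> w) \<le> C
      * wt K 1 w"
proof -
  \<comment> \<open>One constant for \<phi> and its first partials: the empty list and the
    singletons form a finite set, so the maximum of their bounds exists.\<close>
  have "\<exists>B. \<forall>ks\<in>{[]} \<union> range (\<lambda>k. [k]). \<forall>x. (1 + norm x) ^ K * cmod (iter_partial ks \<phi> x) \<le> B"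
  proof -
    have "\<forall>ks. \<exists>B. \<forall>x. (1 + norm x) ^ K * cmod (iter_partial ks \<phi> x) \<le> B"
      using assms unfolding schwartz_functions_def by blast
    then obtain b where b: "\<And>ks x. (1 + norm x) ^ K * cmod (iter_partial ks \<phi> x) \<le> b ks" by metis
    have "b ks \<le> Max (b ` ({[]} \<union> range (\<lambda>k. [k])))" if "ks \<in> {[]} \<union> range (\<lambda>k. [k])" for ks
      using that by (intro Max_ge) auto
    then show ?thesis
      by (intro exI[of _ "Max (b ` ({[]} \<union> range (\<lambda>k. [k])))"] ballI allI order_trans[OF b])
  qed
  then obtain B where B: "\<And>ks x. ks \<in> {[]} \<union> range (\<lambda>k. [k]) \<Longrightarrow> (1 + norm x) ^ K * cmod
      (iter_partial ks \<phi> x) \<le> B"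
    by blast
  have *: "cmod z \<le> B * wt K 1 x" if "(1 + norm x) ^ K * cmod z \<le> B" for z and x :: "real^'d"
    using that one_plus_norm_power_pos[of 1 x K] by (simp add: wt_def pos_le_divide_eq mult.commute)
  have "0 \<le> B" using order_trans[OF _ B[of "[]" 0]] by simp
  moreover have "cmod (\<phi> w) \<le> B * wt K 1 w" "cmod (partial_deriv k \<phi> w) \<le> B * wt K 1 w" for k w
    using B[of "[]" w] B[of "[k]" w] by (auto intro!: * simp: iter_partial_def)
  ultimately show ?thesis by (rule that)
qed

lemma dilate_smooth: "smooth \<phi> \<Longrightarrow> smooth (\<lambda>y. dilate t \<phi> (x - y))"
proof -
  assume "smooth \<phi>"
  then have "smooth (\<lambda>y. complex_of_real (1 / t ^ CARD('a)) * \<phi> ((1 / t) *\<^sub>R x + (- 1 / t) *\<^sub>R y))"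
    by (intro smooth_mult smooth_const smooth_affine_comp)
  then show ?thesis by (simp add: dilate_def scaleR_diff_right)
qed

lemma partial_dilate:
  fixes \<phi> :: "real^'d::finite \<Rightarrow> complex"
  assumes "smooth \<phi>"
  shows "partial_deriv k (\<lambda>y. dilate t \<phi> (x - y)) y
    = of_real (- 1 / t) * (of_real (1 / t ^ CARD('d)) * partial_deriv k \<phi> ((1 / t) *\<^sub>R (x - y)))"
proof -
  let ?g = "\<lambda>y. \<phi> ((1 / t) *\<^sub>R x + (- 1 / t) *\<^sub>R y)"
  have arg: "(1 / t) *\<^sub>R x + (- 1 / t) *\<^sub>R y = (1 / t) *\<^sub>R (x - y)" for y
    by (simp add: scaleR_diff_right)
  have "partial_deriv k (\<lambda>y. complex_of_real (1 / t ^ CARD('d)) * ?g y) y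
      = complex_of_real (1 / t ^ CARD('d)) * partial_deriv k ?g y + partial_deriv k
          (\<lambda>y. complex_of_real (1 / t ^ CARD('d))) y * ?g y"
    by (intro partial_deriv_mult smooth_differentiable[OF smooth_const] smooth_differentiable[OF
        smooth_affine_comp[OF assms]])
  also have "partial_deriv k ?g y = of_real (- 1 / t) * partial_deriv k \<phi>
      ((1 / t) *\<^sub>R x + (- 1 / t) *\<^sub>R y)"
    by (rule partial_deriv_affine_comp[OF smooth_differentiable[OF assms]])
  finally show ?thesis
    unfolding arg dilate_def by simp
qed

lemma wt_dilate: "t > 0 \<Longrightarrow> 1 / t ^ CARD('d::finite) * wt K 1 ((1 / t) *\<^sub>R w) = wt K t (w :: real^'d)"
  by (simp add: wt_def)

text \<open>\<open>dilate\<close> and \<open>wt\<close> have the same normalisation, so a bound at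
  scale 1 passes to scale t with the same constant; a derivative brings out 1/t.\<close>

lemma dilate_bound:
  assumes "smooth \<phi>" and C: "\<And>w. cmod (\<phi> w) \<le> C * wt K 1 w" "\<And>k w. cmod (partial_deriv k \<phi> w) \<le> C
      * wt K 1 w" and "t > 0"
  shows "cmod (dilate t \<phi> (x - y)) \<le> C * wt K t (x - y)"
    and "cmod (partial_deriv k (\<lambda>y. dilate t \<phi> (x - y)) y) \<le> C / t * wt K t (x - y)"
proof -
  let ?w = "(1 / t) *\<^sub>R (x - y)" and ?T = "1 / t ^ CARD('a)"
  have T: "?T \<ge> 0" using \<open>t > 0\<close> by simp
  have 1: "?T * (C * wt K 1 ?w) = C * wt K t (x - y)"
    unfolding wt_dilate[OF \<open>t > 0\<close>, symmetric] by (simp only: mult_ac)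
  have "cmod (dilate t \<phi> (x - y)) = ?T * cmod (\<phi> ?w)"
    unfolding dilate_def norm_mult norm_of_real using T by simp
  also have "\<dots> \<le> ?T * (C * wt K 1 ?w)" by (intro mult_left_mono C T)
  finally show "cmod (dilate t \<phi> (x - y)) \<le> C * wt K t (x - y)" unfolding 1 .
  have "cmod (partial_deriv k (\<lambda>y. dilate t \<phi> (x - y)) y) = 1 / t *
      (?T * cmod (partial_deriv k \<phi> ?w))"
    unfolding partial_dilate[OF assms(1)] norm_mult norm_of_real using T \<open>t > 0\<close> by simp
  also have "\<dots> \<le> 1 / t * (?T * (C * wt K 1 ?w))" using \<open>t > 0\<close> by (intro mult_left_mono C T) simp
  finally show "cmod (partial_deriv k (\<lambda>y. dilate t \<phi> (x - y)) y) \<le> C / t * wt K t (x - y)"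
      unfolding 1 by simp
qed

section \<open>Pointwise control of the smooth maximal function\<close>

context heat_kernel
begin

text \<open>The first summand in the bracket is the boundary term at s = t. The second collects the
  terms of \<open>div_curl_identity\<close>, with the 2 from the integral of 1/(sqrt s sqrt t).
  Division by \<open>cmod mass\<close> makes up for the unnormalised Gaussian.\<close>

definition point_const :: "real \<Rightarrow> real" where
  "point_const C\<phi> = 3 * (wt_const TYPE(real^'d))\<^sup>2 * CARD('n) * C\<phi> *
     (gk_const (2 * (CARD('d) + 1))
      + 2 * (2 * b_const * gk_const (2 * (CARD('d) + 1) + 1)) * (1 + CARD('n) * c_const
          + CARD('n))) / cmod mass"

lemma point_const_nonneg: "C\<phi> \<ge> 0 \<Longrightarrow> point_const C\<phi> \<ge> 0"
  unfolding point_const_def using c_const_nonneg gk_const_pos b_const_bounds(1)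
  by (intro divide_nonneg_nonneg mult_nonneg_nonneg add_nonneg_nonneg) (auto intro: less_imp_le)

text \<open>Every term of \<open>div_curl_identity\<close> is a form with a kernel at scale s and a
  factor decaying about x at scale t, so \<open>bil_mf_bound\<close> applies. The result does not
  depend on t and therefore survives the supremum over t.\<close>

lemma pointwise_bound:
  fixes V W :: "'n \<Rightarrow> real^'d \<Rightarrow> complex"
    and \<delta> :: real
  assumes pp': "1 < p" "1 / p + 1 / p' = 1"
    and div: "\<And>\<psi>. \<psi> \<in> test_functions \<Longrightarrow>
      (\<Sum>k\<in>UNIV. LINT x|lborel. (\<Sum>j\<in>UNIV. cnj (c$j$k) * V j x) * partial_deriv k \<psi> x) =
          (LINT x|lborel. D x * \<psi> x)"
    and curl: "\<And>i j \<psi>. \<psi> \<in> test_functions \<Longrightarrow>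
      (\<Sum>k\<in>UNIV. LINT x|lborel. (c$j$k * W i x - c$i$k * W j x) * partial_deriv k \<psi> x) =
          (LINT x|lborel. R i j x * \<psi> x)"
    and Lq: "\<And>j. Lq p (V j)" "Lq p D" "\<And>j. Lq p' (W j)" "\<And>i j. Lq p' (R i j)"
    and v: "v \<in> borel_measurable borel" "\<And>y. v y \<ge> 0" "mf_finite \<alpha> v x" "\<And>j y. cmod (V j y) \<le> v y"
    and d: "d \<in> borel_measurable borel" "\<And>y. d y \<ge> 0" "mf_finite \<alpha> d x" "\<And>y. cmod (D y) \<le> d y"
    and w: "w \<in> borel_measurable borel" "\<And>y. w y \<ge> 0" "mf_finite \<beta>' w x" "\<And>j y. cmod (W j y) \<le> w y"
    and r: "r \<in> borel_measurable borel" "\<And>y. r y \<ge> 0" "mf_finite \<beta>' r x" "\<And>i j y. cmod (R i j y)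
        \<le> r y"
    and exps: "0 < \<delta>" "\<delta> \<le> \<alpha>" "\<delta> \<le> \<beta>'" "\<alpha> + \<beta>' = 1 + \<delta>" "CARD('d) * \<delta> \<le> 1 / 2"
    and \<phi>: "smooth \<phi>" "\<And>w. cmod (\<phi> w) \<le> C\<phi> * wt (2 * (CARD('d) + 1)) 1 w"
      "\<And>k w. cmod (partial_deriv k \<phi> w) \<le> C\<phi> * wt (2 * (CARD('d) + 1)) 1 w" "C\<phi> \<ge> 0"
    and t: "0 < t" "t < 1"
  shows "cmod (\<Sum>j\<in>UNIV. LINT y|lborel. (V j y * dilate t \<phi> (x - y)) * cnj (W j y))
    \<le> point_const C\<phi> * (mf \<alpha> v x * mf \<beta>' w x + mf \<alpha> d x * mf \<beta>' w x + mf \<alpha> v x * mf \<beta>' r x)"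
proof -
  let ?K = "2 * (CARD('d) + 1)" and ?T = "3 * (wt_const TYPE(real^'d))\<^sup>2" and ?n = "real CARD('n)"
  define \<Phi> where "\<Phi> y = dilate t \<phi> (x - y)" for y
  define H where "H = 2 * b_const * gk_const (?K + 1)"
  have H: "H \<ge> 0" unfolding H_def using gk_const_pos[of "?K + 1"] b_const_bounds(1) by simp
  note dil = dilate_bound[OF \<phi>(1-3) t(1)]
  have p: "p > 0" using pp' by simp
  have sm: "smooth \<Phi>" unfolding \<Phi>_def by (rule dilate_smooth[OF \<phi>(1)])
  have \<Phi>_le: "cmod (\<Phi> y) \<le> C\<phi> * wt ?K t (x - y)" for y
    unfolding \<Phi>_def by (rule dil(1))
  have \<Phi>'_le: "cmod (partial_deriv k \<Phi> y) \<le> C\<phi> / t * wt ?K t (x - y)" for k y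
    unfolding \<Phi>_def by (rule dil(2))
  have \<Phi>_bd: "cmod (\<Phi> y) \<le> C\<phi> * (1 / t ^ CARD('d))" for y
    by (rule order_trans[OF \<Phi>_le]) (use wt_le_power[OF t(1), of ?K "x - y"] \<phi>(4) in
        \<open>intro mult_left_mono; simp\<close>)
  have \<Phi>'_bd: "cmod (partial_deriv k \<Phi> y) \<le> C\<phi> / t * (1 / t ^ CARD('d))" for k y
    by (rule order_trans[OF \<Phi>'_le]) (use wt_le_power[OF t(1), of ?K "x - y"] \<phi>(4) t in
        \<open>intro mult_left_mono; simp\<close>)
  define L\<Phi> where "L\<Phi> j y = (\<Sum>k\<in>UNIV. cnj (c$j$k) * partial_deriv k \<Phi> y)" for j y
  have [measurable]: "V j \<in> borel_measurable borel" "D \<in> borel_measurable borel"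
      "(\<lambda>z. cnj (W j z)) \<in> borel_measurable borel"
    "(\<lambda>z. cnj (R i j z)) \<in> borel_measurable borel" "\<Phi> \<in> borel_measurable borel"
        "partial_deriv k \<Phi> \<in> borel_measurable borel"
    "L\<Phi> j \<in> borel_measurable borel" "hk i s \<in> borel_measurable borel" for i j k s
    using LqD(1)[OF Lq(1)] LqD(1)[OF Lq(2)] LqD(1)[OF Lq_cnj[OF Lq(3)]] LqD(1)[OF Lq_cnj[OF Lq(4)]]
      smooth_borel[OF sm] partial_deriv_borel[OF sm] smooth_borel[OF smooth_hk]
    unfolding L\<Phi>_def by measurable
  have L\<Phi>_le: "cmod (L\<Phi> j y) \<le> c_const * C\<phi> / t * wt ?K t (x - y)" for j y
  proof -
    have "cmod (L\<Phi> j y) \<le> (\<Sum>k\<in>UNIV. cmod (c$j$k) * (C\<phi> / t * wt ?K t (x - y)))"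
      unfolding L\<Phi>_def by (intro order_trans[OF norm_sum] sum_mono)
          (simp only: norm_mult complex_mod_cnj, intro mult_left_mono \<Phi>'_le, simp)
    also have "\<dots> = (\<Sum>k\<in>UNIV. cmod (c$j$k)) * (C\<phi> / t * wt ?K t (x - y))"
      by (simp only: sum_distrib_right)
    also have "\<dots> \<le> c_const * (C\<phi> / t * wt ?K t (x - y))"
      unfolding c_const_def using \<phi>(4) t
      by (intro mult_right_mono member_le_sum[of j UNIV "\<lambda>j. \<Sum>k\<in>UNIV. cmod (c$j$k)"]
          mult_nonneg_nonneg wt_nonneg) (auto intro!: sum_nonneg)
    finally show ?thesis by simp
  qed
  have V\<Phi>_le: "cmod (V j y * \<Phi> y) \<le> C\<phi> * (v y * wt ?K t (x - y))" for j y
    using mult_mono[OF v(4)[of j y] \<Phi>_le[of y] v(2)] by (simp add: norm_mult mult_ac)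
  have D\<Phi>_le: "cmod (D y * \<Phi> y) \<le> C\<phi> * (d y * wt ?K t (x - y))" for y
    using mult_mono[OF d(4)[of y] \<Phi>_le[of y] d(2)] by (simp add: norm_mult mult_ac)
  have VL_le: "cmod (V j y * L\<Phi> j y) \<le> c_const * C\<phi> / t * (v y * wt ?K t (x - y))" for j y
    using mult_mono[OF v(4)[of j y] L\<Phi>_le[of j y] v(2)] by (simp add: norm_mult mult_ac)
  have hk_le: "cmod (hk i s u) \<le> H / s * wt ?K s u" if "s > 0" for i s u
    unfolding H_def by (rule hk_bound[OF that])
  have cW_le: "cmod (cnj (W j y)) \<le> w y" and cR_le: "cmod (cnj (R i j y)) \<le> r y" for i j y
    using w(4) r(4) by simp_all
  let ?X = "mf \<alpha> v x * mf \<beta>' w x" and ?Y = "mf \<alpha> d x * mf \<beta>' w x" and ?Z = "mf \<alpha> v x * mf \<beta>' r x"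
  have XYZ: "?X \<ge> 0" "?Y \<ge> 0" "?Z \<ge> 0" by (intro mult_nonneg_nonneg mf_nonneg)+
  define S where "S = ?X + ?Y + ?Z"
  \<comment> \<open>For each i there is one term with D, one term per j with a derivative of \<Phi>,
    and one term per j with R.\<close>
  define N where "N = 1 + ?n * c_const + ?n"
  have N: "N \<ge> 0" using c_const_nonneg by (simp add: N_def)
  have "cmod (mass * (\<Sum>j\<in>UNIV. LINT y|lborel. (V j y * \<Phi> y) * cnj (W j y)))
      \<le> ?n * (C\<phi> * gk_const ?K * (?T * S)) + 2 * (?n * H * C\<phi> * ?T * N * S)"
  proof (rule mass_integral_bound[OF _ _ pp'])
    show "Lq p (\<lambda>y. V j y * \<Phi> y)" for j
      by (rule Lq_mult_bounded[OF Lq(1) _ \<Phi>_bd p]) measurable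
    show "Lq p' (\<lambda>y. cnj (W j y))" for j by (rule Lq_cnj[OF Lq(3)])
    show "0 < t" "t \<le> 1" using t by auto
    show "0 \<le> ?n * H * C\<phi> * ?T * N * S"
      using H \<phi>(4) N XYZ by (simp add: S_def)
    show "cmod (\<Sum>j\<in>UNIV. bil (\<lambda>y. V j y * \<Phi> y) (\<lambda>y. cnj (W j y)) (gk t)) \<le> ?n *
        (C\<phi> * gk_const ?K * (?T * S))"
    proof -
      have "cmod (bil (\<lambda>y. V j y * \<Phi> y) (\<lambda>y. cnj (W j y)) (gk t)) \<le> C\<phi> * gk_const ?K * (?T * S)"
          for j
      proof -
        have "cmod (bil (\<lambda>y. V j y * \<Phi> y) (\<lambda>y. cnj (W j y)) (gk t)) \<le> C\<phi> * gk_const ?K *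
            (?T * sqrt (t / t) * ?X)"
          by (rule bil_mf_bound[OF _ _ _ v(1-3) w(1-3) t(1) order_refl exps V\<Phi>_le cW_le
              gk_bound[OF t(1)] \<phi>(4) less_imp_le[OF gk_const_pos]]) measurable
        also have "\<dots> \<le> C\<phi> * gk_const ?K * (?T * S)"
        proof -
          have "?X \<le> S" using XYZ by (simp add: S_def)
          then have "?T * sqrt (t / t) * ?X \<le> ?T * S" using t by (simp add: mult_left_mono)
          moreover have "C\<phi> * gk_const ?K \<ge> 0" using \<phi>(4) less_imp_le[OF gk_const_pos] by
              (intro mult_nonneg_nonneg)
          ultimately show ?thesis by (rule mult_left_mono)
        qed
        finally show ?thesis .
      qed
      then show ?thesis
        by (intro order_trans[OF norm_sum] order_trans[OF sum_bounded_above]) auto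
    qed
    show "cmod (of_real (s / 2) * (\<Sum>j\<in>UNIV. bil (\<lambda>y. V j y * \<Phi> y) (\<lambda>y. cnj (W j y)) (lap s)))
        \<le> (?n * H * C\<phi> * ?T * N * S) / (sqrt s * sqrt t)" if s: "0 < s" "s \<le> t" for s
    proof -
      let ?b1 = "\<lambda>i. bil (\<lambda>y. D y * \<Phi> y) (\<lambda>z. cnj (W i z)) (hk i s)"
        and ?b2 = "\<lambda>i j. bil (\<lambda>y. V j y * L\<Phi> j y) (\<lambda>z. cnj (W i z)) (hk i s)"
        and ?b3 = "\<lambda>i j. bil (\<lambda>y. V j y * \<Phi> y) (\<lambda>z. cnj (R i j z)) (hk i s)"
      \<comment> \<open>The common size of all terms: H/s from the kernel, the bilinear bound with
        its square-root loss, and C\<phi>/t from a differentiated dilate.\<close>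
      define q where "q = H / s * (?T * sqrt (t / s)) * C\<phi> / t"
      have q: "q \<ge> 0" unfolding q_def using H s t \<phi>(4) by simp
      \<comment> \<open>Terms in which \<Phi> is not differentiated lack 1/t; as t < 1 this factor
        may be inserted. Here the local nature of h^1 enters.\<close>
      have t1: "1 \<le> 1 / t" using t by simp
      have Hs: "H / s \<ge> 0" using H s by simp
      have scale: "C\<phi> * (H / s) * (?T * sqrt (t / s) * A) \<le> q * A" if "A \<ge> 0" for A
      proof -
        have "C\<phi> * (H / s) * (?T * sqrt (t / s) * A) * 1 \<le> C\<phi> * (H / s) * (?T * sqrt (t / s) * A)
            * (1 / t)"
          using that s t H \<phi>(4) by (intro mult_left_mono t1 mult_nonneg_nonneg) auto
        then show ?thesis by (simp add: q_def mult_ac)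
      qed
      have b1: "cmod (?b1 i) \<le> q * ?Y" for i
        by (rule order_trans[OF bil_mf_bound[OF _ _ _ d(1-3) w(1-3) s exps D\<Phi>_le cW_le
            hk_le[OF s(1)] \<phi>(4) Hs] scale[OF XYZ(2)]]) measurable
      have b2: "cmod (?b2 i j) \<le> q * (c_const * ?X)" for i j
      proof -
        have "cmod (?b2 i j) \<le> c_const * C\<phi> / t * (H / s) * (?T * sqrt (t / s) * ?X)"
          by (rule bil_mf_bound[OF _ _ _ v(1-3) w(1-3) s exps VL_le cW_le hk_le[OF s(1)] _ Hs])
             (measurable, use c_const_nonneg \<phi>(4) t in simp)
        then show ?thesis by (simp add: q_def mult_ac)
      qed
      have b3: "cmod (?b3 i j) \<le> q * ?Z" for i j
        by (rule order_trans[OF bil_mf_bound[OF _ _ _ v(1-3) r(1-3) s exps V\<Phi>_le cR_le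
            hk_le[OF s(1)] \<phi>(4) Hs] scale[OF XYZ(3)]]) measurable
      have b2': "cmod (\<Sum>j\<in>UNIV. ?b2 i j) \<le> ?n * (q * (c_const * ?X))" for i
        using b2 by (intro order_trans[OF norm_sum] order_trans[OF sum_bounded_above]) auto
      have b3': "cmod (\<Sum>j\<in>UNIV. ?b3 i j) \<le> ?n * (q * ?Z)" for i
        using b3 by (intro order_trans[OF norm_sum] order_trans[OF sum_bounded_above]) auto
      have tri: "cmod (a - b + e) \<le> cmod a + cmod b + cmod e" for a b e :: complex
        by (rule order_trans[OF norm_triangle_ineq add_right_mono[OF norm_triangle_ineq4]])
      have sum_le: "q * ?Y + ?n * (q * (c_const * ?X)) + ?n * (q * ?Z) \<le> q * (N * S)"
      proof -
        have "?Y + ?n * (c_const * ?X) + ?n * ?Z \<le> N * S"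
        proof -
          have "N * S = ?Y + ?n * (c_const * ?X) + ?n * ?Z
             + (?X + ?Z + ?n * c_const * (?Y + ?Z) + ?n * (?X + ?Y))"
            by (simp add: N_def S_def algebra_simps)
          moreover have "0 \<le> ?X + ?Z + ?n * c_const * (?Y + ?Z) + ?n * (?X + ?Y)"
            using c_const_nonneg by (intro add_nonneg_nonneg mult_nonneg_nonneg mf_nonneg) auto
          ultimately show ?thesis by linarith
        qed
        then have "q * (?Y + ?n * (c_const * ?X) + ?n * ?Z) \<le> q * (N * S)"
          using q by (rule mult_left_mono)
        then show ?thesis by (simp only: distrib_left mult_ac)
      qed
      have each: "cmod (?b1 i - (\<Sum>j\<in>UNIV. ?b2 i j) + (\<Sum>j\<in>UNIV. ?b3 i j)) \<le> q * (N * S)" for i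
        by (intro order_trans[OF tri] order_trans[OF add_mono[OF add_mono[OF b1 b2'] b3']] sum_le)
      have "(\<Sum>j\<in>UNIV. bil (\<lambda>y. V j y * \<Phi> y) (\<lambda>z. cnj (W j z)) (lap s))
          = (\<Sum>i\<in>UNIV. ?b1 i - (\<Sum>j\<in>UNIV. ?b2 i j) + (\<Sum>j\<in>UNIV. ?b3 i j))"
        unfolding L\<Phi>_def by (rule div_curl_identity[OF pp' s(1) div curl Lq sm \<Phi>_bd \<Phi>'_bd])
      then have "cmod (\<Sum>j\<in>UNIV. bil (\<lambda>y. V j y * \<Phi> y) (\<lambda>z. cnj (W j z)) (lap s)) \<le> ?n *
          (q * (N * S))"
        using each by (simp only:) (intro order_trans[OF norm_sum]
            order_trans[OF sum_bounded_above], auto)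
      then have "cmod (of_real (s / 2) * (\<Sum>j\<in>UNIV. bil (\<lambda>y. V j y * \<Phi> y) (\<lambda>z. cnj (W j z))
          (lap s))) \<le> s / 2 * (?n * (q * (N * S)))"
        unfolding norm_mult norm_of_real using s by (intro mult_mono) auto
      also have "\<dots> \<le> s * (?n * (q * (N * S)))"
        using s q N XYZ by (intro mult_right_mono mult_nonneg_nonneg) (auto simp: S_def)
      \<comment> \<open>The factor s from the heat equation cancels the 1/s of the kernel, and only
        the integrable square root of 1/s is left.\<close>
      also have "\<dots> = ?n * H * C\<phi> * ?T * N * S * (sqrt (t / s) / t)"
        using s by (simp add: q_def)
      also have "sqrt (t / s) / t = 1 / (sqrt s * sqrt t)"
        using s t real_sqrt_mult_self[of t] by (simp add: real_sqrt_divide field_simps)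
      finally show ?thesis by simp
    qed
  qed
  also have "\<dots> = cmod mass * (point_const C\<phi> * S)"
    using mass_nonzero by (simp add: point_const_def H_def N_def field_simps)
  finally have "cmod (\<Sum>j\<in>UNIV. LINT y|lborel. (V j y * \<Phi> y) * cnj (W j y)) \<le> point_const C\<phi> * S"
    unfolding norm_mult using mass_nonzero by (simp add: mult_le_cancel_left)
  then show ?thesis by (simp add: \<Phi>_def S_def)
qed

end

subsection \<open>Borel representatives\<close>

text \<open>Coordinates in an orthonormal basis reduce this to real functions, at the price of
  finitely many null sets.\<close>

lemma borel_representative:
  fixes f :: "'a::euclidean_space \<Rightarrow> 'b::euclidean_space"
  assumes "f \<in> borel_measurable lebesgue"
  obtains g where "g \<in> borel_measurable borel" "AE x in lborel. f x = g x"
proof -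
  have "\<exists>g\<in>borel_measurable lborel. AE x in lborel. f x \<bullet> i = g x" for i
    by (rule completion_ex_borel_measurable_real) (use assms in measurable)
  then obtain g where g: "\<And>i. g i \<in> borel_measurable lborel" "\<And>i. AE x in lborel. f x \<bullet> i = g i x"
    by metis
  have [measurable]: "g i \<in> borel_measurable borel" for i using g(1)[of i] by simp
  have "AE x in lborel. \<forall>i\<in>Basis. f x \<bullet> i = g i x"
    using g(2) by (intro AE_finite_allI) auto
  then have "AE x in lborel. f x = (\<Sum>i\<in>Basis. g i x *\<^sub>R i)"
  proof eventually_elim
    case (elim x)
    have "f x = (\<Sum>i\<in>Basis. (f x \<bullet> i) *\<^sub>R i)" by (simp add: euclidean_representation)
    also have "\<dots> = (\<Sum>i\<in>Basis. g i x *\<^sub>R i)" using elim by (intro sum.cong) auto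
    finally show ?case .
  qed
  moreover have "(\<lambda>x. \<Sum>i\<in>Basis. g i x *\<^sub>R i) \<in> borel_measurable borel" by measurable
  ultimately show ?thesis using that by blast
qed

lemma borel_measurable_nth:
  fixes f :: "'a \<Rightarrow> ('b::euclidean_space)^'n::finite"
  shows "f \<in> borel_measurable M \<Longrightarrow> (\<lambda>x. f x $ i) \<in> borel_measurable M"
  by (rule borel_measurable_continuous_on[where f = "\<lambda>v. v $ i"]) (auto intro: continuous_intros)

lemma LINT_lebesgue_representative:
  fixes f g :: "'a::euclidean_space \<Rightarrow> 'b::{banach, second_countable_topology}"
  assumes "f \<in> borel_measurable lebesgue" "g \<in> borel_measurable borel" "AE x in lborel. f x = g x"
  shows "(LINT x|lebesgue. f x) = (LINT x|lborel. g x)"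
      "integrable lebesgue f \<longleftrightarrow> integrable lborel g"
proof -
  have ae: "AE x in lebesgue. f x = g x" using assms(3) by (simp add: AE_completion)
  have g: "g \<in> borel_measurable lebesgue" "g \<in> borel_measurable lborel"
    using assms(2) by (auto intro: measurable_completion)
  show "(LINT x|lebesgue. f x) = (LINT x|lborel. g x)"
    using integral_cong_AE[OF assms(1) g(1) ae] integral_completion[OF g(2)] by simp
  show "integrable lebesgue f \<longleftrightarrow> integrable lborel g"
    using integrable_cong_AE[OF assms(1) g(1) ae] integrable_completion[OF g(2)] by simp
qed

lemma regular_dist_representative:
  assumes "f \<in> borel_measurable lebesgue" "g \<in> borel_measurable borel" "AE x in lborel. f x = g x"
    and \<psi>: "\<psi> \<in> borel_measurable borel"
  shows "regular_dist f \<psi> = (LINT x|lborel. g x * \<psi> x)"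
  unfolding regular_dist_def
proof (rule LINT_lebesgue_representative(1))
  have "\<psi> \<in> borel_measurable lebesgue" by (rule measurable_completion) (use \<psi> in simp)
  then show "(\<lambda>x. f x * \<psi> x) \<in> borel_measurable lebesgue" using assms(1) by measurable
  show "(\<lambda>x. g x * \<psi> x) \<in> borel_measurable borel" using assms(2) \<psi> by measurable
  show "AE x in lborel. f x * \<psi> x = g x * \<psi> x" using assms(3) by eventually_elim simp
qed

lemma Lp_representative:
  fixes f g :: "real^'d::finite \<Rightarrow> 'b::euclidean_space"
  assumes f: "f \<in> Lp_space p" and g: "g \<in> borel_measurable borel" "AE x in lborel. f x = g x"
  shows "integrable lborel (\<lambda>x. norm (g x) powr p)"
      "Lp_norm p f = (LINT x|lborel. norm (g x) powr p) powr (1 / p)"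
proof -
  have fm: "f \<in> borel_measurable lebesgue" "integrable lebesgue (\<lambda>x. norm (f x) powr p)"
    using f by (auto simp: Lp_space_def)
  have m: "(\<lambda>x. norm (f x) powr p) \<in> borel_measurable lebesgue"
      "(\<lambda>x. norm (g x) powr p) \<in> borel_measurable borel"
    using fm(1) g(1) by measurable
  have ae: "AE x in lborel. norm (f x) powr p = norm (g x) powr p" using g(2) by eventually_elim
      simp
  show "integrable lborel (\<lambda>x. norm (g x) powr p)"
    using LINT_lebesgue_representative(2)[OF m ae] fm(2) by simp
  show "Lp_norm p f = (LINT x|lborel. norm (g x) powr p) powr (1 / p)"
    unfolding Lp_norm_def LINT_lebesgue_representative(1)[OF m ae] ..
qed

text \<open>An integrable function pairs with bounded functions, and the seminorm of order 0 is
  already the supremum norm.\<close>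

lemma tempered_regular_dist:
  fixes f :: "real^'d::finite \<Rightarrow> complex"
  assumes f: "integrable lebesgue f"
  shows "tempered (regular_dist f)"
proof -
  have [measurable]: "f \<in> borel_measurable lebesgue" using f by auto
  have bound: "\<exists>B. \<forall>x. cmod (\<psi> x) \<le> B" if "\<psi> \<in> schwartz_functions" for \<psi> :: "real^'d \<Rightarrow> complex"
  proof -
    have "\<exists>B. \<forall>x. (1 + norm x) ^ 0 * cmod (iter_partial [] \<psi> x) \<le> B"
      using that unfolding schwartz_functions_def by blast
    then show ?thesis by (simp add: iter_partial_def)
  qed
  have \<psi>_m: "\<psi> \<in> borel_measurable lebesgue" if "\<psi> \<in> schwartz_functions" for \<psi> :: "real^'d \<Rightarrow> complex"
    by (rule measurable_completion) (use that smooth_borel in \<open>auto simp: schwartz_functions_def\<close>)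
  have int: "integrable lebesgue (\<lambda>x. f x * \<psi> x)" if \<psi>: "\<psi> \<in> schwartz_functions" for \<psi>
  proof -
    obtain B where B: "\<And>x. cmod (\<psi> x) \<le> B" using bound[OF \<psi>] by blast
    note [measurable] = \<psi>_m[OF \<psi>]
    show ?thesis
    proof (rule Bochner_Integration.integrable_bound)
      show "integrable lebesgue (\<lambda>x. B * cmod (f x))" using f by simp
      show "AE x in lebesgue. cmod (f x * \<psi> x) \<le> norm (B * cmod (f x))"
      proof (intro AE_I2)
        fix x
        have "cmod (f x * \<psi> x) \<le> B * cmod (f x)"
          using mult_right_mono[OF B[of x], of "cmod (f x)"] by (simp add: norm_mult mult.commute)
        then show "cmod (f x * \<psi> x) \<le> norm (B * cmod (f x))" by simp
      qed
    qed measurable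
  qed
  have sn: "cmod (\<psi> x) \<le> schwartz_seminorm 0 \<psi>" if \<psi>: "\<psi> \<in> schwartz_functions" for \<psi> and x ::
      "real^'d"
  proof -
    obtain B where B: "\<And>x. cmod (\<psi> x) \<le> B" using bound[OF \<psi>] by blast
    have "cmod (\<psi> x) = (\<lambda>(ks, x). (1 + norm x) ^ 0 * cmod (iter_partial ks \<psi> x)) ([], x)"
      by (simp add: iter_partial_def)
    also have "\<dots> \<le> schwartz_seminorm 0 \<psi>"
      unfolding schwartz_seminorm_def
    proof (rule cSUP_upper)
      show "bdd_above ((\<lambda>(ks, x). (1 + norm x) ^ 0 * cmod (iter_partial ks \<psi> x)) `
          ({ks. length ks \<le> 0} \<times> UNIV))"
        by (rule bdd_aboveI[of _ B]) (use B in \<open>auto simp: iter_partial_def\<close>)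
    qed simp
    finally show ?thesis .
  qed
  have le: "cmod (regular_dist f \<psi>) \<le> (LINT x|lebesgue. cmod (f x)) * schwartz_seminorm 0 \<psi>" if
      \<psi>: "\<psi> \<in> schwartz_functions" for \<psi>
  proof -
    have "cmod (regular_dist f \<psi>) \<le> (LINT x|lebesgue. cmod (f x * \<psi> x))"
      unfolding regular_dist_def by (rule Bochner_Integration.integral_norm_bound)
    also have "\<dots> \<le> (LINT x|lebesgue. cmod (f x) * schwartz_seminorm 0 \<psi>)"
      using f by (intro Bochner_Integration.integral_mono integrable_norm[OF int[OF \<psi>]])
        (auto simp: norm_mult intro: mult_left_mono sn[OF \<psi>])
    finally show ?thesis by simp
  qed
  show ?thesis
    unfolding tempered_def
  proof (intro conjI ballI allI exI)
    fix \<psi> \<eta> :: "real^'d \<Rightarrow> complex" assume "\<psi> \<in> schwartz_functions" "\<eta> \<in> schwartz_functions"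
    then show "regular_dist f (\<lambda>x. \<psi> x + \<eta> x) = regular_dist f \<psi> + regular_dist f \<eta>"
      unfolding regular_dist_def using int by (simp add: distrib_left)
  next
    fix a and \<psi> :: "real^'d \<Rightarrow> complex"
    have "(\<lambda>x. f x * (a * \<psi> x)) = (\<lambda>x. a * (f x * \<psi> x))" by (simp add: mult_ac)
    then show "regular_dist f (\<lambda>x. a * \<psi> x) = a * regular_dist f \<psi>"
      unfolding regular_dist_def by simp
  next
    fix \<psi> :: "real^'d \<Rightarrow> complex" assume "\<psi> \<in> schwartz_functions"
    then show "cmod (regular_dist f \<psi>) \<le> (LINT x|lebesgue. cmod (f x)) * schwartz_seminorm 0 \<psi>"
      by (rule le)
  qed
qed

lemma LINT_sum_cmult_test:
  assumes "\<And>j. Lq q (V j)" "q \<ge> 1" "\<psi> \<in> test_functions"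
  shows "(LINT x|lborel. (\<Sum>j\<in>UNIV. a j * V j x) * \<psi> x) = (\<Sum>j\<in>(UNIV::'n::finite set). a j *
      (LINT x|lborel. V j x * \<psi> x))"
proof -
  note i = test_integrable[OF assms]
  have "(LINT x|lborel. (\<Sum>j\<in>UNIV. a j * V j x) * \<psi> x) =
      (LINT x|lborel. (\<Sum>j\<in>UNIV. a j * (V j x * \<psi> x)))"
    by (simp add: sum_distrib_right mult.assoc)
  also have "\<dots> = (\<Sum>j\<in>UNIV. LINT x|lborel. a j * (V j x * \<psi> x))"
    using i by (intro Bochner_Integration.integral_sum) auto
  finally show ?thesis by simp
qed

theorem theoremA:
  fixes c :: "complex^'d::finite^'n::finite"
    and p p' :: real
    and \<phi> :: "real^'d \<Rightarrow> complex"
  assumes "CARD('d) \<ge> 2" and "CARD('n) \<ge> 2"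
    and "elliptic_system c" and "lin_indep_system c"
    and "1 < p" and "1 / p + 1 / p' = 1"
    and "\<phi> \<in> schwartz_functions" and "(LINT x|lebesgue. \<phi> x) \<noteq> 0"
  shows "\<exists>C>0. \<forall>(V :: real^'d \<Rightarrow> complex^'n) (W :: real^'d \<Rightarrow> complex^'n)
            (D :: real^'d \<Rightarrow> complex) (R :: real^'d \<Rightarrow> complex^'n^'n).
      V \<in> Lp_space p \<and> W \<in> Lp_space p' \<and>
      D \<in> Lp_space p \<and> dist_represented_by (div_adj c V) D \<and>
      R \<in> Lp_space p' \<and> (\<forall>i j. dist_represented_by (curl_sys c W i j) (\<lambda>x. R x $ i $ j)) \<longrightarrow>
      regular_dist (\<lambda>x. hermitian (V x) (W x)) \<in> h1_space \<phi> \<and>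
      h1_norm \<phi> (regular_dist (\<lambda>x. hermitian (V x) (W x)))
        \<le> ennreal (C * (Lp_norm p V * Lp_norm p' W + Lp_norm p D * Lp_norm p' W
                        + Lp_norm p V * Lp_norm p' R))"
proof -
  note pp' = assms(5,6)
  have p': "p' > 1" by (rule conjugate_exponent_gt_1[OF pp'])
  have p0: "p > 0" "p \<ge> 1" "p' > 0" "p' \<ge> 1" using pp' p' by auto
  obtain B \<beta> where "heat_kernel c B \<beta>" by (rule elliptic_imp_heat_kernel[OF assms(3)])
  then interpret heat_kernel c B \<beta> .
  define K where "K = 2 * (CARD('d) + 1)"
  have \<phi>_smooth: "smooth \<phi>" using assms(7) by (simp add: schwartz_functions_def)
  obtain C\<phi> where C\<phi>: "C\<phi> \<ge> 0" "\<And>w. cmod (\<phi> w) \<le> C\<phi> * wt K 1 w" "\<And>k w. cmod (partial_deriv k \<phi> w)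
      \<le> C\<phi> * wt K 1 w"
    by (rule schwartz_wt_bound[OF assms(7), of K]) blast
  \<comment> \<open>\<delta> \<le> 1/(2N) limits the loss to a square root, while \<delta> \<le> 1/p
    and \<delta> \<le> 1/p' ensure \<delta> \<le> a and \<delta> \<le> b.\<close>
  define \<delta> where "\<delta> = min (1 / (2 * CARD('d))) (min (1 / p) (1 / p'))"
  \<comment> \<open>The excess \<delta> is split evenly, which puts both maximal operators strictly
    inside their range: p a > 1 and p' b > 1.\<close>
  define a b where "a = 1 / p + \<delta> / 2" and "b = 1 / p' + \<delta> / 2"
  have \<delta>: "0 < \<delta>" "\<delta> \<le> 1 / (2 * CARD('d))" "\<delta> \<le> 1 / p" "\<delta> \<le> 1 / p'"
    using p0 by (auto simp: \<delta>_def)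
  have exps: "0 < \<delta>" "\<delta> \<le> a" "\<delta> \<le> b" "a + b = 1 + \<delta>" "CARD('d) * \<delta> \<le> 1 / 2"
    using \<delta> pp'(2) by (auto simp: a_def b_def field_simps)
  have ab: "a > 0" "b > 0" "p * a > 1" "p' * b > 1"
    using \<delta> p0 by (auto simp: a_def b_def distrib_left add_pos_pos)
  define A where "A = max_const TYPE(real^'d) (p * a) + max_const TYPE(real^'d) (p' * b)"
  have A: "A \<ge> 0" unfolding A_def using max_const_nonneg ab by (intro add_nonneg_nonneg) auto
  define P where "P = point_const C\<phi>"
  have P: "P \<ge> 0" unfolding P_def by (rule point_const_nonneg[OF C\<phi>(1)])
  show ?thesis
  proof (intro exI[of _ "P * A + 1"] conjI allI impI)
    \<comment> \<open>Only P A \<ge> 0 has been established; adding 1 makes the constant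
      positive.\<close>
    show "0 < P * A + 1" using P A by (simp add: add_nonneg_pos)
    fix V W :: "real^'d \<Rightarrow> complex^'n" and D :: "real^'d \<Rightarrow> complex" and R ::
        "real^'d \<Rightarrow> complex^'n^'n"
    assume "V \<in> Lp_space p \<and> W \<in> Lp_space p' \<and>
      D \<in> Lp_space p \<and> dist_represented_by (div_adj c V) D \<and>
      R \<in> Lp_space p' \<and> (\<forall>i j. dist_represented_by (curl_sys c W i j) (\<lambda>x. R x $ i $ j))"
    then have Lp: "V \<in> Lp_space p" "W \<in> Lp_space p'" "D \<in> Lp_space p" "R \<in> Lp_space p'"
      and divD: "dist_represented_by (div_adj c V) D"
      and curlR: "\<And>i j. dist_represented_by (curl_sys c W i j) (\<lambda>x. R x $ i $ j)" by blast+
    have lm: "V \<in> borel_measurable lebesgue" "W \<in> borel_measurable lebesgue"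
        "D \<in> borel_measurable lebesgue" "R \<in> borel_measurable lebesgue"
      using Lp by (auto simp: Lp_space_def)
    \<comment> \<open>The data enter only through integrals and almost everywhere statements, so
      Borel representatives may replace them.\<close>
    obtain V0 where V0: "V0 \<in> borel_measurable borel" "AE x in lborel. V x = V0 x" by
        (rule borel_representative[OF lm(1)])
    obtain W0 where W0: "W0 \<in> borel_measurable borel" "AE x in lborel. W x = W0 x" by
        (rule borel_representative[OF lm(2)])
    obtain D0 where D0: "D0 \<in> borel_measurable borel" "AE x in lborel. D x = D0 x" by
        (rule borel_representative[OF lm(3)])
    obtain R0 where R0: "R0 \<in> borel_measurable borel" "AE x in lborel. R x = R0 x" by
        (rule borel_representative[OF lm(4)])
    note intV = Lp_representative[OF Lp(1) V0] and intW = Lp_representative[OF Lp(2) W0]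
      and intD = Lp_representative[OF Lp(3) D0] and intR = Lp_representative[OF Lp(4) R0]
    have Lq_comp: "Lq q g" if "integrable lborel (\<lambda>x. u x powr q)" "g \<in> borel_measurable borel"
        "\<And>x. cmod (g x) \<le> u x" "q > 0"
      for q g and u :: "real^'d \<Rightarrow> real"
      unfolding Lq_def
    proof (intro conjI that(2) Bochner_Integration.integrable_bound[OF that(1)] AE_I2)
      show "(\<lambda>x. cmod (g x) powr q) \<in> borel_measurable lborel" using that(2) by measurable
      show "norm (cmod (g x) powr q) \<le> norm (u x powr q)" for x
        using that(3)[of x] \<open>q > 0\<close> by (simp add: powr_mono2)
    qed
    have LV: "Lq p (\<lambda>x. V0 x $ j)" for j
      by (rule Lq_comp[OF intV(1)]) (auto intro: borel_measurable_nth V0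
          Finite_Cartesian_Product.norm_nth_le p0)
    have LW: "Lq p' (\<lambda>x. W0 x $ j)" for j
      by (rule Lq_comp[OF intW(1)]) (auto intro: borel_measurable_nth W0
          Finite_Cartesian_Product.norm_nth_le p0)
    have LD: "Lq p D0"
      by (rule Lq_comp[OF intD(1)]) (auto intro: D0 p0)
    have R_le: "cmod (R0 x $ i $ j) \<le> norm (R0 x)" for x i j
      by (rule order_trans[OF Finite_Cartesian_Product.norm_nth_le
          Finite_Cartesian_Product.norm_nth_le])
    have LR: "Lq p' (\<lambda>x. R0 x $ i $ j)" for i j
      by (rule Lq_comp[OF intR(1) borel_measurable_nth[OF borel_measurable_nth[OF R0(1)]] R_le
          p0(3)])
    have repV: "regular_dist (\<lambda>x. V x $ j) \<psi> = (LINT x|lborel. V0 x $ j * \<psi> x)" if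
        "\<psi> \<in> borel_measurable borel" for j \<psi>
      by (rule regular_dist_representative[OF _ _ _ that])
          (use V0 lm(1) in \<open>auto intro: borel_measurable_nth\<close>)
    have repW: "regular_dist (\<lambda>x. W x $ j) \<psi> = (LINT x|lborel. W0 x $ j * \<psi> x)" if
        "\<psi> \<in> borel_measurable borel" for j \<psi>
      by (rule regular_dist_representative[OF _ _ _ that])
          (use W0 lm(2) in \<open>auto intro: borel_measurable_nth\<close>)
    have repR: "regular_dist (\<lambda>x. R x $ i $ j) \<psi> = (LINT x|lborel. R0 x $ i $ j * \<psi> x)" if
        "\<psi> \<in> borel_measurable borel" for i j \<psi>
      by (rule regular_dist_representative[OF borel_measurable_nth[OF borel_measurable_nth[OF
          lm(4)]]
            borel_measurable_nth[OF borel_measurable_nth[OF R0(1)]] _ that]) (use R0(2) in auto)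
    have test_m: "\<psi> \<in> borel_measurable borel" "partial_deriv k \<psi> \<in> borel_measurable borel" if
        "\<psi> \<in> test_functions" for \<psi> :: "real^'d \<Rightarrow> complex" and k
      using that by (auto simp: test_functions_def intro: smooth_borel partial_deriv_borel)
    \<comment> \<open>The minus signs of the adjoint and of the distributional derivative
      cancel.\<close>
    have div: "(\<Sum>k\<in>UNIV. LINT x|lborel. (\<Sum>j\<in>UNIV. cnj (c$j$k) * V0 x $ j) * partial_deriv k \<psi> x)
        = (LINT x|lborel. D0 x * \<psi> x)"
      if \<psi>: "\<psi> \<in> test_functions" for \<psi>
    proof -
      have "(\<Sum>k\<in>UNIV. LINT x|lborel. (\<Sum>j\<in>UNIV. cnj (c$j$k) * V0 x $ j) * partial_deriv k \<psi> x)
          = (\<Sum>k\<in>UNIV. \<Sum>j\<in>UNIV. cnj (c$j$k) * (LINT x|lborel. V0 x $ j * partial_deriv k \<psi> x))"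
        by (intro sum.cong refl LINT_sum_cmult_test[OF LV p0(2) test_partial[OF \<psi>]])
      also have "\<dots> = (\<Sum>j\<in>UNIV. \<Sum>k\<in>UNIV. cnj (c$j$k) * (LINT x|lborel. V0 x $ j
          * partial_deriv k \<psi> x))"
        by (rule sum.swap)
      also have "\<dots> = div_adj c V \<psi>"
        by (simp add: div_adj_def vf_apply_def vf_adjoint_def dist_partial_def
            repV[OF test_m(2)[OF \<psi>]])
      also have "\<dots> = regular_dist D \<psi>" using divD \<psi> by (simp add: dist_represented_by_def)
      also have "\<dots> = (LINT x|lborel. D0 x * \<psi> x)"
        by (rule regular_dist_representative[OF lm(3) D0 test_m(1)[OF \<psi>]])
      finally show ?thesis .
    qed
    \<comment> \<open>The single minus sign of the distributional derivative reverses the order of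
      the two terms.\<close>
    have curl: "(\<Sum>k\<in>UNIV. LINT x|lborel. (c$j$k * W0 x $ i - c$i$k * W0 x $ j)
        * partial_deriv k \<psi> x) = (LINT x|lborel. R0 x $ i $ j * \<psi> x)"
      if \<psi>: "\<psi> \<in> test_functions" for i j \<psi>
    proof -
      have "(LINT x|lborel. (c$j$k * W0 x $ i - c$i$k * W0 x $ j) * partial_deriv k \<psi> x)
          = c$j$k * (LINT x|lborel. W0 x $ i * partial_deriv k \<psi> x) - c$i$k *
              (LINT x|lborel. W0 x $ j * partial_deriv k \<psi> x)" for k
      proof -
        note I = test_integrable[OF LW p0(4) test_partial[OF \<psi>]]
        have "(\<lambda>x. (c$j$k * W0 x $ i - c$i$k * W0 x $ j) * partial_deriv k \<psi> x)
            = (\<lambda>x. c$j$k * (W0 x $ i * partial_deriv k \<psi> x) - c$i$k *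
                (W0 x $ j * partial_deriv k \<psi> x))"
          by (simp add: left_diff_distrib mult.assoc)
        then show ?thesis using I by simp
      qed
      then have "(\<Sum>k\<in>UNIV. LINT x|lborel. (c$j$k * W0 x $ i - c$i$k * W0 x $ j)
          * partial_deriv k \<psi> x) = curl_sys c W i j \<psi>"
        by (simp add: curl_sys_def vf_apply_def dist_partial_def repW[OF test_m(2)[OF \<psi>]]
            sum_subtractf sum_negf)
      also have "\<dots> = regular_dist (\<lambda>x. R x $ i $ j) \<psi>" using curlR \<psi> by
          (simp add: dist_represented_by_def)
      also have "\<dots> = (LINT x|lborel. R0 x $ i $ j * \<psi> x)" by (rule repR[OF test_m(1)[OF \<psi>]])
      finally show ?thesis .
    qed
    let ?h = "\<lambda>x. hermitian (V x) (W x)" and ?g = "\<lambda>x. \<Sum>j\<in>UNIV. V0 x $ j * cnj (W0 x $ j)"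
    have h0_int: "integrable lborel ?g"
      by (intro Bochner_Integration.integrable_sum Lq_mult_integrable(1)[OF LV Lq_cnj[OF LW] pp'])
    have h0_m: "?g \<in> borel_measurable borel"
      by (intro borel_measurable_sum borel_measurable_times LqD(1)[OF LV] LqD(1)[OF Lq_cnj[OF LW]])
    have h_m: "?h \<in> borel_measurable lebesgue"
    proof -
      have "(\<lambda>x. V x $ j) \<in> borel_measurable lebesgue"
          "(\<lambda>x. cnj (W x $ j)) \<in> borel_measurable lebesgue" for j
        using borel_measurable_nth[OF lm(1)] borel_measurable_continuous_on[OF
            continuous_on_cnj[OF continuous_on_id] borel_measurable_nth[OF lm(2)]] by auto
      then show ?thesis
        unfolding hermitian_def by (intro borel_measurable_sum borel_measurable_times)
    qed
    have h_ae: "AE x in lborel. ?h x = ?g x"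
      using V0(2) W0(2) by eventually_elim (simp add: hermitian_def)
    have "integrable lebesgue ?h"
      using LINT_lebesgue_representative(2)[OF h_m h0_m h_ae] h0_int by simp
    then have temp: "tempered (regular_dist ?h)" by (rule tempered_regular_dist)
    let ?v = "\<lambda>x. norm (V0 x)" and ?w = "\<lambda>x. norm (W0 x)" and ?d = "\<lambda>x. cmod (D0 x)" and ?r =
        "\<lambda>x. norm (R0 x)"
    have vm: "?v \<in> borel_measurable borel" "?w \<in> borel_measurable borel"
        "?d \<in> borel_measurable borel" "?r \<in> borel_measurable borel"
      using V0(1) W0(1) D0(1) R0(1) by measurable
    note [measurable] = vm
    let ?M = "\<lambda>x. mf a ?v x * mf b ?w x + mf a ?d x * mf b ?w x + mf a ?v x * mf b ?r x"
    have h_dil: "regular_dist ?h (\<lambda>y. dilate t \<phi> (x - y)) = (\<Sum>j\<in>UNIV. LINT y|lborel.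
        (V0 y $ j * dilate t \<phi> (x - y)) * cnj (W0 y $ j))"
      if "t > 0" for t x
    proof -
      have sm: "smooth (\<lambda>y. dilate t \<phi> (x - y))" by (rule dilate_smooth[OF \<phi>_smooth])
      have "cmod (dilate t \<phi> (x - y)) \<le> C\<phi> * (1 / t ^ CARD('d))" for y
        by (rule order_trans[OF dilate_bound(1)[OF \<phi>_smooth C\<phi>(2,3) that]])
           (use wt_le_power[OF that, of K "x - y"] C\<phi>(1) in \<open>intro mult_left_mono; simp\<close>)
      then have "Lq p (\<lambda>y. V0 y $ j * dilate t \<phi> (x - y))" for j
        by (rule Lq_mult_bounded[OF LV smooth_borel[OF sm] _ p0(1)])
      note i = Lq_mult_integrable(1)[OF this Lq_cnj[OF LW] pp']
      have "regular_dist ?h (\<lambda>y. dilate t \<phi> (x - y)) = (LINT y|lborel. ?g y * dilate t \<phi> (x - y))"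
        by (rule regular_dist_representative[OF h_m h0_m h_ae smooth_borel[OF sm]])
      also have "\<dots> = (LINT y|lborel. (\<Sum>j\<in>UNIV. (V0 y $ j * dilate t \<phi> (x - y)) * cnj (W0 y $ j)))"
        unfolding sum_distrib_right by (intro Bochner_Integration.integral_cong refl sum.cong)
            (simp only: mult_ac)
      also have "\<dots> = (\<Sum>j\<in>UNIV. LINT y|lborel. (V0 y $ j * dilate t \<phi> (x - y)) * cnj (W0 y $ j))"
        by (rule Bochner_Integration.integral_sum) (rule i)
      finally show ?thesis .
    qed
    have fin: "AE x in lborel. mf_finite a ?v x" "AE x in lborel. mf_finite b ?w x"
        "AE x in lborel. mf_finite a ?d x" "AE x in lborel. mf_finite b ?r x"
      by (rule mf_AE_finite[OF vm(1) norm_ge_zero ab(1,3) intV(1)]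
          mf_AE_finite[OF vm(2) norm_ge_zero ab(2,4) intW(1)]
        mf_AE_finite[OF vm(3) norm_ge_zero ab(1,3) intD(1)] mf_AE_finite[OF vm(4) norm_ge_zero
            ab(2,4) intR(1)])+
    \<comment> \<open>The four maximal functions are finite off a null set that does not depend on
      t, so the supremum over t can be taken at each remaining x.\<close>
    have max_le: "AE x in lborel. local_maximal \<phi> (regular_dist ?h) x \<le> ennreal (P * ?M x)"
      using fin
    proof eventually_elim
      case (elim x)
      show ?case unfolding local_maximal_def
      proof (rule SUP_least)
        fix t :: real assume "t \<in> {0<..<1}"
        then have t: "0 < t" "t < 1" by auto
        have "cmod (regular_dist ?h (\<lambda>y. dilate t \<phi> (x - y))) \<le> P * ?M x"
          unfolding h_dil[OF t(1)] P_def
          by (rule pointwise_bound[OF pp' div curl LV LD LW LR vm(1) norm_ge_zero elim(1)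
              Finite_Cartesian_Product.norm_nth_le
                vm(3) norm_ge_zero elim(3) order_refl vm(2) norm_ge_zero elim(2)
                    Finite_Cartesian_Product.norm_nth_le
                vm(4) norm_ge_zero elim(4) R_le exps \<phi>_smooth C\<phi>(2,3)[unfolded K_def] C\<phi>(1) t])
        then show "ennreal (cmod (regular_dist ?h (\<lambda>y. dilate t \<phi> (x - y)))) \<le> ennreal (P * ?M x)"
          by (rule ennreal_leI)
      qed
    qed
    let ?N = "Lp_norm p V * Lp_norm p' W + Lp_norm p D * Lp_norm p' W + Lp_norm p V * Lp_norm p' R"
    have N: "Lp_norm p V * Lp_norm p' W \<ge> 0" "Lp_norm p D * Lp_norm p' W \<ge> 0"
        "Lp_norm p V * Lp_norm p' R \<ge> 0"
      by (simp_all add: Lp_norm_def)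
    have mm: "(\<lambda>x. mf a ?v x * mf b ?w x) \<in> borel_measurable borel"
        "(\<lambda>x. mf a ?d x * mf b ?w x) \<in> borel_measurable borel"
        "(\<lambda>x. mf a ?v x * mf b ?r x) \<in> borel_measurable borel"
      by measurable
    have nn: "mf e u x * mf e' u' x \<ge> 0" for e e' u u' and x :: "real^'d" by
        (intro mult_nonneg_nonneg mf_nonneg)
    have "h1_norm \<phi> (regular_dist ?h) = (\<integral>\<^sup>+x. local_maximal \<phi> (regular_dist ?h) x \<partial>lborel)"
      unfolding h1_norm_def nn_integral_completion ..
    also have "\<dots> \<le> (\<integral>\<^sup>+x. ennreal (P * ?M x) \<partial>lborel)"
      by (rule nn_integral_mono_AE[OF max_le])
    also have "\<dots> = ennreal P * ((\<integral>\<^sup>+x. ennreal (mf a ?v x * mf b ?w x) \<partial>lborel) +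
        (\<integral>\<^sup>+x. ennreal (mf a ?d x * mf b ?w x) \<partial>lborel)
        + (\<integral>\<^sup>+x. ennreal (mf a ?v x * mf b ?r x) \<partial>lborel))"
      using P nn mm by (simp add: ennreal_mult nn_integral_cmult nn_integral_add)
    also have "\<dots> \<le> ennreal P * (ennreal (A * (Lp_norm p V * Lp_norm p' W)) + ennreal
        (A * (Lp_norm p D * Lp_norm p' W)) + ennreal (A * (Lp_norm p V * Lp_norm p' R)))"
      unfolding A_def intV(2) intW(2) intD(2) intR(2)
      by (intro mult_left_mono add_mono mf_product_integral vm norm_ge_zero intV(1) intW(1)
          intD(1) intR(1) pp' p' ab) auto
    also have "\<dots> = ennreal (P * A * ?N)"
      using P A N by (simp add: ennreal_mult[symmetric] ennreal_plus[symmetric] distrib_left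
          mult.assoc del: ennreal_plus)
    also have "\<dots> \<le> ennreal ((P * A + 1) * ?N)"
      using N by (intro ennreal_leI mult_right_mono) auto
    finally show h1: "h1_norm \<phi> (regular_dist ?h) \<le> ennreal ((P * A + 1) * ?N)" .
    show "regular_dist ?h \<in> h1_space \<phi>"
      unfolding h1_space_def using temp le_less_trans[OF h1] by simp
  qed
qed

end
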